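(* Let $(X_i)_{i\ge 1}$ be i.i.d. real random variables with $\mathbb E X_1=0$, $\mathbb E X_1^2=\sigma^2\in(0,\infty)$ and $\mathbb E|X_1|^{2+\delta}<\infty$ for some $\delta>0$. (i) There exist $\varepsilon>0$ and a constant $c_\varepsilon>0$ such that for any sequence of positive numbers $(\alpha_n)_{n\ge1}$ with $\lim_{n\to\infty}\alpha_n=0$, for all $n\ge1$, $t\in\mathbb R_+$ and $x\in[0,\alpha_n\sqrt n]$, $$\left|\mathbb P\Big(\frac{x+S_n}{\sigma\sqrt n}\le t,\ \tau_x>n\Big)-\frac{2V(x)}{\sigma\sqrt{2\pi n}}\,\Phi^+(t)\right|\le c_\varepsilon\big(\alpha_n+n^{-\varepsilon}\big)\frac{1+x}{n^{1/2}}.$$ (ii) There exist $\varepsilon\in(0,\frac12)$ and a constant $c_\varepsilon>0$ such that for any $\beta\in(0,\frac12-\varepsilon)$, for all $n\ge1$, $t\in\mathbb R_+$ and $x\ge n^\beta$, $$\left|\mathbb P\Big(\frac{x+S_n}{\sigma\sqrt n}\le t,\ \tau_x>n\Big)-\int_0^t\psi\Big(s,\frac{x}{\sigma\sqrt n}\Big)\,ds\right|\le c_\varepsilon\,\frac{1+\min\{x,n^{1/2-\varepsilon}\}}{n^{1/2+\varepsilon\beta}}.$$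
   Context: Notation: $\mathbb R_+=[0,\infty)$; $S_n=\sum_{i=1}^n X_i$; for $x\ge0$, $\tau_x=\inf\{k\ge1:\ x+S_k<0\}$; $V(x)=-\mathbb E S_{\tau_x}$ for $x\ge0$ (well defined under the stated assumptions); $\Phi^+(t)=(1-e^{-t^2/2})\mathbf 1_{\{t\ge0\}}$; $\psi(s,x)=\frac1{\sqrt{2\pi}}\big(e^{-(s-x)^2/2}-e^{-(s+x)^2/2}\big)$ for $s,x\in\mathbb R$. By the paper's convention, a constant $c_\varepsilon$ depends only on its index $\varepsilon$ (and on the law of $X_1$). *)

theory Defs
  imports "HOL-Probability.Probability"
begin

definition walk :: "(nat \<Rightarrow> 'a \<Rightarrow> real) \<Rightarrow> nat \<Rightarrow> 'a \<Rightarrow> real" where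
  "walk X n w = (\<Sum>i=1..n. X i w)"

text \<open>The exit time takes values in \<^typ>\<open>enat\<close>, so that the infimum of the empty set
  (the walk never leaves) is \<open>\<infinity>\<close>.\<close>

definition exit_time :: "(nat \<Rightarrow> 'a \<Rightarrow> real) \<Rightarrow> real \<Rightarrow> 'a \<Rightarrow> enat" where
  "exit_time X x w = Inf {enat k | k. k \<ge> 1 \<and> x + walk X k w < 0}"

text \<open>The value \<open>0\<close> on the event that the exit time is infinite is a dummy: for a centred walk with
  finite positive variance this event is null, and the stopped walk is integrable.\<close>

definition walk_at_exit :: "(nat \<Rightarrow> 'a \<Rightarrow> real) \<Rightarrow> real \<Rightarrow> 'a \<Rightarrow> real" where
  "walk_at_exit X x w = (case exit_time X x w of enat k \<Rightarrow> walk X k w | \<infinity> \<Rightarrow> 0)"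

definition V :: "'a measure \<Rightarrow> (nat \<Rightarrow> 'a \<Rightarrow> real) \<Rightarrow> real \<Rightarrow> real" where
  "V M X x = - (\<integral>w. walk_at_exit X x w \<partial>M)"

definition Phi_plus :: "real \<Rightarrow> real" where
  "Phi_plus t = (1 - exp (- (t\<^sup>2 / 2))) * indicator {0..} t"

definition psi :: "real \<Rightarrow> real \<Rightarrow> real" where
  "psi s x = 1 / sqrt (2 * pi) * (exp (- ((s - x)\<^sup>2 / 2)) - exp (- ((s + x)\<^sup>2 / 2)))"

end

theory Submission
  imports Defs
begin

text \<open>Let \<open>u v y\<close> be the probability that Brownian motion started at \<open>y\<close> and run for time \<open>v\<close> stays
  positive and ends in \<open>[0, T]\<close>. Being odd in \<open>y\<close>, it extends smoothly across \<open>0\<close> to a solution of the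
  heat equation on the whole line, so Lindeberg's telescoping of \<open>u (v - \<sigma>\<^sup>2 k) (x + S\<^sub>k)\<close> up to the exit
  time involves no boundary layer: the error of step \<open>k\<close> carries the factor \<open>P(\<tau> > k)\<close>, which is
  \<open>O((1 + x) / sqrt k)\<close>, and the value at the exit time is, to first order, the slope of \<open>u\<close> at \<open>0\<close> times
  the overshoot. Hence \<open>P(x + S\<^sub>n \<le> T, \<tau> > n)\<close> is \<open>u (\<sigma>\<^sup>2 n) x\<close> plus the slope times the mean
  overshoot \<open>V x - x\<close>, up to \<open>O((1 + x) n powr (-1/2 - \<epsilon>))\<close>. The overshoot is controlled by the Lyapunov
  function \<open>(a + y) powr (1 - d)\<close>, and the survival probability by the martingale bound
  \<open>E(x + S\<^sub>n; \<tau> > n) = O(1 + x)\<close> together with a concentration inequality that comes from the same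
  telescoping argument.\<close>

section \<open>The Gaussian integral\<close>

text \<open>The indicator of [0, T] is not smooth, so the telescoping stops while a variance v =
  \<open>smooth n\<close> is still to run. The Lindeberg errors then total v^(-d) times the survival
  factor, and the mismatch between u and the indicator is confined to windows around 0 and T, which
  the concentration inequality handles.

  Concentration and survival seem to need each other. The circle is broken by halving time:
  concentration at time n is bounded through survival at time n/2, while survival at n splits into
  high positions (Markov's inequality for the martingale) and low ones (concentration). A tuned
  window width makes this recursion a contraction.

  For (i), u is linearised in the starting point, so that x and the mean overshoot multiply the same
  slope and add up to V(x). For (ii), u is kept and the overshoot term, of order x^(1-d) / sqrt n,
  becomes an error. Its gain x^(-d), at most n^(-d \<beta>), is the origin of the product of
  \<epsilon> and \<beta> in the exponent. Well beyond sqrt n, exit before time n is itself unlikely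
  and the survival factor is dispensable.\<close>

definition gphi :: "real \<Rightarrow> real" where
  "gphi z = exp (- (z\<^sup>2 / 2)) / sqrt (2 * pi)"

text \<open>This is the standard normal distribution function minus 1/2. The centring makes it odd,
  so that solutions built by reflection vanish at 0 by symmetry alone.\<close>

definition gint :: "real \<Rightarrow> real" where
  "gint z = (LBINT s=0..z. gphi s)"

lemma gphi_std_normal: "gphi = std_normal_density"
  by (rule ext) (simp add: gphi_def std_normal_density_def)

lemma gphi_pos: "gphi z > 0"
  by (simp add: gphi_def)

lemma gphi_even: "gphi (- z) = gphi z"
  by (simp add: gphi_def)

lemma gphi_continuous: "continuous_on S gphi"
  unfolding gphi_def by (intro continuous_intros) auto

lemma DERIV_gphi: "(gphi has_real_derivative (- z * gphi z)) (at z)"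
  unfolding gphi_def by (auto intro!: derivative_eq_intros simp: field_simps)

lemma DERIV_gphi_chain [derivative_intros]:
  assumes "(f has_real_derivative D) (at x within S)"
  shows "((\<lambda>x. gphi (f x)) has_real_derivative (- f x * gphi (f x)) * D) (at x within S)"
  using DERIV_chain2[OF DERIV_gphi assms] .

lemma DERIV_gint: "(gint has_real_derivative gphi z) (at z)"
proof -
  let ?a = "min 0 z - 1" and ?b = "max 0 z + 1"
  have "((\<lambda>u. LBINT y=ereal 0..ereal u. gphi y) has_vector_derivative (gphi z)) (at z within {?a..?b})"
    by (rule interval_integral_FTC2) (auto intro: gphi_continuous)
  then have "(gint has_vector_derivative gphi z) (at z within {?a..?b})"
    unfolding gint_def by (simp add: zero_ereal_def)
  moreover have "at z within {?a..?b} = at z"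
    by (rule at_within_Icc_at) auto
  ultimately show ?thesis
    by (simp add: has_real_derivative_iff_has_vector_derivative)
qed

lemma DERIV_gint_chain [derivative_intros]:
  assumes "(f has_real_derivative D) (at x within S)"
  shows "((\<lambda>x. gint (f x)) has_real_derivative gphi (f x) * D) (at x within S)"
  using DERIV_chain2[OF DERIV_gint assms] .

lemma gint_continuous: "continuous_on S gint"
  using DERIV_gint DERIV_continuous_on has_field_derivative_at_within by blast

lemma gint_measurable [measurable]: "gint \<in> borel_measurable borel"
  using gint_continuous by (rule borel_measurable_continuous_onI)

lemma gint_0 [simp]: "gint 0 = 0"
  by (simp add: gint_def zero_ereal_def)

lemma gint_odd: "gint (- z) = - gint z"
proof -
  have "\<forall>x. ((\<lambda>z. gint z + gint (- z)) has_real_derivative 0) (at x)"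
    by (auto intro!: derivative_eq_intros simp: gphi_even)
  from DERIV_isconst_all[OF this, of z 0] show ?thesis by simp
qed

lemma gint_strict_mono: "x < y \<Longrightarrow> gint x < gint y"
  by (rule DERIV_pos_imp_increasing) (auto intro: DERIV_gint gphi_pos)

lemma gint_mono: "x \<le> y \<Longrightarrow> gint x \<le> gint y"
  using gint_strict_mono[of x y] by (cases "x = y") auto

lemma gint_double:
  assumes "z \<ge> 0"
  shows "2 * gint z = measure (density lborel std_normal_density) {-z..z}"
proof -
  have "has_bochner_integral lborel (\<lambda>x. gphi x * indicator {-z..z} x) (gint z - gint (-z))"
    using assms by (intro has_bochner_integral_FTC_Icc_real DERIV_gint)
      (auto intro!: DERIV_isCont[OF DERIV_gphi])
  then have "(\<integral>x. gphi x * indicator {-z..z} x \<partial>lborel) = 2 * gint z"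
    by (auto simp: has_bochner_integral_iff gint_odd)
  moreover have "measure (density lborel std_normal_density) {-z..z} = (\<integral>x. indicator {-z..z} x \<partial>density lborel std_normal_density)"
    by simp
  moreover have "\<dots> = (\<integral>x. gphi x * indicator {-z..z} x \<partial>lborel)"
    by (subst integral_density) (auto simp: gphi_std_normal)
  ultimately show ?thesis by simp
qed

lemma gint_abs_le: "\<bar>gint z\<bar> \<le> 1/2"
proof -
  interpret prob_space "density lborel std_normal_density" by (rule prob_space_normal_density) simp
  have "2 * gint \<bar>z\<bar> \<le> 1"
    by (subst gint_double) (auto intro: prob_le_1)
  then have "gint \<bar>z\<bar> \<le> 1/2" "gint \<bar>z\<bar> \<ge> 0"
    using gint_mono[of 0 "\<bar>z\<bar>"] by auto
  then show ?thesis by (cases "z \<ge> 0") (auto simp: gint_odd)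
qed

text \<open>Chebyshev's inequality with variance 1. Polynomial decay is enough, since all final
  rates are powers of \<open>n\<close>.\<close>

lemma gint_tail:
  assumes "z > 0"
  shows "1 - 2 * gint z \<le> 1 / z\<^sup>2"
proof -
  let ?N = "density lborel std_normal_density"
  interpret prob_space ?N by (rule prob_space_normal_density) simp
  have hb: "has_bochner_integral lborel (\<lambda>x. std_normal_density x * x^2) 1"
    using std_normal_moment_even[of 1] by simp
  have int: "integrable ?N (\<lambda>x. x^2)" and eq: "(\<integral>x. x^2 \<partial>?N) = 1"
    using hb by (auto simp: integrable_density integral_density has_bochner_integral_iff normal_density_nonneg)
  have "1 - 2 * gint z = measure ?N (space ?N - {-z..z})"
    using assms by (subst prob_compl) (auto simp: gint_double)
  also have "\<dots> = (\<integral>x. indicator (space ?N - {-z..z}) x \<partial>?N)" by simp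
  also have "\<dots> \<le> (\<integral>x. x^2 / z^2 \<partial>?N)"
  proof (rule integral_mono)
    fix x
    show "indicator (space ?N - {-z..z}) x \<le> x^2/z^2"
    proof (cases "x \<in> {-z..z}")
      case False
      then have "\<bar>z\<bar> \<le> \<bar>x\<bar>" using assms by auto
      then have "z^2 \<le> x^2" by (simp add: abs_le_square_iff)
      then show ?thesis using assms by (simp add: indicator_def)
    qed simp
  qed (use int in \<open>auto intro!: integrable_real_indicator simp: emeasure_eq_measure\<close>)
  also have "\<dots> = 1 / z^2" using eq by simp
  finally show ?thesis .
qed

text \<open>The even powers come from 1 + s + s^2/2 at most exp s with s = z^2/2, the odd ones from
  the inequality between arithmetic and geometric means. These are the bounds behind all space and
  time derivatives of the heat flow used below.\<close>

lemma gphi_poly_bounds: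
  shows "gphi z \<le> 1/2" "\<bar>z\<bar> * gphi z \<le> 1" "z\<^sup>2 * gphi z \<le> 1" "\<bar>z\<bar>^3 * gphi z \<le> 3"
proof -
  define E where "E = exp (- (z\<^sup>2 / 2))"
  have E: "E > 0" "E \<le> 1" by (auto simp: E_def)
  have "2 \<le> sqrt (2 * pi)"
    using pi_gt3 by (intro real_le_rsqrt) auto
  then have le: "gphi z \<le> E / 2"
    unfolding gphi_def E_def[symmetric] using E by (intro divide_left_mono) auto
  then show 0: "gphi z \<le> 1/2" using E by simp
  have ex: "exp (z\<^sup>2/2) * E = 1" by (simp add: E_def exp_minus)
  have "1 + z\<^sup>2/2 + (z\<^sup>2/2)^2/2 \<le> exp (z\<^sup>2/2)"
    by (rule exp_lower_Taylor_quadratic) simp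
  then have "(1 + z\<^sup>2/2 + (z\<^sup>2/2)^2/2) * E \<le> 1"
    using mult_right_mono[of _ _ E] ex E by fastforce
  then have *: "E + z\<^sup>2 * E / 2 + z^4 * E / 8 \<le> 1"
    by (simp add: algebra_simps power2_eq_square power4_eq_xxxx)
  have nn: "z\<^sup>2 * E \<ge> 0" "z^4 * E \<ge> 0" using E by auto
  have "z\<^sup>2 * gphi z \<le> z\<^sup>2 * (E/2)" using le by (intro mult_left_mono) auto
  then show 2: "z\<^sup>2 * gphi z \<le> 1" using * nn E by linarith
  have "z^4 * gphi z \<le> z^4 * (E/2)" using le by (intro mult_left_mono) auto
  then have 4: "z^4 * gphi z \<le> 4" using * nn E by linarith
  have "2 * \<bar>z\<bar> \<le> 1 + z\<^sup>2" using sum_squares_ge_zero[of "\<bar>z\<bar> - 1" 0] by (simp add: power2_eq_square algebra_simps)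
  from mult_right_mono[OF this, of "gphi z"] show "\<bar>z\<bar> * gphi z \<le> 1"
    using 0 2 gphi_pos[of z] by (simp add: algebra_simps)
  have "2 * \<bar>z\<bar>^3 \<le> z\<^sup>2 + z^4"
  proof -
    have "0 \<le> (\<bar>z\<bar> - z\<^sup>2)^2" by simp
    also have "\<dots> = z\<^sup>2 + z^4 - 2 * \<bar>z\<bar>^3"
      by (cases "z \<ge> 0") (simp_all add: eval_nat_numeral algebra_simps)
    finally show ?thesis by simp
  qed
  from mult_right_mono[OF this, of "gphi z"] show "\<bar>z\<bar>^3 * gphi z \<le> 3"
    using 4 2 gphi_pos[of z] by (simp add: algebra_simps)
qed

lemma gphi_der2_bound: "\<bar>(z\<^sup>2 - 1) * gphi z\<bar> \<le> 1"
proof -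
  have "0 \<le> z\<^sup>2 * gphi z" using gphi_pos[of z] by simp
  then show ?thesis
    using gphi_poly_bounds(1,3)[of z] gphi_pos[of z] unfolding left_diff_distrib by linarith
qed

lemma gint_lipschitz: "\<bar>gint x - gint y\<bar> \<le> \<bar>x - y\<bar>"
proof -
  have "\<bar>gint b - gint a\<bar> \<le> \<bar>b - a\<bar>" if ab: "a < b" for a b
  proof -
    obtain z where "gint b - gint a = (b - a) * gphi z"
      using MVT2[OF ab DERIV_gint] by auto
    then show ?thesis using that gphi_poly_bounds(1)[of z] gphi_pos[of z]
      by (simp add: abs_mult mult_left_le)
  qed
  from this[of x y] this[of y x] show ?thesis by (cases x y rule: linorder_cases) auto
qed

lemma gint_taylor3: "\<bar>gint (z + h) - gint z - gphi z * h + z * gphi z * h\<^sup>2 / 2\<bar> \<le> \<bar>h\<bar>^3"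
proof (cases "h = 0")
  case False
  define D where "D = (\<lambda>m::nat. if m = 0 then gint else if m = 1 then gphi
     else if m = 2 then (\<lambda>z. - z * gphi z) else (\<lambda>z. (z\<^sup>2 - 1) * gphi z))"
  let ?a = "min z (z + h)" and ?b = "max z (z + h)"
  have der: "\<forall>m t. m < 3 \<and> ?a \<le> t \<and> t \<le> ?b \<longrightarrow> (D m has_real_derivative D (Suc m) t) (at t)"
  proof (intro allI impI)
    fix m :: nat and t assume "m < 3 \<and> ?a \<le> t \<and> t \<le> ?b"
    then consider "m = 0" | "m = 1" | "m = 2" by linarith
    then show "(D m has_real_derivative D (Suc m) t) (at t)"
    proof cases
      case 1 then show ?thesis using DERIV_gint by (simp add: D_def)
    next
      case 2 then show ?thesis using DERIV_gphi by (simp add: D_def)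
    next
      case 3 then show ?thesis
        by (auto simp: D_def intro!: derivative_eq_intros) (simp add: algebra_simps power2_eq_square)
    qed
  qed
  have "\<exists>t. (if z + h < z then z + h < t \<and> t < z else z < t \<and> t < z + h) \<and>
      gint (z + h) = (\<Sum>m<3. D m z / fact m * (z + h - z)^m) + D 3 t / fact 3 * (z + h - z)^3"
    by (rule Taylor[where a="?a" and b="?b", OF _ _ der]) (use False in \<open>auto simp: D_def\<close>)
  then obtain t where t: "gint (z + h) = (\<Sum>m<3. D m z / fact m * h^m) + D 3 t / fact 3 * h^3"
    by auto
  have "gint (z + h) - gint z - gphi z * h + z * gphi z * h\<^sup>2 / 2 = (t\<^sup>2 - 1) * gphi t / 6 * h^3"
    unfolding t by (simp add: D_def eval_nat_numeral field_simps)
  then have "\<bar>gint (z + h) - gint z - gphi z * h + z * gphi z * h\<^sup>2 / 2\<bar> = \<bar>(t\<^sup>2 - 1) * gphi t\<bar> * (\<bar>h\<bar>^3 / 6)"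
    by (simp only: abs_mult abs_divide power_abs) simp
  also have "\<dots> \<le> 1 * (\<bar>h\<bar>^3 / 6)"
    by (intro mult_right_mono gphi_der2_bound) auto
  also have "\<dots> \<le> \<bar>h\<bar>^3" by simp
  finally show ?thesis by simp
qed simp

text \<open>Interpolation: for small \<open>h\<close> the cubic remainder is below the power
  \<open>q\<close>, for large \<open>h\<close> every term is at most of order h^2, hence also below
  it. This turns a finite moment of order \<open>q\<close> into a bound on the expected
  remainder.\<close>

lemma gint_taylor:
  assumes "2 \<le> q" "q \<le> 3"
  shows "\<bar>gint (z + h) - gint z - gphi z * h + z * gphi z * h\<^sup>2 / 2\<bar> \<le> 3 * \<bar>h\<bar> powr q"
proof (cases "\<bar>h\<bar> \<le> 1")
  case True
  have "\<bar>h\<bar>^3 \<le> \<bar>h\<bar> powr q"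
  proof (cases "h = 0")
    case False
    then have "\<bar>h\<bar> powr 3 \<le> \<bar>h\<bar> powr q" using True assms by (intro powr_mono') auto
    then show ?thesis using False by simp
  qed simp
  then show ?thesis using gint_taylor3[of z h] powr_ge_zero[of "\<bar>h\<bar>" q] by linarith
next
  case False
  have "\<bar>h\<bar>^2 = \<bar>h\<bar> powr 2" using False by simp
  also have "\<dots> \<le> \<bar>h\<bar> powr q" using False assms by (intro powr_mono) auto
  finally have *: "h^2 \<le> \<bar>h\<bar> powr q" by simp
  have h1: "1 \<le> \<bar>h\<bar>" using False by simp
  then have h: "\<bar>h\<bar> \<le> h^2"
    using mult_left_mono[OF h1, of "\<bar>h\<bar>"] by (simp add: power2_eq_square)
  then have h2: "1 \<le> h^2" using h1 by linarith
  have "\<bar>gphi z * h\<bar> \<le> \<bar>h\<bar>/2"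
    using mult_right_mono[OF gphi_poly_bounds(1)[of z], of "\<bar>h\<bar>"] gphi_pos[of z] by (simp add: abs_mult)
  moreover have "\<bar>z * gphi z * h\<^sup>2 / 2\<bar> \<le> h\<^sup>2 / 2"
    using gphi_poly_bounds(2)[of z] gphi_pos[of z] by (simp add: abs_mult mult_left_le_one_le)
  moreover have "\<bar>gint (z+h)\<bar> \<le> 1/2" "\<bar>gint z\<bar> \<le> 1/2" by (rule gint_abs_le)+
  ultimately show ?thesis using * h h2 by linarith
qed

section \<open>The heat flow of the sign function\<close>

text \<open>Half the expected sign of \<open>y\<close> plus a centred Gaussian of variance
  \<open>v\<close>. Time is measured in variance, so one step of the walk corresponds to the time
  increment \<open>\<sigma>\<^sup>2\<close>; \<open>heat' v\<close> is the Gaussian density of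
  variance \<open>v\<close>.\<close>

definition heat :: "real \<Rightarrow> real \<Rightarrow> real" where
  "heat v y = gint (y / sqrt v)"

definition heat' :: "real \<Rightarrow> real \<Rightarrow> real" where
  "heat' v y = gphi (y / sqrt v) / sqrt v"

lemma heat_measurable [measurable]: "heat v \<in> borel_measurable borel"
  unfolding heat_def by measurable

lemma heat_0 [simp]: "heat v 0 = 0"
  by (simp add: heat_def)

lemma heat_odd: "heat v (- y) = - heat v y"
  by (simp add: heat_def gint_odd flip: minus_divide_left)

lemma heat_abs_le: "\<bar>heat v y\<bar> \<le> 1/2"
  unfolding heat_def by (rule gint_abs_le)

lemma heat_mono: "v > 0 \<Longrightarrow> x \<le> y \<Longrightarrow> heat v x \<le> heat v y"
  unfolding heat_def by (intro gint_mono divide_right_mono) auto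

lemma heat_tail:
  assumes "v > 0" "y > 0"
  shows "1 - 2 * heat v y \<le> v / y\<^sup>2"
  using gint_tail[of "y / sqrt v"] assms by (simp add: heat_def power_divide)

lemma DERIV_heat: "v > 0 \<Longrightarrow> (heat v has_real_derivative heat' v y) (at y)"
  unfolding heat_def heat'_def by (auto intro!: derivative_eq_intros simp: field_simps)

lemma heat'_bounds: "v > 0 \<Longrightarrow> 0 < heat' v y" "v > 0 \<Longrightarrow> heat' v y \<le> 1 / sqrt v"
  unfolding heat'_def using gphi_pos[of "y / sqrt v"] gphi_poly_bounds(1)[of "y / sqrt v"]
  by (auto intro!: divide_right_mono)

lemma heat_lipschitz: "v > 0 \<Longrightarrow> \<bar>heat v x - heat v y\<bar> \<le> \<bar>x - y\<bar> / sqrt v"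
  using gint_lipschitz[of "x / sqrt v" "y / sqrt v"] by (simp add: heat_def flip: diff_divide_distrib)

lemma heat'_lipschitz:
  assumes "v > 0"
  shows "\<bar>heat' v x - heat' v y\<bar> \<le> \<bar>x - y\<bar> / v"
proof -
  have "\<bar>heat' v b - heat' v a\<bar> \<le> \<bar>b - a\<bar> / v" if ab: "a < b" for a b
  proof -
    have "((\<lambda>x. heat' v x) has_real_derivative (- (z / sqrt v) * gphi (z / sqrt v) / v)) (at z)" for z
      unfolding heat'_def using assms by (auto intro!: derivative_eq_intros simp: field_simps)
    then obtain z where "heat' v b - heat' v a = (b - a) * (- (z / sqrt v) * gphi (z / sqrt v) / v)"
      using MVT2[OF ab, of "heat' v" "\<lambda>z. - (z / sqrt v) * gphi (z / sqrt v) / v"] by blast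
    then have "\<bar>heat' v b - heat' v a\<bar> = \<bar>b - a\<bar> * (\<bar>z / sqrt v\<bar> * gphi (z / sqrt v) / v)"
      using assms gphi_pos[of "z / sqrt v"] by (simp add: abs_mult)
    also have "\<dots> \<le> \<bar>b - a\<bar> * (1 / v)"
      using assms gphi_poly_bounds(2)[of "z / sqrt v"] by (intro mult_left_mono divide_right_mono) auto
    finally show ?thesis by simp
  qed
  from this[of x y] this[of y x] show ?thesis by (cases x y rule: linorder_cases) auto
qed

lemma heat_space_step:
  assumes "v > 0" "2 \<le> q" "q \<le> 3"
  shows "\<bar>heat v (y + h) - heat v y - heat' v y * h + (y / sqrt v) * gphi (y / sqrt v) / (2 * v) * h\<^sup>2\<bar>
    \<le> 3 * \<bar>h\<bar> powr q * v powr (- q / 2)"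
proof -
  have "(\<bar>h\<bar> / sqrt v) powr q = \<bar>h\<bar> powr q * v powr (- q / 2)"
    using assms by (simp add: powr_divide powr_half_sqrt[symmetric] powr_powr powr_minus_divide)
  then show ?thesis
    using gint_taylor[of q "y / sqrt v" "h / sqrt v"] assms
    by (simp add: heat_def heat'_def add_divide_distrib power_divide mult.assoc)
qed

lemma DERIV_div_sqrt:
  assumes "v > 0"
  shows "((\<lambda>v. y / sqrt v) has_real_derivative (- (y / sqrt v) / (2 * v))) (at v)"
  using assms by (auto intro!: derivative_eq_intros simp: field_simps)

lemma DERIV_heat_time:
  assumes "v > 0"
  shows "((\<lambda>v. heat v y) has_real_derivative (- (y / sqrt v) * gphi (y / sqrt v) / (2 * v))) (at v)"
  unfolding heat_def using DERIV_gint_chain[OF DERIV_div_sqrt[OF assms], of y]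
  by (simp add: mult.commute)

lemma DERIV_heat_time2:
  assumes "v > 0"
  shows "((\<lambda>v. - (y / sqrt v) * gphi (y / sqrt v) / (2 * v)) has_real_derivative
    ((3 * (y / sqrt v) - (y / sqrt v)^3) * gphi (y / sqrt v) / (4 * v\<^sup>2))) (at v)"
proof -
  define z where "z = y / sqrt v"
  have "((\<lambda>z. - z * gphi z) has_real_derivative ((z\<^sup>2 - 1) * gphi z)) (at z)"
    by (auto intro!: derivative_eq_intros) (simp add: algebra_simps power2_eq_square)
  from DERIV_chain2[OF this[unfolded z_def] DERIV_div_sqrt[OF assms]]
  have *: "((\<lambda>v. - (y / sqrt v) * gphi (y / sqrt v)) has_real_derivative
      (z\<^sup>2 - 1) * gphi z * (- z / (2 * v))) (at v)"
    by (simp add: z_def)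
  have "((\<lambda>v. 2 * v) has_real_derivative 2) (at v)"
    by (auto intro!: derivative_eq_intros)
  from DERIV_divide[OF * this] have "((\<lambda>v. - (y / sqrt v) * gphi (y / sqrt v) / (2 * v)) has_real_derivative
      ((z\<^sup>2 - 1) * gphi z * (- z / (2 * v)) * (2 * v) - - z * gphi z * 2) / (2 * v * (2 * v))) (at v)"
    using assms by (simp add: z_def)
  then show ?thesis
    unfolding z_def[symmetric] using assms
    by (elim DERIV_cong) (simp add: field_simps power2_eq_square power3_eq_cube)
qed

text \<open>The first-order term expresses the heat equation: its coefficient is that of the
  quadratic term in \<open>heat_space_step\<close>. A centred step of variance \<open>s\<close>
  therefore cancels against a time increment \<open>s\<close>, up to the two remainders.\<close>

lemma heat_time_step:
  assumes "v > 0" "s \<ge> 0"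
  shows "\<bar>heat (v + s) y - heat v y + s * ((y / sqrt v) * gphi (y / sqrt v) / (2 * v))\<bar> \<le> s\<^sup>2 / v\<^sup>2"
proof (cases "s = 0")
  case False
  then have s: "s > 0" using assms by simp
  define D where "D = (\<lambda>m::nat. if m = 0 then (\<lambda>v. heat v y) else if m = 1 then
      (\<lambda>v. - (y / sqrt v) * gphi (y / sqrt v) / (2 * v))
     else (\<lambda>v. (3 * (y / sqrt v) - (y / sqrt v)^3) * gphi (y / sqrt v) / (4 * v\<^sup>2)))"
  have der: "\<forall>m t. m < 2 \<and> v \<le> t \<and> t \<le> v + s \<longrightarrow> (D m has_real_derivative D (Suc m) t) (at t)"
  proof (intro allI impI)
    fix m :: nat and t assume "m < 2 \<and> v \<le> t \<and> t \<le> v + s"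
    then have "t > 0" "m = 0 \<or> m = 1" using assms by auto
    then show "(D m has_real_derivative D (Suc m) t) (at t)"
      using DERIV_heat_time[of t y] DERIV_heat_time2[of t y] by (auto simp: D_def)
  qed
  have "\<exists>t. (if v + s < v then v + s < t \<and> t < v else v < t \<and> t < v + s) \<and>
      heat (v + s) y = (\<Sum>m<2. D m v / fact m * (v + s - v)^m) + D 2 t / fact 2 * (v + s - v)^2"
    by (rule Taylor[where a=v and b="v + s", OF _ _ der]) (use s in \<open>auto simp: D_def\<close>)
  then obtain t where "v < t" and t: "heat (v + s) y = (\<Sum>m<2. D m v / fact m * s^m) + D 2 t / fact 2 * s^2"
    using s by (auto split: if_splits)
  define z where "z = y / sqrt t"
  have "\<bar>(3 * z - z^3) * gphi z\<bar> \<le> 3 * (\<bar>z\<bar> * gphi z) + \<bar>z\<bar>^3 * gphi z"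
    using abs_triangle_ineq4[of "3 * z" "z^3"] gphi_pos[of z]
    by (simp add: abs_mult power_abs mult_right_mono flip: distrib_right mult.assoc)
  also have "\<dots> \<le> 6" using gphi_poly_bounds(2,4)[of z] by simp
  finally have b: "\<bar>(3 * z - z^3) * gphi z\<bar> \<le> 6" .
  have "\<bar>D 2 t\<bar> = \<bar>(3 * z - z^3) * gphi z\<bar> / (4 * t\<^sup>2)"
    by (simp add: D_def z_def abs_mult)
  also have "\<dots> \<le> 6 / (4 * v\<^sup>2)"
    using b assms \<open>v < t\<close> by (intro frac_le mult_left_mono power_mono) auto
  finally have "\<bar>D 2 t\<bar> \<le> 6 / (4 * v\<^sup>2)" .
  have "heat (v + s) y - heat v y + s * ((y / sqrt v) * gphi (y / sqrt v) / (2 * v)) = D 2 t / 2 * s^2"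
    unfolding t by (simp add: D_def eval_nat_numeral)
  then have "\<bar>heat (v + s) y - heat v y + s * ((y / sqrt v) * gphi (y / sqrt v) / (2 * v))\<bar> = \<bar>D 2 t\<bar> / 2 * s^2"
    by (simp only: abs_mult abs_divide) simp
  also have "\<dots> \<le> 6 / (4 * v\<^sup>2) / 2 * s^2"
    using \<open>\<bar>D 2 t\<bar> \<le> _\<close> by (intro mult_right_mono divide_right_mono) auto
  also have "\<dots> = (3/4) * (s^2 / v^2)" by simp
  also have "\<dots> \<le> s^2/v^2" by (intro mult_left_le_one_le) auto
  finally show ?thesis .
qed simp

lemma heat_time_lipschitz:
  assumes "v \<ge> m" "v' \<ge> m" "m > 0"
  shows "\<bar>heat v y - heat v' y\<bar> \<le> \<bar>v - v'\<bar> / m"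
proof -
  have "\<bar>heat b y - heat a y\<bar> \<le> \<bar>b - a\<bar> / m" if ab: "a < b" "a \<ge> m" for a b
  proof -
    obtain t where t: "a < t" "heat b y - heat a y = (b - a) * (- (y / sqrt t) * gphi (y / sqrt t) / (2 * t))"
      using MVT2[OF ab(1), of "\<lambda>v. heat v y"
        "\<lambda>v. - (y / sqrt v) * gphi (y / sqrt v) / (2 * v)"] DERIV_heat_time ab assms by fastforce
    then have "\<bar>heat b y - heat a y\<bar> = \<bar>b - a\<bar> * (\<bar>y / sqrt t\<bar> * gphi (y / sqrt t) / (2 * t))"
      using that assms gphi_pos[of "y / sqrt t"] by (simp add: abs_mult)
    also have "\<dots> \<le> \<bar>b - a\<bar> * (1 / m)"
      using assms gphi_poly_bounds(2)[of "y / sqrt t"] t that by (intro mult_left_mono frac_le) auto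
    finally show ?thesis by simp
  qed
  from this[of v v'] this[of v' v] assms show ?thesis by (cases v v' rule: linorder_cases) auto
qed

lemma heat'_time_lipschitz:
  assumes "v \<ge> m" "v' \<ge> m" "m > 0"
  shows "\<bar>heat' v y - heat' v' y\<bar> \<le> \<bar>v - v'\<bar> / (m * sqrt m)"
proof -
  have der: "((\<lambda>v. heat' v y) has_real_derivative (((y / sqrt t)\<^sup>2 - 1) * gphi (y / sqrt t) / (2 * t * sqrt t))) (at t)"
    if "t > 0" for t
    unfolding heat'_def
    using that by (auto intro!: derivative_eq_intros DERIV_div_sqrt simp: field_simps power2_eq_square)
  have "\<bar>heat' b y - heat' a y\<bar> \<le> \<bar>b - a\<bar> / (m * sqrt m)" if ab: "a < b" "a \<ge> m" for a b
  proof -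
    obtain t where t: "a < t" "heat' b y - heat' a y = (b - a) * (((y / sqrt t)\<^sup>2 - 1) * gphi (y / sqrt t) / (2 * t * sqrt t))"
      using MVT2[OF ab(1), of "\<lambda>v. heat' v y"
        "\<lambda>t. ((y / sqrt t)\<^sup>2 - 1) * gphi (y / sqrt t) / (2 * t * sqrt t)"] der ab assms by fastforce
    define z where "z = y / sqrt t"
    have "\<bar>(z\<^sup>2 - 1) * gphi z\<bar> \<le> 1"
      by (rule gphi_der2_bound)
    have "\<bar>heat' b y - heat' a y\<bar> = \<bar>b - a\<bar> * (\<bar>(z\<^sup>2 - 1) * gphi z\<bar> / (2 * t * sqrt t))"
      using that assms t by (simp add: abs_mult z_def)
    also have "\<dots> \<le> \<bar>b - a\<bar> * (1 / (m * sqrt m))"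
      using assms t that \<open>_ \<le> 1\<close> by (intro mult_left_mono frac_le mult_mono) auto
    finally show ?thesis by simp
  qed
  from this[of v v'] this[of v' v] assms show ?thesis by (cases v v' rule: linorder_cases) auto
qed

section \<open>The killed walk\<close>

text \<open>The moment exponent is written \<open>2 + 2 * d\<close> with \<open>d \<le> 1/2\<close>, so that it does not exceed \<open>3\<close> and
  third-order Taylor expansions suffice.\<close>

locale centred_walk = prob_space M for M :: "'a measure" +
  fixes X :: "nat \<Rightarrow> 'a \<Rightarrow> real" and \<sigma> d :: real
  assumes indep: "indep_vars (\<lambda>_. borel) X {1..}"
    and ident: "\<And>i. i \<ge> 1 \<Longrightarrow> distr M borel (X i) = distr M borel (X 1)"
    and integrable_X1: "integrable M (X 1)" and mean_X1: "(\<integral>w. X 1 w \<partial>M) = 0"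
    and sigma_pos: "\<sigma> > 0" and integrable_X1_sq: "integrable M (\<lambda>w. (X 1 w)\<^sup>2)"
    and var_X1: "(\<integral>w. (X 1 w)\<^sup>2 \<partial>M) = \<sigma>\<^sup>2"
    and d_pos: "0 < d" and d_le: "d \<le> 1/2"
    and integrable_X1_powr: "integrable M (\<lambda>w. \<bar>X 1 w\<bar> powr (2 + 2 * d))"
begin

definition Y :: "real \<Rightarrow> nat \<Rightarrow> 'a \<Rightarrow> real" where
  "Y x k w = x + walk X k w"

definition alive :: "real \<Rightarrow> nat \<Rightarrow> 'a set" where
  "alive x k = {w \<in> space M. \<forall>j\<in>{1..k}. 0 \<le> Y x j w}"

text \<open>Indexed by the last step survived: the exit time is \<open>Suc k\<close> here. With this
  shift \<open>alive x k\<close> is the disjoint union of \<open>alive x (Suc k)\<close> and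
  \<open>dies x k\<close>.\<close>

definition dies :: "real \<Rightarrow> nat \<Rightarrow> 'a set" where
  "dies x k = {w \<in> alive x k. Y x (Suc k) w < 0}"

text \<open>The transition operator of the walk without killing. Killing enters only through the
  sets over which \<open>EA\<close> and \<open>ED\<close> integrate.\<close>

definition kern :: "(real \<Rightarrow> real) \<Rightarrow> real \<Rightarrow> real" where
  "kern F y = (\<integral>w. F (y + X 1 w) \<partial>M)"

definition EA :: "real \<Rightarrow> nat \<Rightarrow> (real \<Rightarrow> real) \<Rightarrow> real" where
  "EA x k F = (\<integral>w. indicator (alive x k) w * F (Y x k w) \<partial>M)"

definition ED :: "real \<Rightarrow> nat \<Rightarrow> (real \<Rightarrow> real) \<Rightarrow> real" where
  "ED x k F = (\<integral>w. indicator (dies x k) w * F (Y x (Suc k) w) \<partial>M)"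

text \<open>The class of test functions: it contains the bounded functions and the identity, is
  stable under \<open>kern\<close>, and is integrable along the walk by the first moment
  alone.\<close>

definition lingrowth :: "(real \<Rightarrow> real) \<Rightarrow> bool" where
  "lingrowth F \<longleftrightarrow> F \<in> borel_measurable borel \<and> (\<exists>c\<ge>0. \<forall>y. \<bar>F y\<bar> \<le> c * (1 + \<bar>y\<bar>))"

lemma lingrowth_measurable: "lingrowth F \<Longrightarrow> F \<in> borel_measurable borel"
  by (simp add: lingrowth_def)

lemma lingrowthI:
  assumes "F \<in> borel_measurable borel" and b: "\<And>y. \<bar>F y\<bar> \<le> c * (1 + \<bar>y\<bar>)"
  shows "lingrowth F"
proof -
  have "\<bar>F y\<bar> \<le> \<bar>c\<bar> * (1 + \<bar>y\<bar>)" for y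
    using b[of y] mult_right_mono[of c "\<bar>c\<bar>" "1 + \<bar>y\<bar>"] by linarith
  then show ?thesis using assms(1) abs_ge_zero[of c] unfolding lingrowth_def by blast
qed

lemma lingrowth_bounded: "F \<in> borel_measurable borel \<Longrightarrow> (\<And>y. \<bar>F y\<bar> \<le> c) \<Longrightarrow> lingrowth F"
proof (rule lingrowthI[of F c])
  fix y assume b: "\<And>y. \<bar>F y\<bar> \<le> c"
  then have "0 \<le> c" using abs_ge_zero order_trans by blast
  then show "\<bar>F y\<bar> \<le> c * (1 + \<bar>y\<bar>)"
    using b[of y] by (simp add: algebra_simps add_increasing2)
qed

lemma lingrowth_id: "lingrowth (\<lambda>y. y)"
  by (rule lingrowthI[of _ 1]) auto

lemma lingrowth_const: "lingrowth (\<lambda>y. c)"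
  by (rule lingrowth_bounded[of _ "\<bar>c\<bar>"]) auto

lemma lingrowth_add: "lingrowth F \<Longrightarrow> lingrowth G \<Longrightarrow> lingrowth (\<lambda>y. F y + G y)"
proof -
  assume F: "lingrowth F" and G: "lingrowth G"
  then obtain c c' where c: "\<And>y. \<bar>F y\<bar> \<le> c * (1 + \<bar>y\<bar>)" "\<And>y. \<bar>G y\<bar> \<le> c' * (1 + \<bar>y\<bar>)"
    unfolding lingrowth_def by blast
  have "\<bar>F y + G y\<bar> \<le> (c + c') * (1 + \<bar>y\<bar>)" for y
    using c[of y] abs_triangle_ineq[of "F y" "G y"] unfolding distrib_right by linarith
  then show ?thesis
    using borel_measurable_add[OF F[THEN lingrowth_measurable] G[THEN lingrowth_measurable]]
    by (intro lingrowthI[of _ "c + c'"]) auto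
qed

lemma lingrowth_cmult: "lingrowth F \<Longrightarrow> lingrowth (\<lambda>y. c * F y)"
proof -
  assume F: "lingrowth F"
  then obtain b where b: "\<And>y. \<bar>F y\<bar> \<le> b * (1 + \<bar>y\<bar>)"
    unfolding lingrowth_def by blast
  then have "\<bar>c * F y\<bar> \<le> \<bar>c\<bar> * b * (1 + \<bar>y\<bar>)" for y
    by (simp add: abs_mult mult.assoc mult_left_mono)
  then show ?thesis
    using borel_measurable_times[OF borel_measurable_const F[THEN lingrowth_measurable]]
    by (intro lingrowthI[of _ "\<bar>c\<bar> * b"]) auto
qed

lemma lingrowth_diff: "lingrowth F \<Longrightarrow> lingrowth G \<Longrightarrow> lingrowth (\<lambda>y. F y - G y)"
  using lingrowth_add[of F "\<lambda>y. -1 * G y"] lingrowth_cmult[of G "-1"] by simp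

section \<open>Measurability and integrability along the killed walk\<close>

lemma X_measurable: "i \<ge> 1 \<Longrightarrow> X i \<in> borel_measurable M"
  using indep unfolding indep_vars_def by auto

lemma X1_measurable: "X 1 \<in> borel_measurable M" "X (Suc 0) \<in> borel_measurable M"
  using X_measurable[of 1] by auto

lemma integrable_X: "i \<ge> 1 \<Longrightarrow> integrable M (X i)"
proof -
  assume i: "i \<ge> 1"
  have "integrable (distr M borel (X 1)) (\<lambda>x. x)"
    using integrable_X1 X_measurable[of 1] by (subst integrable_distr_eq) auto
  then have "integrable (distr M borel (X i)) (\<lambda>x. x)" using ident[OF i] by simp
  then show ?thesis using X_measurable[OF i] by (subst (asm) integrable_distr_eq) auto
qed

lemma Y_measurable [measurable]: "Y x k \<in> borel_measurable M"
  unfolding Y_def walk_def using X_measurable by (intro borel_measurable_add borel_measurable_sum) auto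

lemma Y_0 [simp]: "Y x 0 w = x" by (simp add: Y_def walk_def)

lemma Y_Suc: "Y x (Suc k) w = Y x k w + X (Suc k) w" by (simp add: Y_def walk_def)

lemma integrable_Y: "integrable M (Y x k)"
  by (induction k) (auto simp: Y_Suc[abs_def] integrable_X)

lemma alive_sets [measurable]: "alive x k \<in> sets M"
  unfolding alive_def by measurable

lemma dies_sets [measurable]: "dies x k \<in> sets M"
proof -
  have "dies x k = alive x k \<inter> {w \<in> space M. Y x (Suc k) w < 0}"
    unfolding dies_def alive_def by auto
  then show ?thesis by simp
qed

lemma alive_0 [simp]: "alive x 0 = space M" by (auto simp: alive_def)

lemma alive_Suc: "alive x (Suc k) = {w \<in> alive x k. 0 \<le> Y x (Suc k) w}"
  by (auto simp: alive_def atLeastAtMostSuc_conv)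

lemma alive_nonneg: "x \<ge> 0 \<Longrightarrow> w \<in> alive x k \<Longrightarrow> 0 \<le> Y x k w"
  by (cases k) (auto simp: alive_def)

lemma lingrowth_integrable:
  assumes "lingrowth F" "f \<in> borel_measurable M" "integrable M f"
  shows "integrable M (\<lambda>w. F (f w))"
proof -
  obtain c where c: "c \<ge> 0" "\<And>y. \<bar>F y\<bar> \<le> c * (1 + \<bar>y\<bar>)"
    using assms unfolding lingrowth_def by blast
  show ?thesis
  proof (rule Bochner_Integration.integrable_bound)
    show "integrable M (\<lambda>w. c * (1 + \<bar>f w\<bar>))" using assms by auto
    show "(\<lambda>w. F (f w)) \<in> borel_measurable M"
      using assms lingrowth_measurable by measurable
    show "AE w in M. norm (F (f w)) \<le> norm (c * (1 + \<bar>f w\<bar>))"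
      using c by auto
  qed
qed

lemma lingrowth_integrable_Y: "lingrowth F \<Longrightarrow> integrable M (\<lambda>w. F (Y x k w))"
  by (intro lingrowth_integrable[where F=F and f="Y x k"] integrable_Y Y_measurable)

lemma lingrowth_integrable_kern: "lingrowth F \<Longrightarrow> integrable M (\<lambda>w. F (y + X 1 w))"
  using integrable_X1 X1_measurable by (intro lingrowth_integrable[where F=F and f="\<lambda>w. y + X 1 w"]) auto

lemma integrable_ind:
  fixes f :: "'a \<Rightarrow> real"
  assumes "integrable M f" "B \<in> sets M"
  shows "integrable M (\<lambda>w. indicator B w * f w)"
  using integrable_mult_indicator[OF assms(2,1)] by simp

lemma integrable_EA: "lingrowth F \<Longrightarrow> integrable M (\<lambda>w. indicator (alive x k) w * F (Y x k w))"
  by (intro integrable_ind lingrowth_integrable_Y) auto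

lemma integrable_ED: "lingrowth F \<Longrightarrow> integrable M (\<lambda>w. indicator (dies x k) w * F (Y x (Suc k) w))"
  by (intro integrable_ind lingrowth_integrable_Y) auto

lemma kern_const [simp]: "kern (\<lambda>_. c) y = c"
  by (simp add: kern_def prob_space)

lemma kern_diff: "lingrowth F \<Longrightarrow> lingrowth G \<Longrightarrow> kern (\<lambda>y. F y - G y) y = kern F y - kern G y"
  unfolding kern_def by (intro Bochner_Integration.integral_diff lingrowth_integrable_kern)

lemma kern_cmult: "kern (\<lambda>y. c * F y) y = c * kern F y"
  unfolding kern_def by simp

lemma kern_id: "kern (\<lambda>y. y) y = y"
  using mean_X1 integrable_X1 by (simp add: kern_def prob_space)

lemma lingrowth_kern: "lingrowth F \<Longrightarrow> lingrowth (kern F)"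
proof -
  assume F: "lingrowth F"
  then obtain c where c: "c \<ge> 0" "\<And>y. \<bar>F y\<bar> \<le> c * (1 + \<bar>y\<bar>)"
    unfolding lingrowth_def by blast
  have [measurable]: "F \<in> borel_measurable borel" "X 1 \<in> borel_measurable M"
    using F X_measurable by (auto simp: lingrowth_measurable)
  define m where "m = (\<integral>w. \<bar>X 1 w\<bar> \<partial>M)"
  have m: "m \<ge> 0" by (simp add: m_def)
  show ?thesis
  proof (rule lingrowthI[of _ "c * (1 + m)"])
    show "kern F \<in> borel_measurable borel"
      unfolding kern_def by measurable
    fix y
    have "\<bar>kern F y\<bar> \<le> (\<integral>w. \<bar>F (y + X 1 w)\<bar> \<partial>M)"
      unfolding kern_def by (rule integral_abs_bound)
    also have "\<dots> \<le> (\<integral>w. c * (1 + \<bar>y\<bar> + \<bar>X 1 w\<bar>) \<partial>M)"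
    proof (rule integral_mono)
      show "integrable M (\<lambda>w. \<bar>F (y + X 1 w)\<bar>)" using lingrowth_integrable_kern[OF F] by auto
      show "integrable M (\<lambda>w. c * (1 + \<bar>y\<bar> + \<bar>X 1 w\<bar>))" using integrable_X1 by auto
      show "\<bar>F (y + X 1 w)\<bar> \<le> c * (1 + \<bar>y\<bar> + \<bar>X 1 w\<bar>)" for w
        using c(2)[of "y + X 1 w"] mult_left_mono[OF _ c(1), of "1 + \<bar>y + X 1 w\<bar>" "1 + \<bar>y\<bar> + \<bar>X 1 w\<bar>"] abs_triangle_ineq[of y "X 1 w"] by simp
    qed
    also have "\<dots> = c * (1 + \<bar>y\<bar> + m)"
      using integrable_X1 by (simp add: prob_space m_def)
    also have "\<dots> \<le> c * (1 + m) * (1 + \<bar>y\<bar>)"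
      using c m by (simp add: algebra_simps)
    finally show "\<bar>kern F y\<bar> \<le> c * (1 + m) * (1 + \<bar>y\<bar>)" .
  qed
qed

text \<open>The past enters through a survival flag, coded as a real 0 or 1, and the current
  position. The dummy \<open>0\<close> beside the new increment gives both variables the common
  value type that \<open>indep_var\<close> requires.\<close>

lemma indep_step:
  "indep_var (borel \<Otimes>\<^sub>M borel) (\<lambda>w. (if \<forall>j\<in>{1..k}. 0 \<le> Y x j w then 1 else 0 :: real, Y x k w)) (borel \<Otimes>\<^sub>M borel) (\<lambda>w. (X (Suc k) w, 0 :: real))"
proof -
  let ?P = "\<lambda>J. PiM J (\<lambda>_. borel) :: (nat \<Rightarrow> real) measure"
  have ind: "indep_var (?P {1..k}) (\<lambda>w. restrict (\<lambda>i. X i w) {1..k}) (?P {Suc k}) (\<lambda>w. restrict (\<lambda>i. X i w) {Suc k})"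
    by (rule indep_var_restrict[OF indep]) auto
  define g :: "(nat \<Rightarrow> real) \<Rightarrow> real \<times> real" where
    "g z = (if \<forall>j\<in>{1..k}. 0 \<le> x + (\<Sum>i=1..j. z i) then 1 else 0, x + (\<Sum>i=1..k. z i))" for z
  have ms: "(\<lambda>z. \<Sum>i=1..j. z i) \<in> borel_measurable (?P {1..k})" if "j \<le> k" for j
    by (rule borel_measurable_sum, rule measurable_component_singleton) (use that in auto)
  have gm: "g \<in> ?P {1..k} \<rightarrow>\<^sub>M borel \<Otimes>\<^sub>M borel"
    unfolding g_def
  proof (rule measurable_Pair)
    show "(\<lambda>z. x + (\<Sum>i=1..k. z i)) \<in> borel_measurable (?P {1..k})" using ms[of k] by auto
    have "{z \<in> space (?P {1..k}). \<forall>j\<in>{1..k}. 0 \<le> x + (\<Sum>i=1..j. z i)} \<in> sets (?P {1..k})"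
    proof (rule sets.sets_Collect_finite_All)
      fix j assume "j \<in> {1..k}"
      then have [measurable]: "(\<lambda>z. \<Sum>i=1..j. z i) \<in> borel_measurable (?P {1..k})" using ms by auto
      show "{z \<in> space (?P {1..k}). 0 \<le> x + (\<Sum>i=1..j. z i)} \<in> sets (?P {1..k})" by measurable
    qed simp
    then show "(\<lambda>z. if \<forall>j\<in>{1..k}. 0 \<le> x + (\<Sum>i=1..j. z i) then 1 else 0::real) \<in> borel_measurable (?P {1..k})"
      by (intro measurable_If) auto
  qed
  have em: "(\<lambda>z. (z (Suc k), 0 :: real)) \<in> ?P {Suc k} \<rightarrow>\<^sub>M borel \<Otimes>\<^sub>M borel" by measurable
  have "indep_var (borel \<Otimes>\<^sub>M borel) (g \<circ> (\<lambda>w. restrict (\<lambda>i. X i w) {1..k})) (borel \<Otimes>\<^sub>M borel) ((\<lambda>z. (z (Suc k), 0)) \<circ> (\<lambda>w. restrict (\<lambda>i. X i w) {Suc k}))"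
    by (rule indep_var_compose[OF ind gm em])
  moreover have "g (restrict (\<lambda>i. X i w) {1..k}) = (if \<forall>j\<in>{1..k}. 0 \<le> Y x j w then 1 else 0, Y x k w)" for w
  proof -
    have "(\<Sum>i=1..j. restrict (\<lambda>i. X i w) {1..k} i) = walk X j w" if "j \<le> k" for j
      unfolding walk_def using that by (intro sum.cong) auto
    then show ?thesis by (auto simp: g_def Y_def)
  qed
  ultimately show ?thesis
    by (simp add: o_def)
qed

text \<open>The Markov property at time \<open>k\<close>: by independence the joint law of past and
  next increment is a product, Fubini integrates the increment out, and identical distribution turns
  it into \<open>X 1\<close>.\<close>

lemma EA_step:
  assumes F: "lingrowth F"
  shows "(\<integral>w. indicator (alive x k) w * F (Y x (Suc k) w) \<partial>M) = EA x k (kern F)"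
proof -
  let ?U = "\<lambda>w. (if \<forall>j\<in>{1..k}. 0 \<le> Y x j w then 1 else 0 :: real, Y x k w)" and ?V = "\<lambda>w. (X (Suc k) w, 0 :: real)" and ?B = "borel \<Otimes>\<^sub>M borel :: (real \<times> real) measure"
  have [measurable]: "F \<in> borel_measurable borel" "X 1 \<in> borel_measurable M" "X (Suc k) \<in> borel_measurable M"
    using F X_measurable by (auto simp: lingrowth_measurable)
  have U [measurable]: "?U \<in> M \<rightarrow>\<^sub>M ?B" "?V \<in> M \<rightarrow>\<^sub>M ?B" by measurable
  interpret U: prob_space "distr M ?B ?U" by (rule prob_space_distr) simp
  interpret S: prob_space "distr M ?B ?V" by (rule prob_space_distr) simp
  interpret US: pair_prob_space "distr M ?B ?U" "distr M ?B ?V" ..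
  have eq: "distr M ?B ?U \<Otimes>\<^sub>M distr M ?B ?V = distr M (?B \<Otimes>\<^sub>M ?B) (\<lambda>w. (?U w, ?V w))"
    using indep_step[of k x] unfolding indep_var_distribution_eq by auto
  define H :: "(real \<times> real) \<times> (real \<times> real) \<Rightarrow> real" where "H p = fst (fst p) * F (snd (fst p) + fst (snd p))" for p
  have [measurable]: "H \<in> borel_measurable (?B \<Otimes>\<^sub>M ?B)" unfolding H_def by measurable
  have HU: "H (?U w, ?V w) = indicator (alive x k) w * F (Y x (Suc k) w)" if "w \<in> space M" for w
    using that by (auto simp: H_def Y_Suc alive_def)
  have int0: "integrable M (\<lambda>w. H (?U w, ?V w))"
    using integrable_ind[OF lingrowth_integrable_Y[OF F, of x "Suc k"] alive_sets[of x k]]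
    by (subst Bochner_Integration.integrable_cong[OF refl HU])
  have int: "integrable (distr M ?B ?U \<Otimes>\<^sub>M distr M ?B ?V) H"
    unfolding eq using int0 by (subst integrable_distr_eq) auto
  have "(\<integral>w. indicator (alive x k) w * F (Y x (Suc k) w) \<partial>M) = (\<integral>w. H (?U w, ?V w) \<partial>M)"
    by (intro Bochner_Integration.integral_cong refl HU[symmetric])
  also have "\<dots> = integral\<^sup>L (distr M (?B \<Otimes>\<^sub>M ?B) (\<lambda>w. (?U w, ?V w))) H"
    by (subst integral_distr) auto
  also have "\<dots> = integral\<^sup>L (distr M ?B ?U \<Otimes>\<^sub>M distr M ?B ?V) H"
    by (simp only: eq)
  also have "\<dots> = (\<integral>u. (\<integral>\<xi>. H (u, \<xi>) \<partial>distr M ?B ?V) \<partial>distr M ?B ?U)"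
    by (rule US.integral_fst'[symmetric, OF int])
  also have "\<dots> = (\<integral>u. fst u * kern F (snd u) \<partial>distr M ?B ?U)"
  proof (rule Bochner_Integration.integral_cong[OF refl])
    fix u
    have "(\<integral>\<xi>. H (u, \<xi>) \<partial>distr M ?B ?V) = fst u * (\<integral>\<xi>. F (snd u + fst \<xi>) \<partial>distr M ?B ?V)"
      by (simp add: H_def)
    also have "(\<integral>\<xi>. F (snd u + fst \<xi>) \<partial>distr M ?B ?V) = kern F (snd u)"
    proof -
      have "(\<integral>\<xi>. F (snd u + fst \<xi>) \<partial>distr M ?B ?V) = (\<integral>w. F (snd u + X (Suc k) w) \<partial>M)"
        by (subst integral_distr) auto
      also have "\<dots> = (\<integral>\<xi>. F (snd u + \<xi>) \<partial>distr M borel (X (Suc k)))"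
        by (subst integral_distr) auto
      also have "\<dots> = (\<integral>\<xi>. F (snd u + \<xi>) \<partial>distr M borel (X 1))"
        using ident[of "Suc k"] by simp
      also have "\<dots> = kern F (snd u)"
        unfolding kern_def by (subst integral_distr) (auto intro: X1_measurable)
      finally show ?thesis .
    qed
    finally show "(\<integral>\<xi>. H (u, \<xi>) \<partial>distr M ?B ?V) = fst u * kern F (snd u)" .
  qed
  also have "\<dots> = EA x k (kern F)"
  proof -
    have [measurable]: "kern F \<in> borel_measurable borel"
      by (rule lingrowth_measurable[OF lingrowth_kern[OF F]])
    have "(\<integral>u. fst u * kern F (snd u) \<partial>distr M ?B ?U) = (\<integral>w. fst (?U w) * kern F (snd (?U w)) \<partial>M)"
      by (subst integral_distr) auto
    also have "\<dots> = EA x k (kern F)"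
      unfolding EA_def by (intro Bochner_Integration.integral_cong) (auto simp: alive_def)
    finally show ?thesis .
  qed
  finally show ?thesis .
qed

text \<open>The balance equation of the killed walk: mass alive at time \<open>k\<close> either
  stays alive or exits at the next step. Every martingale argument below is an instance of
  it.\<close>

lemma EA_ED_step:
  assumes F: "lingrowth F"
  shows "EA x (Suc k) F + ED x k F = EA x k (kern F)"
proof -
  have "EA x (Suc k) F + ED x k F = (\<integral>w. indicator (alive x (Suc k)) w * F (Y x (Suc k) w) + indicator (dies x k) w * F (Y x (Suc k) w) \<partial>M)"
    unfolding EA_def ED_def by (intro Bochner_Integration.integral_add[symmetric] integrable_EA integrable_ED F)
  also have "\<dots> = (\<integral>w. indicator (alive x k) w * F (Y x (Suc k) w) \<partial>M)"
    by (intro Bochner_Integration.integral_cong) (auto simp: alive_Suc dies_def indicator_def)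
  finally show ?thesis using EA_step[OF F] by simp
qed

section \<open>Calculus of the expectations over surviving and exiting paths\<close>

lemma EA_mono:
  assumes "lingrowth F" "lingrowth G" "x \<ge> 0" "\<And>y. y \<ge> 0 \<Longrightarrow> F y \<le> G y"
  shows "EA x k F \<le> EA x k G"
  unfolding EA_def using assms alive_nonneg[OF assms(3), of _ k]
  by (intro integral_mono integrable_EA) (auto simp: indicator_def)

lemma EA_add: "lingrowth F \<Longrightarrow> lingrowth G \<Longrightarrow> EA x k (\<lambda>y. F y + G y) = EA x k F + EA x k G"
  unfolding EA_def by (simp add: distrib_left Bochner_Integration.integral_add integrable_EA)

lemma EA_diff: "lingrowth F \<Longrightarrow> lingrowth G \<Longrightarrow> EA x k (\<lambda>y. F y - G y) = EA x k F - EA x k G"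
  unfolding EA_def by (simp add: right_diff_distrib Bochner_Integration.integral_diff integrable_EA)

lemma EA_cmult: "EA x k (\<lambda>y. c * F y) = c * EA x k F"
  unfolding EA_def by (simp add: mult.left_commute)

lemma EA_nonneg: "x \<ge> 0 \<Longrightarrow> (\<And>y. y \<ge> 0 \<Longrightarrow> F y \<ge> 0) \<Longrightarrow> EA x k F \<ge> 0"
  unfolding EA_def using alive_nonneg[of x _ k] by (intro integral_nonneg_AE) (auto simp: indicator_def)

lemma EA_0: "EA x 0 F = F x"
proof -
  have "EA x 0 F = (\<integral>w. F x \<partial>M)"
    unfolding EA_def by (intro Bochner_Integration.integral_cong) auto
  then show ?thesis by (simp add: prob_space)
qed

definition surv :: "real \<Rightarrow> nat \<Rightarrow> real" where
  "surv x k = measure M (alive x k)"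

lemma EA_const: "EA x k (\<lambda>_. c) = c * surv x k"
  unfolding EA_def surv_def by simp

lemma surv_0 [simp]: "surv x 0 = 1" by (simp add: surv_def prob_space)

lemma surv_nonneg: "0 \<le> surv x k" by (simp add: surv_def)

lemma surv_le_1: "surv x k \<le> 1" by (simp add: surv_def prob_le_1)

lemma alive_antimono: "j \<le> k \<Longrightarrow> alive x k \<subseteq> alive x j" by (auto simp: alive_def)

lemma surv_antimono: "j \<le> k \<Longrightarrow> surv x k \<le> surv x j"
  unfolding surv_def by (intro finite_measure_mono alive_antimono) auto

lemma EA_abs_diff_le:
  assumes "lingrowth F" "lingrowth G" "x \<ge> 0" "\<And>y. y \<ge> 0 \<Longrightarrow> \<bar>F y - G y\<bar> \<le> c"
  shows "\<bar>EA x k F - EA x k G\<bar> \<le> c * surv x k"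
proof -
  have "EA x k (\<lambda>y. F y - G y) \<le> EA x k (\<lambda>_. c)" "EA x k (\<lambda>_. - c) \<le> EA x k (\<lambda>y. F y - G y)"
    using assms(4) by (auto intro!: EA_mono assms lingrowth_diff lingrowth_const simp: abs_le_iff)
       (metis minus_diff_eq neg_le_iff_le minus_minus)
  then show ?thesis using EA_diff[OF assms(1,2)] by (simp add: EA_const abs_le_iff)
qed

lemma ED_mono:
  assumes "lingrowth F" "lingrowth G" "\<And>y. y < 0 \<Longrightarrow> F y \<le> G y"
  shows "ED x k F \<le> ED x k G"
  unfolding ED_def using assms by (intro integral_mono integrable_ED) (auto simp: indicator_def dies_def)

lemma ED_cmult: "ED x k (\<lambda>y. c * F y) = c * ED x k F"
  unfolding ED_def by (simp add: mult.left_commute)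

lemma ED_diff: "lingrowth F \<Longrightarrow> lingrowth G \<Longrightarrow> ED x k (\<lambda>y. F y - G y) = ED x k F - ED x k G"
  unfolding ED_def by (simp add: right_diff_distrib Bochner_Integration.integral_diff integrable_ED)

lemma ED_nonneg: "(\<And>y. y < 0 \<Longrightarrow> F y \<ge> 0) \<Longrightarrow> ED x k F \<ge> 0"
  unfolding ED_def by (intro integral_nonneg_AE) (auto simp: indicator_def dies_def)

text \<open>Optional stopping for an approximate martingale. A defect bounded uniformly over the
  half-line is paid only by paths still alive, hence the factor \<open>surv x k\<close>. No boundary
  condition at 0 is imposed on \<open>F\<close>; its values at exit are kept in the
  \<open>ED\<close> terms.\<close>

lemma telescoping:
  assumes F: "\<And>k. lingrowth (F k)" and x: "x \<ge> 0" and mn: "m \<le> n"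
    and step: "\<And>k y. m \<le> k \<Longrightarrow> k < n \<Longrightarrow> y \<ge> 0 \<Longrightarrow> \<bar>kern (F (Suc k)) y - F k y\<bar> \<le> r k"
  shows "\<bar>EA x n (F n) + (\<Sum>k=m..<n. ED x k (F (Suc k))) - EA x m (F m)\<bar> \<le> (\<Sum>k=m..<n. r k * surv x k)"
  using mn step
proof (induction n rule: dec_induct)
  case (step n)
  have "\<bar>EA x n (kern (F (Suc n))) - EA x n (F n)\<bar> \<le> r n * surv x n"
    using step by (intro EA_abs_diff_le lingrowth_kern F x) auto
  moreover have "\<bar>EA x n (F n) + (\<Sum>k=m..<n. ED x k (F (Suc k))) - EA x m (F m)\<bar> \<le> (\<Sum>k=m..<n. r k * surv x k)"
    using step by auto
  ultimately show ?case
    using EA_ED_step[OF F, of x n "Suc n"] step(1) by (simp add: abs_le_iff)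
qed simp

end

section \<open>One-step estimates\<close>

lemma powr_young:
  fixes s p :: real
  assumes "0 \<le> s" "0 < p" "p < 1"
  shows "s powr p \<le> 1 + p * (s - 1)"
proof (cases "s = 0")
  case False
  then show ?thesis
    using Youngs_inequality_0[of p "1 - p" s 1] assms by (simp add: algebra_simps)
qed (use assms in simp)

text \<open>Second-order Taylor expansion at 1. The constant is half of p(1 - p) times (3/2)^(-2) =
  4/9, a lower bound for t^(p - 2) on [1/2, 3/2].\<close>

lemma powr_concave_gap:
  fixes h p :: real
  assumes "\<bar>h\<bar> \<le> 1/2" "0 < p" "p < 1"
  shows "(1 + h) powr p \<le> 1 + p * h - 2 * p * (1 - p) / 9 * h\<^sup>2"
proof (cases "h = 0")
  case False
  define D where "D = (\<lambda>m::nat. if m = 0 then (\<lambda>z::real. z powr p) else if m = 1 then (\<lambda>z. p * z powr (p - 1))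
     else (\<lambda>z. p * ((p - 1) * z powr (p - 2))))"
  have der: "\<forall>m t. m < 2 \<and> 1/2 \<le> t \<and> t \<le> 3/2 \<longrightarrow> (D m has_real_derivative D (Suc m) t) (at t)"
  proof (intro allI impI)
    fix m :: nat and t :: real assume "m < 2 \<and> 1/2 \<le> t \<and> t \<le> 3/2"
    then have "t > 0" "m = 0 \<or> m = 1" by auto
    then show "(D m has_real_derivative D (Suc m) t) (at t)"
      by (auto simp: D_def algebra_simps intro!: derivative_eq_intros)
  qed
  have "\<exists>t. (if 1 + h < 1 then 1 + h < t \<and> t < 1 else 1 < t \<and> t < 1 + h) \<and>
      (1 + h) powr p = (\<Sum>m<2. D m 1 / fact m * (1 + h - 1)^m) + D 2 t / fact 2 * (1 + h - 1)^2"
    by (rule Taylor[where a="1/2" and b="3/2", OF _ _ der]) (use False assms in \<open>auto simp: D_def\<close>)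
  then obtain t where t: "1/2 \<le> t" "t \<le> 3/2"
      "(1 + h) powr p = (\<Sum>m<2. D m 1 / fact m * h^m) + D 2 t / fact 2 * h^2"
    using assms(1) by (elim exE) (rule that; auto split: if_splits simp: abs_le_iff)
  have "(1 + h) powr p = 1 + p * h - p * (1 - p) * t powr (p - 2) / 2 * h\<^sup>2"
    unfolding t(3) by (simp add: D_def eval_nat_numeral algebra_simps add_divide_distrib diff_divide_distrib)
  moreover have "4/9 \<le> t powr (p - 2)"
  proof -
    have "4/9 = (3/2::real) powr (-2)" by (simp add: powr_minus field_simps)
    also have "\<dots> \<le> (3/2) powr (p - 2)" using assms by (intro powr_mono) auto
    also have "\<dots> \<le> t powr (p - 2)" using t assms by (intro powr_mono2') auto
    finally show ?thesis .
  qed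
  moreover have "p * (1 - p) * (4/9) / 2 * h\<^sup>2 \<le> p * (1 - p) * t powr (p - 2) / 2 * h\<^sup>2"
    using assms calculation(2) by (intro mult_right_mono divide_right_mono mult_left_mono) auto
  ultimately show ?thesis by simp
qed simp

text \<open>Strict concavity gives the negative quadratic term near 0. For |h| > 1/2 one has h^2/2
  at most |h|^q, so the last term can refund it: the part \<open>2 * c\<close> repays the quadratic
  gain, and the part \<open>2\<close> keeps the right-hand side nonnegative when
  \<open>h < -1\<close>, where the left-hand side is 0.\<close>

lemma powr_superharmonic:
  fixes h p q :: real
  assumes p: "0 < p" "p < 1" and q: "2 \<le> q" "q \<le> 3" and c: "c = 2 * p * (1 - p) / 9"
  shows "(max 0 (1 + h)) powr p \<le> 1 + p * h - c * h\<^sup>2 + (2 * c + 2) * \<bar>h\<bar> powr q"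
proof -
  have c0: "c > 0" unfolding c using p by simp
  show ?thesis
  proof (cases "\<bar>h\<bar> \<le> 1/2")
    case True
    then have "max 0 (1 + h) = 1 + h" by auto
    moreover have nonneg: "0 \<le> (2 * c + 2) * \<bar>h\<bar> powr q" using c0 by simp
    ultimately show ?thesis
      using powr_concave_gap[OF True p] nonneg
      unfolding c[symmetric] \<open>max 0 (1 + h) = 1 + h\<close> by linarith
  next
    case False
    have "h\<^sup>2 / 2 \<le> \<bar>h\<bar> powr q"
    proof -
      have "(1/2::real) = (1/2) powr 1" by simp
      also have "\<dots> \<le> (1/2) powr (q - 2)" using q by (intro powr_mono') auto
      also have "\<dots> \<le> \<bar>h\<bar> powr (q - 2)" using False q by (intro powr_mono2) auto
      finally have "\<bar>h\<bar> powr 2 * (1/2) \<le> \<bar>h\<bar> powr 2 * \<bar>h\<bar> powr (q - 2)" by (intro mult_left_mono) auto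
      also have "\<dots> = \<bar>h\<bar> powr (2 + (q - 2))" by (simp only: powr_add)
      finally show ?thesis using False by simp
    qed
    then have "(2 * c + 2) * (h\<^sup>2 / 2) \<le> (2 * c + 2) * \<bar>h\<bar> powr q"
      using c0 by (intro mult_left_mono) auto
    then have *: "c * h\<^sup>2 + h\<^sup>2 \<le> (2 * c + 2) * \<bar>h\<bar> powr q" by (simp add: algebra_simps)
    show ?thesis
    proof (cases "h \<ge> -1")
      case True
      then have "(max 0 (1 + h)) powr p \<le> 1 + p * h"
        using powr_young[of "1 + h" p] p by simp
      then show ?thesis using * zero_le_power2[of h] by linarith
    next
      case False
      have "p * h \<ge> h" using False p by (simp add: mult_le_cancel_right2)
      moreover have "- h \<le> h\<^sup>2"
        using False mult_left_mono[of 1 "-h" "-h"] by (simp add: power2_eq_square)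
      ultimately have "1 + p * h + h\<^sup>2 \<ge> 0" by linarith
      then show ?thesis using * False by simp
    qed
  qed
qed

context centred_walk
begin

definition mom :: real where "mom = (\<integral>w. \<bar>X 1 w\<bar> powr (2 + 2 * d) \<partial>M)"

lemma mom_nonneg: "mom \<ge> 0" by (simp add: mom_def)

lemma kern_shift: "kern (\<lambda>y. F (y + b)) y = kern F (y + b)"
  by (simp add: kern_def algebra_simps)

lemma lingrowth_heat: "lingrowth (heat v)"
  by (rule lingrowth_bounded[OF heat_measurable heat_abs_le])

lemma lingrowth_heat_shift: "lingrowth (\<lambda>y. heat v (y + b))"
  by (rule lingrowth_bounded[of _ "1/2"]) (use heat_abs_le in auto)

text \<open>The Lindeberg step. Zero mean removes the linear term, and the variance
  \<open>\<sigma>\<^sup>2\<close> cancels the quadratic term against the time increment. What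
  remains is the space remainder, giving \<open>3 * mom\<close>, and the time remainder, giving
  \<open>\<sigma>^4\<close>.\<close>

lemma kern_heat:
  assumes v: "v \<ge> 1"
  shows "\<bar>kern (heat v) y - heat (v + \<sigma>\<^sup>2) y\<bar> \<le> (3 * mom + \<sigma>^4) * v powr (-1 - d)"
proof -
  define z where "z = y / sqrt v"
  define r where "r h = heat v (y + h) - heat v y - heat' v y * h + z * gphi z / (2 * v) * h\<^sup>2" for h
  have q: "2 \<le> 2 + 2 * d" "2 + 2 * d \<le> 3" using d_pos d_le by auto
  have r: "\<bar>r h\<bar> \<le> 3 * \<bar>h\<bar> powr (2 + 2 * d) * v powr (-1 - d)" for h
  proof -
    have "- (2 + 2 * d) / 2 = -1 - d" by (simp add: field_simps)
    then have "v powr (- (2 + 2 * d) / 2) = v powr (-1 - d)" by (rule arg_cong)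
    then show ?thesis
      using heat_space_step[OF _ q, of v y h] v by (simp add: r_def z_def)
  qed
  have int: "integrable M (\<lambda>w. heat v (y + X 1 w))"
    by (rule lingrowth_integrable_kern[OF lingrowth_heat])
  have "(\<integral>w. r (X 1 w) \<partial>M) = kern (heat v) y - heat v y + z * gphi z / (2 * v) * \<sigma>\<^sup>2"
    unfolding r_def kern_def using int integrable_X1 integrable_X1_sq
    by (simp add: prob_space mean_X1[unfolded One_nat_def] var_X1[unfolded One_nat_def])
  moreover have "\<bar>\<integral>w. r (X 1 w) \<partial>M\<bar> \<le> (\<integral>w. 3 * \<bar>X 1 w\<bar> powr (2 + 2 * d) * v powr (-1 - d) \<partial>M)"
  proof -
    have ir: "integrable M (\<lambda>w. r (X 1 w))"
      unfolding r_def using int integrable_X1 integrable_X1_sq by auto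
    have "\<bar>\<integral>w. r (X 1 w) \<partial>M\<bar> \<le> (\<integral>w. \<bar>r (X 1 w)\<bar> \<partial>M)" by (rule integral_abs_bound)
    also have "\<dots> \<le> (\<integral>w. 3 * \<bar>X 1 w\<bar> powr (2 + 2 * d) * v powr (-1 - d) \<partial>M)"
      using ir integrable_X1_powr r by (intro integral_mono) auto
    finally show ?thesis .
  qed
  moreover have "(\<integral>w. 3 * \<bar>X 1 w\<bar> powr (2 + 2 * d) * v powr (-1 - d) \<partial>M) = 3 * mom * v powr (-1 - d)"
    by (simp add: mom_def)
  moreover have "\<bar>heat (v + \<sigma>\<^sup>2) y - heat v y + \<sigma>\<^sup>2 * (z * gphi z / (2 * v))\<bar> \<le> (\<sigma>\<^sup>2)\<^sup>2 / v\<^sup>2"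
    using heat_time_step[of v "\<sigma>\<^sup>2" y] v by (simp add: z_def)
  moreover have "(\<sigma>\<^sup>2)\<^sup>2 / v\<^sup>2 \<le> \<sigma>^4 * v powr (-1 - d)"
  proof -
    have "1 / v\<^sup>2 = v powr (-2)" using v by (simp add: powr_minus field_simps)
    also have "\<dots> \<le> v powr (-1 - d)" using v d_le by (intro powr_mono) auto
    finally show ?thesis using mult_left_mono[of "1 / v\<^sup>2" "v powr (-1 - d)" "\<sigma>^4"] by simp
  qed
  ultimately show ?thesis unfolding distrib_right mult.commute[of "\<sigma>\<^sup>2" "z * gphi z / (2 * v)"] by linarith
qed

definition cheat :: real where "cheat = 3 * mom + \<sigma>^4"

lemma cheat_pos: "cheat > 0"
  using mom_nonneg sigma_pos by (simp add: cheat_def add_nonneg_pos)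

lemma kern_heat_shift:
  "v \<ge> 1 \<Longrightarrow> \<bar>kern (\<lambda>y. heat v (y + b)) y - heat (v + \<sigma>\<^sup>2) (y + b)\<bar> \<le> cheat * v powr (-1 - d)"
  using kern_heat[of v "y + b"] by (simp add: kern_shift[of "heat v"] cheat_def)

text \<open>The Lyapunov function of the killed walk: its decrement in one step is of the order of the
  conditional mean overshoot.\<close>

definition lyap :: "real \<Rightarrow> real \<Rightarrow> real" where
  "lyap a y = (if y \<ge> 0 then (a + y) powr (1 - d) else 0)"

text \<open>The power -1 - d is that of the second derivative of the power 1 - d in
  \<open>lyap\<close>, hence the expected drift of the Lyapunov function. Taking
  \<open>max y 0\<close> only keeps the weight bounded on the negative side.\<close>

definition wght :: "real \<Rightarrow> real \<Rightarrow> real" where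
  "wght a y = (a + max y 0) powr (-1 - d)"

lemma lingrowth_lyap: "a \<ge> 1 \<Longrightarrow> lingrowth (lyap a)"
proof (rule lingrowthI[of _ a])
  assume a: "a \<ge> 1"
  show "lyap a \<in> borel_measurable borel" unfolding lyap_def by measurable
  fix y
  have "(a + y) powr (1 - d) \<le> (a + y) powr 1" if "y \<ge> 0"
    using a that d_pos by (intro powr_mono) auto
  moreover have "a + y \<le> a * (1 + y)" if "y \<ge> 0"
    using that a mult_right_mono[of 1 a y] by (simp add: algebra_simps)
  ultimately show "\<bar>lyap a y\<bar> \<le> a * (1 + \<bar>y\<bar>)"
    using a by (auto simp: lyap_def)
qed

lemma lingrowth_wght: "a \<ge> 1 \<Longrightarrow> lingrowth (wght a)"
proof (rule lingrowth_bounded[of _ 1])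
  assume a: "a \<ge> 1"
  show "wght a \<in> borel_measurable borel" unfolding wght_def by measurable
  show "\<bar>wght a y\<bar> \<le> 1" for y
    using a d_pos powr_mono[of "-1-d" 0 "a + max y 0"] by (simp add: wght_def)
qed

text \<open>Concavity makes the mean of \<open>lyap a\<close> drop by the order of its second
  derivative, and cutting it to 0 on the negative side can only lower the mean further. The shift
  \<open>a\<close> makes steps small relative to the height, so that the moment remainder does not
  spoil the gain.\<close>

lemma kern_lyap: "\<exists>a\<ge>1. \<exists>c>0. \<forall>y\<ge>0. kern (lyap a) y \<le> lyap a y - c * wght a y"
proof -
  define p where "p = 1 - d"
  have p: "0 < p" "p < 1" using d_pos d_le by (auto simp: p_def)
  have q: "2 \<le> 2 + 2 * d" "2 + 2 * d \<le> 3" using d_pos d_le by auto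
  define c where "c = 2 * p * (1 - p) / 9"
  define K where "K = 2 * c + 2"
  have c0: "c > 0" and K: "K > 0" using p by (simp_all add: c_def K_def add_pos_pos)
  \<comment> \<open>Chosen so that \<open>b powr (2 * d)\<close> is at least
    \<open>2 * K * mom / (c * \<sigma>\<^sup>2)\<close> for every \<open>b \<ge> a\<close>; the
    remainder of order \<open>2 + 2 * d\<close> then consumes at most half of the variance
    gain.\<close>
  define a where "a = max 1 ((2 * K * mom / (c * \<sigma>\<^sup>2)) powr (1 / (2 * d)))"
  have a1: "a \<ge> 1" by (simp add: a_def)
  have "kern (lyap a) y \<le> lyap a y - c * \<sigma>\<^sup>2 / 2 * wght a y" if y: "y \<ge> 0" for y
  proof -
    define b where "b = a + y"
    have b: "b \<ge> a" "b \<ge> 1" "b > 0" using y a1 by (auto simp: b_def)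
    have pw: "lyap a (y + \<xi>) \<le> b powr p * (1 + p * (\<xi> / b) - c * (\<xi> / b)\<^sup>2 + K * \<bar>\<xi> / b\<bar> powr (2 + 2 * d))" for \<xi>
    proof -
      have "lyap a (y + \<xi>) \<le> b powr p * (max 0 (1 + \<xi> / b)) powr p"
      proof (cases "y + \<xi> \<ge> 0")
        case True
        have e: "a + (y + \<xi>) = b * (1 + \<xi> / b)" using b by (simp add: b_def field_simps)
        have "0 \<le> b * (1 + \<xi> / b)" using True a1 unfolding e[symmetric] by simp
        then have "0 \<le> 1 + \<xi> / b" using b by (simp add: zero_le_mult_iff)
        then show ?thesis using True b unfolding lyap_def e by (simp add: powr_mult p_def)
      qed (simp add: lyap_def)
      also have "\<dots> \<le> b powr p * (1 + p * (\<xi> / b) - c * (\<xi> / b)\<^sup>2 + K * \<bar>\<xi> / b\<bar> powr (2 + 2 * d))"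
        unfolding K_def by (intro mult_left_mono powr_superharmonic[OF p q c_def]) auto
      finally show ?thesis .
    qed
    have "kern (lyap a) y \<le> (\<integral>w. b powr p * (1 + p / b * X 1 w - c / b\<^sup>2 * (X 1 w)\<^sup>2 + K / b powr (2 + 2 * d) * \<bar>X 1 w\<bar> powr (2 + 2 * d)) \<partial>M)"
      unfolding kern_def
    proof (rule integral_mono)
      show "integrable M (\<lambda>w. lyap a (y + X 1 w))" by (rule lingrowth_integrable_kern[OF lingrowth_lyap[OF a1]])
      show "integrable M (\<lambda>w. b powr p * (1 + p / b * X 1 w - c / b\<^sup>2 * (X 1 w)\<^sup>2 + K / b powr (2 + 2 * d) * \<bar>X 1 w\<bar> powr (2 + 2 * d)))"
        using integrable_X1 integrable_X1_sq integrable_X1_powr by auto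
      show "lyap a (y + X 1 w) \<le> b powr p * (1 + p / b * X 1 w - c / b\<^sup>2 * (X 1 w)\<^sup>2 + K / b powr (2 + 2 * d) * \<bar>X 1 w\<bar> powr (2 + 2 * d))" for w
        using pw[of "X 1 w"] b by (simp add: power_divide powr_divide)
    qed
    also have "\<dots> = b powr p * (1 - c / b\<^sup>2 * \<sigma>\<^sup>2 + K / b powr (2 + 2 * d) * mom)"
      using integrable_X1 integrable_X1_sq integrable_X1_powr mean_X1 var_X1
      by (simp add: prob_space mom_def)
    also have "\<dots> \<le> b powr p * (1 - c * \<sigma>\<^sup>2 / 2 / b\<^sup>2)"
    proof (intro mult_left_mono)
      have "2 * K * mom / (c * \<sigma>\<^sup>2) \<le> b powr (2 * d)"
      proof -
        have nn: "0 \<le> 2 * K * mom / (c * \<sigma>\<^sup>2)" using K mom_nonneg c0 by simp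
        have "2 * K * mom / (c * \<sigma>\<^sup>2) = ((2 * K * mom / (c * \<sigma>\<^sup>2)) powr (1 / (2 * d))) powr (2 * d)"
          using nn d_pos by (simp add: powr_powr del: abs_divide)
        also have "\<dots> \<le> b powr (2 * d)"
          using b d_pos by (intro powr_mono2) (auto simp: a_def)
        finally show ?thesis .
      qed
      then have "K * mom \<le> c * \<sigma>\<^sup>2 / 2 * b powr (2 * d)"
        using c0 sigma_pos by (simp add: field_simps)
      then have "K * mom / b powr (2 + 2 * d) \<le> c * \<sigma>\<^sup>2 / 2 * b powr (2 * d) / b powr (2 + 2 * d)"
        by (intro divide_right_mono) auto
      also have "\<dots> = c * \<sigma>\<^sup>2 / 2 / b\<^sup>2" using b by (simp add: powr_add)
      finally show "1 - c / b\<^sup>2 * \<sigma>\<^sup>2 + K / b powr (2 + 2 * d) * mom \<le> 1 - c * \<sigma>\<^sup>2 / 2 / b\<^sup>2"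
        by (simp add: field_simps)
    qed simp
    also have "\<dots> = b powr p - c * \<sigma>\<^sup>2 / 2 * (b powr p / b\<^sup>2)" by (simp add: algebra_simps)
    also have "b powr p / b\<^sup>2 = wght a y"
    proof -
      have "wght a y = b powr (p - 2)" using y by (simp add: wght_def b_def p_def)
      also have "\<dots> = b powr p / b\<^sup>2" using b by (simp add: powr_diff)
      finally show ?thesis by simp
    qed
    also have "b powr p = lyap a y" using y by (simp add: lyap_def b_def p_def)
    finally show ?thesis .
  qed
  moreover have "c * \<sigma>\<^sup>2 / 2 > 0" using c0 sigma_pos by simp
  ultimately show ?thesis using a1 by blast
qed

text \<open>A Green function estimate: summing the drift inequality of the Lyapunov function bounds
  the expected total weight collected before exit by the Lyapunov value at the start. The shift
  \<open>a\<close> is replaced by 1 because a + y is at most a(1 + y). A general starting time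
  \<open>m\<close> is kept for the tail estimates.\<close>

lemma green:
  "\<exists>C>0. \<forall>x\<ge>0. \<forall>m n. m \<le> n \<longrightarrow> (\<Sum>k=m..<n. EA x k (wght 1)) \<le> C * EA x m (lyap 1)"
proof -
  obtain a c where a: "a \<ge> 1" and c: "c > 0" and L: "\<And>y. y \<ge> 0 \<Longrightarrow> kern (lyap a) y \<le> lyap a y - c * wght a y"
    using kern_lyap by blast
  have w: "wght 1 y \<le> a powr (1 + d) * wght a y" if "y \<ge> 0" for y
  proof -
    have "(a * (1 + y)) powr (-1 - d) \<le> (a + y) powr (-1 - d)"
      using a that d_pos mult_right_mono[of 1 a y] by (intro powr_mono2') (auto simp: algebra_simps)
    then have "a powr (1 + d) * (a powr (-1 - d) * (1 + y) powr (-1 - d)) \<le> a powr (1 + d) * (a + y) powr (-1 - d)"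
      using a that by (intro mult_left_mono) (auto simp: powr_mult)
    also have "a powr (1 + d) * (a powr (-1 - d) * (1 + y) powr (-1 - d)) = (1 + y) powr (-1 - d)"
      using a by (simp flip: mult.assoc powr_add)
    finally show ?thesis using that by (simp add: wght_def)
  qed
  have g: "lyap a y \<le> a powr (1 - d) * lyap 1 y" if "y \<ge> 0" for y
  proof -
    have "(a + y) powr (1 - d) \<le> (a * (1 + y)) powr (1 - d)"
      using a that d_le mult_right_mono[of 1 a y] by (intro powr_mono2) (auto simp: algebra_simps)
    then show ?thesis using that a by (simp add: lyap_def powr_mult)
  qed
  have dec: "c * EA x k (wght a) + EA x (Suc k) (lyap a) \<le> EA x k (lyap a)" if x: "x \<ge> 0" for x k
  proof -
    have "EA x (Suc k) (lyap a) \<le> EA x (Suc k) (lyap a) + ED x k (lyap a)"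
      using ED_nonneg[of "lyap a" x k] by (simp add: lyap_def)
    also have "\<dots> = EA x k (kern (lyap a))" by (rule EA_ED_step[OF lingrowth_lyap[OF a]])
    also have "\<dots> \<le> EA x k (\<lambda>y. lyap a y - c * wght a y)"
      by (intro EA_mono lingrowth_kern lingrowth_diff lingrowth_cmult lingrowth_lyap lingrowth_wght a x L)
    also have "\<dots> = EA x k (lyap a) - c * EA x k (wght a)"
      by (simp add: EA_diff EA_cmult lingrowth_cmult lingrowth_lyap lingrowth_wght a)
    finally show ?thesis by simp
  qed
  have tele: "c * (\<Sum>k=m..<n. EA x k (wght a)) + EA x n (lyap a) \<le> EA x m (lyap a)" if x: "x \<ge> 0" and mn: "m \<le> n" for x m n
    using mn
  proof (induction n rule: dec_induct)
    case (step n)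
    then show ?case using dec[OF x, of n] by (simp add: algebra_simps)
  qed simp
  define C where "C = a powr (1 + d) * a powr (1 - d) / c"
  have "(\<Sum>k=m..<n. EA x k (wght 1)) \<le> C * EA x m (lyap 1)" if x: "x \<ge> 0" and mn: "m \<le> n" for x m n
  proof -
    have "(\<Sum>k=m..<n. EA x k (wght 1)) \<le> (\<Sum>k=m..<n. a powr (1 + d) * EA x k (wght a))"
      by (intro sum_mono, subst EA_cmult[symmetric], intro EA_mono lingrowth_wght lingrowth_cmult x w a) auto
    also have "\<dots> = a powr (1 + d) * (\<Sum>k=m..<n. EA x k (wght a))" by (simp add: sum_distrib_left)
    also have "\<dots> \<le> a powr (1 + d) * (EA x m (lyap a) / c)"
    proof (intro mult_left_mono)
      have "0 \<le> EA x n (lyap a)" by (rule EA_nonneg[OF x]) (simp add: lyap_def)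
      then show "(\<Sum>k=m..<n. EA x k (wght a)) \<le> EA x m (lyap a) / c"
        using tele[OF x mn] c by (simp add: field_simps)
    qed simp
    also have "\<dots> \<le> a powr (1 + d) * (a powr (1 - d) * EA x m (lyap 1) / c)"
    proof -
      have "EA x m (lyap a) \<le> EA x m (\<lambda>y. a powr (1 - d) * lyap 1 y)"
        by (intro EA_mono lingrowth_lyap lingrowth_cmult x g a) auto
      then show ?thesis using c by (intro mult_left_mono divide_right_mono) (auto simp: EA_cmult)
    qed
    finally show ?thesis by (simp add: C_def mult.assoc)
  qed
  moreover have "C > 0" using a c by (simp add: C_def)
  ultimately show ?thesis by blast
qed

section \<open>The overshoot\<close>

lemma integrable_powr_shift: "integrable M (\<lambda>w. (1 + \<bar>X 1 w\<bar>) powr (2 + 2 * d))"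
proof (rule Bochner_Integration.integrable_bound)
  show "integrable M (\<lambda>w. 8 * (1 + \<bar>X 1 w\<bar> powr (2 + 2 * d)))" using integrable_X1_powr by auto
  show "(\<lambda>w. (1 + \<bar>X 1 w\<bar>) powr (2 + 2 * d)) \<in> borel_measurable M" using X1_measurable by measurable
  have "(1 + \<bar>z\<bar>) powr (2 + 2 * d) \<le> 8 * (1 + \<bar>z\<bar> powr (2 + 2 * d))" for z :: real
  proof -
    have "(1 + \<bar>z\<bar>) powr (2 + 2 * d) \<le> (2 * max 1 \<bar>z\<bar>) powr (2 + 2 * d)"
      using d_pos by (intro powr_mono2) auto
    also have "\<dots> = 2 powr (2 + 2 * d) * (max 1 \<bar>z\<bar>) powr (2 + 2 * d)" by (simp add: powr_mult)
    also have "\<dots> \<le> 2 powr 3 * (1 + \<bar>z\<bar> powr (2 + 2 * d))"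
      using d_le by (intro mult_mono powr_mono) (auto simp: max_def)
    finally show ?thesis by simp
  qed
  then show "AE w in M. norm ((1 + \<bar>X 1 w\<bar>) powr (2 + 2 * d)) \<le> norm (8 * (1 + \<bar>X 1 w\<bar> powr (2 + 2 * d)))"
    by (auto simp: abs_of_nonneg add_nonneg_nonneg)
qed

definition mom' :: real where "mom' = (\<integral>w. (1 + \<bar>X 1 w\<bar>) powr (2 + 2 * d) \<partial>M)"

lemma mom'_ge: "mom' \<ge> 1"
proof -
  have "(\<integral>w. 1 \<partial>M) \<le> mom'"
    unfolding mom'_def using d_pos by (intro integral_mono integrable_powr_shift) (auto intro: ge_one_powr_ge_zero)
  then show ?thesis by (simp add: prob_space)
qed

text \<open>An exit from height \<open>y\<close> forces the step to exceed \<open>y\<close>, and the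
  overshoot is smaller than the step. The moment exponent \<open>2 + 2 * d\<close> is thus shared
  equally: \<open>1 + d\<close> controls the overshoot, \<open>1 + d\<close> becomes decay in
  \<open>y\<close>.\<close>

lemma kern_overshoot:
  assumes F: "lingrowth F" and K: "K \<ge> 0" and neg: "\<And>y. y < 0 \<Longrightarrow> \<bar>F y\<bar> \<le> K * (1 + \<bar>y\<bar>) powr (1 + d)"
    and pos: "\<And>y. y \<ge> 0 \<Longrightarrow> F y = 0" and y: "y \<ge> 0"
  shows "kern F y \<le> K * mom' * wght 1 y"
proof -
  have "kern F y \<le> (\<integral>w. K * (1 + \<bar>X 1 w\<bar>) powr (2 + 2 * d) * (1 + y) powr (-1 - d) \<partial>M)"
    unfolding kern_def
  proof (rule integral_mono)
    show "integrable M (\<lambda>w. F (y + X 1 w))" by (rule lingrowth_integrable_kern[OF F])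
    show "integrable M (\<lambda>w. K * (1 + \<bar>X 1 w\<bar>) powr (2 + 2 * d) * (1 + y) powr (-1 - d))"
      using integrable_powr_shift by auto
    fix w
    show "F (y + X 1 w) \<le> K * (1 + \<bar>X 1 w\<bar>) powr (2 + 2 * d) * (1 + y) powr (-1 - d)"
    proof (cases "y + X 1 w < 0")
      case True
      define b where "b = 1 + \<bar>X 1 w\<bar>"
      have b: "1 + y \<le> b" "1 + \<bar>y + X 1 w\<bar> \<le> b" using True y by (auto simp: b_def)
      have "F (y + X 1 w) \<le> K * (1 + \<bar>y + X 1 w\<bar>) powr (1 + d)" using neg[OF True] by simp
      also have "\<dots> \<le> K * b powr (1 + d)"
        using b K d_pos by (intro mult_left_mono powr_mono2) auto
      also have "\<dots> = K * (b powr (2 + 2 * d) * b powr (-1 - d))" by (simp flip: powr_add)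
      also have "\<dots> \<le> K * (b powr (2 + 2 * d) * (1 + y) powr (-1 - d))"
        using b K y d_pos by (intro mult_left_mono powr_mono2') auto
      finally show ?thesis by (simp add: b_def mult.assoc)
    qed (use pos K in auto)
  qed
  also have "\<dots> = K * mom' * wght 1 y" using y by (simp add: mom'_def wght_def)
  finally show ?thesis .
qed

text \<open>Cutting the function off to the negative axis makes its surviving part vanish in the
  balance equation, so that the exit term equals \<open>EA x k\<close> of the kernel of the cut
  function. Applying this to \<open>F\<close> and to its negative gives the absolute value.\<close>

lemma ED_overshoot:
  assumes F: "lingrowth F" and K: "K \<ge> 0" and neg: "\<And>y. y < 0 \<Longrightarrow> \<bar>F y\<bar> \<le> K * (1 + \<bar>y\<bar>) powr (1 + d)" and x: "x \<ge> 0"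
  shows "\<bar>ED x k F\<bar> \<le> K * mom' * EA x k (wght 1)"
proof -
  have *: "ED x k G \<le> K * mom' * EA x k (wght 1)"
    if G: "lingrowth G" and neg: "\<And>y. y < 0 \<Longrightarrow> \<bar>G y\<bar> \<le> K * (1 + \<bar>y\<bar>) powr (1 + d)" for G
  proof -
    define H where "H y = indicator {..<0} y * G y" for y
    have H: "lingrowth H"
    proof -
      obtain c where "\<And>y. \<bar>G y\<bar> \<le> c * (1 + \<bar>y\<bar>)" and [measurable]: "G \<in> borel_measurable borel"
        using G unfolding lingrowth_def by blast
      then show ?thesis
      proof (intro lingrowthI[of _ c])
        fix y assume b: "\<And>y. \<bar>G y\<bar> \<le> c * (1 + \<bar>y\<bar>)"
        show "\<bar>H y\<bar> \<le> c * (1 + \<bar>y\<bar>)"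
          using order_trans[OF abs_ge_zero b[of y]] b[of y] by (cases "y < 0") (simp_all add: H_def)
      qed (simp add: H_def[abs_def])
    qed
    have "ED x k G = ED x k H"
      unfolding ED_def by (intro Bochner_Integration.integral_cong) (auto simp: H_def dies_def indicator_def)
    also have "\<dots> = EA x (Suc k) H + ED x k H"
    proof -
      have "EA x (Suc k) H = EA x (Suc k) (\<lambda>_. 0)"
        unfolding EA_def by (intro Bochner_Integration.integral_cong refl)
          (auto simp: H_def indicator_def dest: alive_nonneg[OF x])
      then show ?thesis by (simp add: EA_const)
    qed
    also have "\<dots> = EA x k (kern H)" by (rule EA_ED_step[OF H])
    also have "\<dots> \<le> EA x k (\<lambda>y. K * mom' * wght 1 y)"
    proof (intro EA_mono lingrowth_kern H lingrowth_cmult lingrowth_wght x kern_overshoot K)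
      show "\<bar>H y\<bar> \<le> K * (1 + \<bar>y\<bar>) powr (1 + d)" if "y < 0" for y
        using neg[OF that] that by (simp add: H_def)
    qed (simp_all add: H_def)
    finally show ?thesis by (simp add: EA_cmult)
  qed
  have "ED x k (\<lambda>y. -1 * F y) = - ED x k F" by (subst ED_cmult) simp
  then show ?thesis
    using *[OF F neg] *[of "\<lambda>y. -1 * F y"] lingrowth_cmult[OF F, of "-1"] neg by (simp add: abs_le_iff)
qed

definition over :: "real \<Rightarrow> nat \<Rightarrow> real" where
  "over x k = ED x k (\<lambda>y. - y)"

lemma lingrowth_uminus: "lingrowth (\<lambda>y. - y)"
  by (rule lingrowthI[of _ 1]) auto

lemma over_nonneg: "0 \<le> over x k"
  unfolding over_def by (rule ED_nonneg) simp

lemma over_le: "x \<ge> 0 \<Longrightarrow> over x k \<le> mom' * EA x k (wght 1)"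
proof -
  assume x: "x \<ge> 0"
  have "\<bar>- y\<bar> \<le> 1 * (1 + \<bar>y\<bar>) powr (1 + d)" for y :: real
    using powr_mono[of 1 "1 + d" "1 + \<bar>y\<bar>"] d_pos by simp
  from ED_overshoot[OF lingrowth_uminus _ this x, of k] show ?thesis by (simp add: over_def)
qed

lemma sum_over_le:
  "\<exists>C>0. \<forall>x\<ge>0. \<forall>m n. m \<le> n \<longrightarrow> (\<Sum>k=m..<n. over x k) \<le> C * EA x m (lyap 1)"
proof -
  obtain C where C: "C > 0" "\<And>x m n. x \<ge> 0 \<Longrightarrow> m \<le> n \<Longrightarrow> (\<Sum>k=m..<n. EA x k (wght 1)) \<le> C * EA x m (lyap 1)"
    using green by blast
  have "(\<Sum>k=m..<n. over x k) \<le> mom' * C * EA x m (lyap 1)" if "x \<ge> 0" "m \<le> n" for x m n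
  proof -
    have "(\<Sum>k=m..<n. over x k) \<le> mom' * (\<Sum>k=m..<n. EA x k (wght 1))"
      unfolding sum_distrib_left by (intro sum_mono over_le that)
    also have "\<dots> \<le> mom' * (C * EA x m (lyap 1))"
      using mom'_ge C(2)[OF that] by (intro mult_left_mono) auto
    finally show ?thesis by simp
  qed
  moreover have "mom' * C > 0" using mom'_ge C by simp
  ultimately show ?thesis by blast
qed

text \<open>Optional stopping for the martingale x + S_n. The sum on the right is the mean overshoot
  of exits up to time \<open>n\<close>; its limit is what distinguishes V(x) from x.\<close>

lemma EA_id: "EA x n (\<lambda>y. y) = x + (\<Sum>k<n. over x k)"
proof (induction n)
  case (Suc n)
  have "over x n = - ED x n (\<lambda>y. y)" unfolding over_def ED_def by simp
  moreover have "EA x (Suc n) (\<lambda>y. y) + ED x n (\<lambda>y. y) = EA x n (\<lambda>y. y)"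
    using EA_ED_step[OF lingrowth_id, of x n] by (simp add: kern_id[abs_def])
  ultimately show ?case using Suc by simp
qed (simp add: EA_0)

lemma sum_over_bound: "\<exists>C>0. \<forall>x\<ge>0. \<forall>n. (\<Sum>k<n. over x k) \<le> C * (1 + x) powr (1 - d)"
proof -
  obtain C where C: "C > 0" "\<And>x m n. x \<ge> 0 \<Longrightarrow> m \<le> n \<Longrightarrow> (\<Sum>k=m..<n. over x k) \<le> C * EA x m (lyap 1)"
    using sum_over_le by blast
  then show ?thesis using C(2)[of _ 0] by (auto simp: EA_0 lyap_def atLeast0LessThan intro!: exI[of _ C])
qed

lemma EA_id_bound: "\<exists>C>0. \<forall>x\<ge>0. \<forall>n. EA x n (\<lambda>y. y) \<le> C * (1 + x)"
proof -
  obtain C where C: "C > 0" "\<And>x n. x \<ge> 0 \<Longrightarrow> (\<Sum>k<n. over x k) \<le> C * (1 + x) powr (1 - d)"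
    using sum_over_bound by blast
  have "EA x n (\<lambda>y. y) \<le> (C + 1) * (1 + x)" if "x \<ge> 0" for x n
  proof -
    have "(1 + x) powr (1 - d) \<le> (1 + x) powr 1" using that d_pos by (intro powr_mono) auto
    then have "C * (1 + x) powr (1 - d) \<le> C * (1 + x)" using C(1) that by (intro mult_left_mono) auto
    then show ?thesis using C(2)[OF that, of n] by (simp add: EA_id algebra_simps)
  qed
  then show ?thesis using C(1) by (intro exI[of _ "C + 1"]) auto
qed

end

section \<open>Concentration and survival probability\<close>

text \<open>The integral test, by telescoping \<open>w powr (- d)\<close>. The mean value point is
  at most w + s, hence at most (1 + s) w, which costs the factor
  \<open>(1 + s) powr (1 + d)\<close>.\<close>

lemma sum_powr_bound:
  fixes s d :: real
  assumes "s > 0" "d > 0"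
  shows "\<exists>C>0. \<forall>v\<ge>1. \<forall>N::nat. (\<Sum>i<N. (v + s * real i) powr (-1 - d)) \<le> C * v powr (- d)"
proof -
  define C where "C = (1 + s) powr (1 + d) / (s * d)"
  have C: "C > 0" using assms by (simp add: C_def)
  have step: "w powr (-1 - d) \<le> C * (w powr (- d) - (w + s) powr (- d))" if w: "w \<ge> 1" for w
  proof -
    have "\<exists>z. w < z \<and> z < w + s \<and> (w + s) powr (- d) - w powr (- d) = (w + s - w) * (- d * z powr (- d - 1))"
      using w assms by (intro MVT2) (auto intro!: derivative_eq_intros)
    then obtain z where z: "w < z" "z < w + s"
      and "(w + s) powr (- d) - w powr (- d) = (w + s - w) * (- d * z powr (- d - 1))" by blast
    moreover have "- d - 1 = -1 - d" by simp
    ultimately have e: "w powr (- d) - (w + s) powr (- d) = s * d * z powr (-1 - d)"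
      by (simp only:) (simp add: algebra_simps)
    have "s \<le> s * w" using w assms by simp
    then have "z \<le> (1 + s) * w" using z unfolding distrib_right by linarith
    then have "((1 + s) * w) powr (-1 - d) \<le> z powr (-1 - d)" using z w assms by (intro powr_mono2') auto
    then have "(1 + s) powr (1 + d) * ((1 + s) powr (-1 - d) * w powr (-1 - d)) \<le> (1 + s) powr (1 + d) * z powr (-1 - d)"
      using w assms by (intro mult_left_mono) (auto simp: powr_mult)
    moreover have "(1 + s) powr (1 + d) * ((1 + s) powr (-1 - d) * w powr (-1 - d)) = w powr (-1 - d)"
      using assms by (simp flip: mult.assoc powr_add)
    ultimately show ?thesis unfolding e C_def using assms by simp
  qed
  have "(\<Sum>i<N. (v + s * real i) powr (-1 - d)) \<le> C * (v powr (- d) - (v + s * real N) powr (- d))" if v: "v \<ge> 1" for v N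
  proof (induction N)
    case (Suc N)
    have "(v + s * real N) powr (-1 - d) \<le> C * ((v + s * real N) powr (- d) - (v + s * real N + s) powr (- d))"
      using v assms by (intro step) (auto intro: add_increasing2)
    with Suc show ?case by (simp add: algebra_simps)
  qed simp
  note telescoped = this
  have "(\<Sum>i<N. (v + s * real i) powr (-1 - d)) \<le> C * v powr (- d)" if v: "v \<ge> 1" for v N
  proof -
    have "C * (v powr (- d) - (v + s * real N) powr (- d)) \<le> C * v powr (- d)"
      using C by (intro mult_left_mono) auto
    then show ?thesis using telescoped[OF v, of N] by linarith
  qed
  with C show ?thesis by blast
qed

context centred_walk
begin

text \<open>The variance still to run after step \<open>k\<close> of \<open>n\<close>, when
  \<open>v\<close> is to be left over at the end.\<close>

definition vv :: "nat \<Rightarrow> real \<Rightarrow> nat \<Rightarrow> real" where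
  "vv n v k = v + \<sigma>\<^sup>2 * (real n - real k)"

lemma vv_ge: "k \<le> n \<Longrightarrow> v \<le> vv n v k"
  by (simp add: vv_def)

lemma vv_Suc: "vv n v k = vv n v (Suc k) + \<sigma>\<^sup>2"
  by (simp add: vv_def algebra_simps)

lemma vv_self [simp]: "vv n v n = v"
  by (simp add: vv_def)

lemma sum_vv:
  "\<exists>C>0. \<forall>v\<ge>1. \<forall>m n. (\<Sum>k=m..<n. vv n v (Suc k) powr (-1 - d)) \<le> C * v powr (- d)"
proof -
  have "\<sigma>\<^sup>2 > 0" using sigma_pos by simp
  from sum_powr_bound[OF this d_pos] obtain C where C: "C > 0"
    "\<And>v N. v \<ge> 1 \<Longrightarrow> (\<Sum>i<N. (v + \<sigma>\<^sup>2 * real i) powr (-1 - d)) \<le> C * v powr (- d)" by blast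
  have "(\<Sum>k=m..<n. vv n v (Suc k) powr (-1 - d)) = (\<Sum>i<n - m. (v + \<sigma>\<^sup>2 * real i) powr (-1 - d))" for m n v
    by (rule sum.reindex_bij_witness[of _ "\<lambda>i. n - Suc i" "\<lambda>k. n - Suc k"])
       (auto simp: vv_def of_nat_diff)
  with C show ?thesis by auto
qed

text \<open>The interval is dominated by a smoothed indicator, which is carried back from time
  \<open>n\<close> to \<open>n div 2\<close>. There the smoothing width is of order sqrt n, so the
  function is only O(R / sqrt n). The exit terms are nonnegative and are dropped, and every
  remaining term carries survival at \<open>n div 2\<close>. A final variance R^2 makes the
  Lindeberg errors sum to R^(-2d).\<close>

lemma concentration:
  "\<exists>C>0. \<forall>x\<ge>0. \<forall>n\<ge>1. \<forall>R\<ge>1. \<forall>b.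
     EA x n (indicator {b..b + R}) \<le> C * surv x (n div 2) * (R / sqrt (real n) + R powr (- 2 * d))"
proof -
  obtain Cs where Cs: "Cs > 0" "\<And>v m n. v \<ge> 1 \<Longrightarrow> (\<Sum>k=m..<n. vv n v (Suc k) powr (-1 - d)) \<le> Cs * v powr (- d)"
    using sum_vv by blast
  define c1 where "c1 = 2 * gint 1"
  have c1: "c1 > 0" using gint_strict_mono[of 0 1] by (simp add: c1_def)
  define C where "C = (5 / \<sigma> + 2 * cheat * Cs) / c1"
  have C: "C > 0" using c1 sigma_pos cheat_pos Cs by (simp add: C_def add_pos_pos)
  have "EA x n (indicator {b..b + R}) \<le> C * surv x (n div 2) * (R / sqrt (real n) + R powr (- 2 * d))"
    if x: "x \<ge> 0" and n: "n \<ge> 1" and R: "R \<ge> 1" for x n R b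
  proof -
    define j where "j = n div 2"
    have j: "j \<le> n" "real n / 2 \<le> real n - real j" unfolding j_def by linarith+
    define v where "v = vv n (R\<^sup>2)"
    have R2: "R\<^sup>2 \<ge> 1" using R by simp
    have v1: "v k \<ge> 1" if "k \<le> n" for k using vv_ge[OF that, of "R\<^sup>2"] R2 by (simp add: v_def)
    \<comment> \<open>The indicator of [b - R, b + 2R] smoothed by variance \<open>v k\<close>. At
      time \<open>n\<close> the smoothing width is \<open>R\<close>, and points of [b, b + R] are at
      distance at least \<open>R\<close> from both ends, whence the lower bound
      \<open>c1 = 2 * gint 1\<close>.\<close>
    define F where "F k y = heat (v k) (y + (R - b)) - heat (v k) (y + (- b - 2 * R))" for k y
    have Flin: "lingrowth (F k)" for k
      unfolding F_def by (intro lingrowth_diff lingrowth_heat_shift)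
    have F0: "F k y \<ge> 0" if "k \<le> n" for k y
      using v1[OF that] R by (simp add: F_def heat_mono)
    have err: "\<bar>kern (F (Suc k)) y - F k y\<bar> \<le> 2 * cheat * v (Suc k) powr (-1 - d)" if "k < n" for k y
    proof -
      have vk: "v k = v (Suc k) + \<sigma>\<^sup>2" unfolding v_def by (rule vv_Suc)
      have v1: "v (Suc k) \<ge> 1" using v1[of "Suc k"] that by simp
      have "kern (F (Suc k)) y = kern (\<lambda>y. heat (v (Suc k)) (y + (R - b))) y - kern (\<lambda>y. heat (v (Suc k)) (y + (- b - 2 * R))) y"
        unfolding F_def by (intro kern_diff lingrowth_heat_shift)
      then show ?thesis
        using kern_heat_shift[OF v1, of "R - b" y] kern_heat_shift[OF v1, of "- b - 2 * R" y]
        unfolding F_def[of k] vk by linarith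
    qed
    have tele: "\<bar>EA x n (F n) + (\<Sum>k=j..<n. ED x k (F (Suc k))) - EA x j (F j)\<bar> \<le> (\<Sum>k=j..<n. 2 * cheat * v (Suc k) powr (-1 - d) * surv x k)"
      by (rule telescoping[OF Flin x j(1)], rule err)
    have "(\<Sum>k=j..<n. ED x k (F (Suc k))) \<ge> 0"
      by (intro sum_nonneg ED_nonneg F0) auto
    then have "EA x n (F n) \<le> EA x j (F j) + (\<Sum>k=j..<n. 2 * cheat * v (Suc k) powr (-1 - d) * surv x k)"
      using tele by linarith
    also have "(\<Sum>k=j..<n. 2 * cheat * v (Suc k) powr (-1 - d) * surv x k) \<le> (\<Sum>k=j..<n. 2 * cheat * v (Suc k) powr (-1 - d) * surv x j)"
      using cheat_pos by (intro sum_mono mult_left_mono surv_antimono) auto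
    also have "\<dots> = 2 * cheat * surv x j * (\<Sum>k=j..<n. v (Suc k) powr (-1 - d))"
      by (simp add: sum_distrib_left mult_ac)
    also have "\<dots> \<le> 2 * cheat * surv x j * (Cs * (R\<^sup>2) powr (- d))"
      unfolding v_def using cheat_pos surv_nonneg R2 by (intro mult_left_mono Cs) auto
    also have "(R\<^sup>2) powr (- d) = R powr (- 2 * d)"
    proof -
      have "R\<^sup>2 = R powr 2" using R by simp
      then show ?thesis by (simp only: powr_powr) simp
    qed
    also have "EA x j (F j) \<le> EA x j (\<lambda>_. 5 / \<sigma> * (R / sqrt (real n)))"
    proof (intro EA_mono Flin lingrowth_const x)
      fix y
      have "F j y \<le> 3 * R / sqrt (v j)"
        using heat_lipschitz[of "v j" "y + (R - b)" "y + (- b - 2 * R)"] v1[OF j(1)] R by (simp add: F_def)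
      also have "\<dots> \<le> 3 * R / (\<sigma> * (sqrt (real n) / sqrt 2))"
      proof (intro divide_left_mono)
        have "\<sigma>\<^sup>2 * (real n / 2) \<le> \<sigma>\<^sup>2 * (real n - real j)" using j by (intro mult_left_mono) auto
        also have "\<dots> \<le> v j" by (simp add: v_def vv_def)
        finally have "sqrt (\<sigma>\<^sup>2 * (real n / 2)) \<le> sqrt (v j)" by simp
        then show "\<sigma> * (sqrt (real n) / sqrt 2) \<le> sqrt (v j)"
          using sigma_pos by (simp add: real_sqrt_mult real_sqrt_divide)
      qed (use R sigma_pos n v1[OF j(1)] in auto)
      also have "\<dots> = 3 * sqrt 2 / \<sigma> * (R / sqrt (real n))" by simp
      also have "\<dots> \<le> 5 / \<sigma> * (R / sqrt (real n))"
      proof (intro mult_right_mono divide_right_mono)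
        have "sqrt 2 \<le> 5/3" by (rule real_le_lsqrt) (auto simp: power2_eq_square)
        then show "3 * sqrt 2 \<le> 5" by simp
      qed (use R sigma_pos in auto)
      finally show "F j y \<le> 5 / \<sigma> * (R / sqrt (real n))" .
    qed
    also have "EA x j (\<lambda>_. 5 / \<sigma> * (R / sqrt (real n))) = 5 / \<sigma> * (R / sqrt (real n)) * surv x j" by (rule EA_const)
    finally have up: "EA x n (F n) \<le> 5 / \<sigma> * (R / sqrt (real n)) * surv x j + 2 * cheat * surv x j * (Cs * R powr (- 2 * d))"
      by simp
    have "EA x n (\<lambda>y. c1 * indicator {b..b + R} y) \<le> EA x n (F n)"
    proof (intro EA_mono Flin x)
      show "lingrowth (\<lambda>y. c1 * indicator {b..b + R} y)"
        by (intro lingrowth_cmult lingrowth_bounded[of _ 1]) (auto simp: indicator_def)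
      fix y
      show "c1 * indicator {b..b + R} y \<le> F n y"
      proof (cases "y \<in> {b..b + R}")
        case True
        have vn: "sqrt (v n) = R" using R by (simp add: v_def)
        have "gint 1 \<le> heat (v n) (y + (R - b))"
          unfolding heat_def vn using True R by (intro gint_mono) (auto simp: field_simps)
        moreover have "heat (v n) (y + (- b - 2 * R)) \<le> gint (-1)"
          unfolding heat_def vn using True R by (intro gint_mono) (auto simp: field_simps)
        ultimately show ?thesis using True by (simp add: F_def c1_def gint_odd)
      qed (use F0[of n y] in simp)
    qed
    then have "c1 * EA x n (indicator {b..b + R}) \<le> EA x n (F n)" by (simp add: EA_cmult)
    also note up
    also have "5 / \<sigma> * (R / sqrt (real n)) * surv x j + 2 * cheat * surv x j * (Cs * R powr (- 2 * d))
        \<le> (5 / \<sigma> + 2 * cheat * Cs) * surv x j * (R / sqrt (real n) + R powr (- 2 * d))"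
    proof -
      have "0 \<le> (5 / \<sigma>) * surv x j * R powr (- 2 * d)" "0 \<le> 2 * cheat * Cs * surv x j * (R / sqrt (real n))"
        using sigma_pos cheat_pos Cs(1) surv_nonneg[of x j] R by (auto intro!: mult_nonneg_nonneg divide_nonneg_nonneg)
      then show ?thesis by (simp add: algebra_simps)
    qed
    finally have "EA x n (indicator {b..b + R}) \<le> (5 / \<sigma> + 2 * cheat * Cs) * surv x j * (R / sqrt (real n) + R powr (- 2 * d)) / c1"
      using c1 by (simp add: field_simps)
    then show ?thesis by (simp add: C_def j_def)
  qed
  with C show ?thesis by blast
qed

lemma lingrowth_indicator: "A \<in> sets borel \<Longrightarrow> lingrowth (indicator A)"
  by (rule lingrowth_bounded[of _ 1]) (auto simp: indicator_def)

text \<open>Surviving paths are either above R of order sqrt n, which the bounded mean of the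
  surviving position makes rare, or inside [0, R], where concentration returns a small multiple of
  survival at time n/2. Halving the time inflates the claimed bound by at most 2, so a factor 1/4 in
  the recursion leaves room for induction.\<close>

lemma survival: "\<exists>C>0. \<forall>x\<ge>0. \<forall>n. surv x n \<le> C * (1 + x) / sqrt (real n + 1)"
proof -
  obtain Ce where Ce: "Ce > 0" "\<And>x n. x \<ge> 0 \<Longrightarrow> EA x n (\<lambda>y. y) \<le> Ce * (1 + x)"
    using EA_id_bound by blast
  obtain Cc where Cc: "Cc > 0" "\<And>x n R b. x \<ge> 0 \<Longrightarrow> n \<ge> 1 \<Longrightarrow> R \<ge> 1 \<Longrightarrow>
     EA x n (indicator {b..b + R}) \<le> Cc * surv x (n div 2) * (R / sqrt (real n) + R powr (- 2 * d))"
    using concentration by blast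
  \<comment> \<open>With R = \<kappa> sqrt n, the two terms of the concentration bound contribute
    1/8 each: the first by the choice of \<open>\<kappa>\<close>, the second once
    \<open>R \<ge> R0\<close>, that is, once n is at least \<open>N0\<close>.\<close>
  define \<kappa> where "\<kappa> = 1 / (8 * Cc)"
  define R0 where "R0 = max 1 ((8 * Cc) powr (1 / (2 * d)))"
  define N0 where "N0 = (R0 / \<kappa>)\<^sup>2"
  \<comment> \<open>The first entry makes the claim trivial for n up to \<open>N0\<close>; the
    second makes the inhomogeneous term of the recursion at most half of the claimed bound.\<close>
  define K where "K = max (sqrt (N0 + 1)) (4 * Ce / \<kappa>)"
  have k: "\<kappa> > 0" using Cc by (simp add: \<kappa>_def)
  have K: "K > 0" using Ce k by (simp add: K_def less_max_iff_disj)
  have R0: "Cc * R powr (- 2 * d) \<le> 1/8" "R \<ge> 1" if "R \<ge> R0" for R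
  proof -
    show R: "R \<ge> 1" using that by (simp add: R0_def)
    have "8 * Cc = ((8 * Cc) powr (1 / (2 * d))) powr (2 * d)" using Cc d_pos by (simp add: powr_powr)
    also have "\<dots> \<le> R powr (2 * d)" using that d_pos by (intro powr_mono2) (auto simp: R0_def)
    finally show "Cc * R powr (- 2 * d) \<le> 1/8"
      using R by (simp add: powr_minus field_simps)
  qed
  have rec: "surv x n \<le> Ce * (1 + x) / (\<kappa> * sqrt (real n)) + surv x (n div 2) / 4"
    if x: "x \<ge> 0" and n: "n \<ge> 1" "real n \<ge> N0" for x n
  proof -
    define R where "R = \<kappa> * sqrt (real n)"
    have "R0 / \<kappa> \<le> sqrt (real n)" using n(2) by (intro real_le_rsqrt) (simp add: N0_def)
    then have R: "R \<ge> R0" using k by (simp add: R_def field_simps)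
    note R1 = R0(2)[OF R]
    have "surv x n = EA x n (\<lambda>_. 1)" by (simp add: EA_const)
    also have "\<dots> \<le> EA x n (\<lambda>y. 1 / R * y + indicator {0..0 + R} y)"
    proof (intro EA_mono lingrowth_const lingrowth_add lingrowth_cmult lingrowth_id lingrowth_indicator x)
      fix y :: real assume "y \<ge> 0"
      then show "1 \<le> 1 / R * y + indicator {0..0 + R} y"
        using R1 by (cases "y \<le> R") (auto simp: field_simps)
    qed simp
    also have "\<dots> = 1 / R * EA x n (\<lambda>y. y) + EA x n (indicator {0..0 + R})"
      by (subst EA_add) (auto intro!: lingrowth_cmult lingrowth_id lingrowth_indicator simp: EA_cmult simp del: add_0)
    also have "\<dots> \<le> 1 / R * (Ce * (1 + x)) + Cc * surv x (n div 2) * (R / sqrt (real n) + R powr (- 2 * d))"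
      using R1 by (intro add_mono mult_left_mono Ce Cc x n) auto
    also have "Cc * surv x (n div 2) * (R / sqrt (real n) + R powr (- 2 * d)) = surv x (n div 2) * (Cc * \<kappa> + Cc * R powr (- 2 * d))"
      using n(1) by (simp add: R_def algebra_simps)
    also have "\<dots> \<le> surv x (n div 2) * (1/4)"
      using R0(1)[OF R] Cc(1) surv_nonneg by (intro mult_left_mono) (auto simp: \<kappa>_def)
    finally show ?thesis by (simp add: R_def)
  qed
  have "surv x n \<le> K * (1 + x) / sqrt (real n + 1)" if x: "x \<ge> 0" for x n
  proof (induction n rule: less_induct)
    case (less n)
    show ?case
    proof (cases "n \<ge> 1 \<and> real n \<ge> N0")
      case False
      have "N0 > 0" using k by (simp add: N0_def R0_def)
      then have "real n \<le> N0" using False by (cases "n \<ge> 1") (auto simp: not_le)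
      then have "sqrt (real n + 1) \<le> K" by (simp add: K_def le_max_iff_disj)
      also have "\<dots> \<le> K * (1 + x)" using K x by simp
      finally have "1 \<le> K * (1 + x) / sqrt (real n + 1)" by simp
      then show ?thesis using surv_le_1[of x n] by linarith
    next
      case True
      then have n: "n \<ge> 1" "real n \<ge> N0" by auto
      have "surv x n \<le> Ce * (1 + x) / (\<kappa> * sqrt (real n)) + surv x (n div 2) / 4" by (rule rec[OF x n])
      also have "Ce * (1 + x) / (\<kappa> * sqrt (real n)) \<le> Ce * (1 + x) / (\<kappa> * (sqrt (real n + 1) / 2))"
      proof (intro divide_left_mono mult_left_mono)
        have "real n + 1 \<le> 4 * real n" using n by linarith
        then have "sqrt (real n + 1) \<le> sqrt (4 * real n)" by (rule real_sqrt_le_mono)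
        then show "sqrt (real n + 1) / 2 \<le> sqrt (real n)" by (simp add: real_sqrt_mult)
      qed (use k n Ce x in auto)
      also have "surv x (n div 2) / 4 \<le> (K * (1 + x) / sqrt (real (n div 2) + 1)) / 4"
        using n by (intro divide_right_mono less) auto
      also have "\<dots> \<le> (K * (1 + x) / (sqrt (real n + 1) / 2)) / 4"
      proof (intro divide_right_mono divide_left_mono)
        have "n + 1 \<le> 4 * (n div 2 + 1)" by presburger
        then have "real (n + 1) \<le> real (4 * (n div 2 + 1))" by (rule of_nat_mono)
        then have "real n + 1 \<le> 4 * (real (n div 2) + 1)" by simp
        then have "sqrt (real n + 1) \<le> sqrt (4 * (real (n div 2) + 1))" by (rule real_sqrt_le_mono)
        then show "sqrt (real n + 1) / 2 \<le> sqrt (real (n div 2) + 1)" unfolding real_sqrt_mult by simp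
      qed (use K x in auto)
      also have "Ce * (1 + x) / (\<kappa> * (sqrt (real n + 1) / 2)) = (2 * Ce / \<kappa>) * ((1 + x) / sqrt (real n + 1))"
        by simp
      also have "\<dots> \<le> (K / 2) * ((1 + x) / sqrt (real n + 1))"
        using x by (intro mult_right_mono) (auto simp: K_def)
      also have "(K * (1 + x) / (sqrt (real n + 1) / 2)) / 4 = (K / 2) * ((1 + x) / sqrt (real n + 1))" by simp
      finally show ?thesis by simp
    qed
  qed
  with K show ?thesis by blast
qed

text \<open>By \<open>sum_over_le\<close> the overshoot after time \<open>m\<close> is controlled by
  the Lyapunov value at time \<open>m\<close>. With R = sqrt m, this value is split at height R:
  above it, it is at most R^(-d) times the position, whose mean is bounded; below it, it is at most
  R^(1-d), to be multiplied by the survival probability. Both parts give (1 + x) R^(-d).\<close>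

lemma sum_over_tail:
  "\<exists>C>0. \<forall>x\<ge>0. \<forall>m\<ge>1. \<forall>n\<ge>m. (\<Sum>k=m..<n. over x k) \<le> C * (1 + x) * real m powr (- d / 2)"
proof -
  obtain Ce where Ce: "Ce > 0" "\<And>x n. x \<ge> 0 \<Longrightarrow> EA x n (\<lambda>y. y) \<le> Ce * (1 + x)"
    using EA_id_bound by blast
  obtain Cs where Cs: "Cs > 0" "\<And>x n. x \<ge> 0 \<Longrightarrow> surv x n \<le> Cs * (1 + x) / sqrt (real n + 1)"
    using survival by blast
  obtain C where C: "C > 0" "\<And>x m n. x \<ge> 0 \<Longrightarrow> m \<le> n \<Longrightarrow> (\<Sum>k=m..<n. over x k) \<le> C * EA x m (lyap 1)"
    using sum_over_le by blast
  have "(\<Sum>k=m..<n. over x k) \<le> (C * (Ce + 1 + Cs)) * (1 + x) * real m powr (- d / 2)"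
    if x: "x \<ge> 0" and m: "m \<ge> 1" "n \<ge> m" for x m n
  proof -
    define R where "R = sqrt (real m)"
    have R: "R \<ge> 1" using m by (simp add: R_def)
    have Rd: "R powr (- d) = real m powr (- d / 2)"
      using m by (simp add: R_def powr_half_sqrt[symmetric] powr_powr)
    have "EA x m (lyap 1) \<le> EA x m (\<lambda>y. R powr (- d) * (y + 1) + R powr (1 - d))"
    proof (intro EA_mono lingrowth_lyap lingrowth_add lingrowth_cmult lingrowth_id lingrowth_const x)
      fix y :: real assume y: "y \<ge> 0"
      show "lyap 1 y \<le> R powr (- d) * (y + 1) + R powr (1 - d)"
      proof (cases "1 + y \<ge> R")
        case True
        have "lyap 1 y = (1 + y) powr (- d) * (1 + y) powr 1"
          using y powr_add[of "1 + y" "- d" 1] by (simp add: lyap_def)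
        also have "\<dots> \<le> R powr (- d) * (1 + y) powr 1"
          using True R d_pos by (intro mult_right_mono powr_mono2') auto
        finally show ?thesis using y powr_ge_zero[of R "1 - d"] by (simp only: powr_one add.commute[of y 1])
      next
        case False
        then have "lyap 1 y \<le> R powr (1 - d)"
          using y d_le by (auto simp: lyap_def intro!: powr_mono2)
        then show ?thesis using y by (simp add: add_increasing)
      qed
    qed simp
    also have "\<dots> = R powr (- d) * (EA x m (\<lambda>y. y) + surv x m) + R powr (1 - d) * surv x m"
    proof -
      have "EA x m (\<lambda>y. R powr (- d) * (y + 1) + R powr (1 - d))
          = EA x m (\<lambda>y. R powr (- d) * (y + 1)) + EA x m (\<lambda>_. R powr (1 - d))"
        by (intro EA_add lingrowth_cmult lingrowth_add lingrowth_id lingrowth_const)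
      moreover have "EA x m (\<lambda>y. y + 1) = EA x m (\<lambda>y. y) + EA x m (\<lambda>_. 1)"
        by (intro EA_add lingrowth_id lingrowth_const)
      ultimately show ?thesis by (simp add: EA_cmult EA_const)
    qed
    also have "\<dots> \<le> R powr (- d) * (Ce * (1 + x) + (1 + x)) + R powr (- d) * (Cs * (1 + x))"
    proof (intro add_mono mult_left_mono Ce x)
      show "surv x m \<le> 1 + x" using surv_le_1[of x m] x by linarith
      have "surv x m \<le> Cs * (1 + x) / sqrt (real m + 1)" by (rule Cs(2)[OF x])
      also have "\<dots> \<le> Cs * (1 + x) / R"
        using Cs x R m by (intro divide_left_mono) (auto simp: R_def)
      finally have "R powr (1 - d) * surv x m \<le> R powr (1 - d) * (Cs * (1 + x) / R)"
        by (intro mult_left_mono) auto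
      also have "\<dots> = R powr (- d) * (Cs * (1 + x))"
        using R by (simp add: powr_diff powr_minus field_simps)
      finally show "R powr (1 - d) * surv x m \<le> R powr (- d) * (Cs * (1 + x))" .
    qed auto
    also have "\<dots> = (Ce + 1 + Cs) * (1 + x) * R powr (- d)" by (simp add: algebra_simps)
    finally have "C * EA x m (lyap 1) \<le> C * ((Ce + 1 + Cs) * (1 + x) * R powr (- d))"
      using C(1) by (intro mult_left_mono) auto
    with C(2)[OF x m(2)] show ?thesis by (simp add: Rd mult.assoc)
  qed
  moreover have "C * (Ce + 1 + Cs) > 0" using C Ce Cs by simp
  ultimately show ?thesis by blast
qed

section \<open>The total error of the telescoping\<close>

lemma sum_inverse_sqrt: "(\<Sum>k<n. 1 / sqrt (real k + 1)) \<le> 2 * sqrt (real n)"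
proof (induction n)
  case (Suc n)
  have "1 / sqrt (real n + 1) \<le> 2 * (sqrt (real n + 1) - sqrt (real n))"
  proof -
    have "(sqrt (real n + 1) - sqrt (real n)) * (sqrt (real n + 1) + sqrt (real n)) = 1"
      by (simp add: algebra_simps)
    moreover have "(sqrt (real n + 1) - sqrt (real n)) * (sqrt (real n + 1) + sqrt (real n))
        \<le> (sqrt (real n + 1) - sqrt (real n)) * (2 * sqrt (real n + 1))"
      by (intro mult_left_mono) auto
    moreover have "(sqrt (real n + 1) - sqrt (real n)) * (2 * sqrt (real n + 1))
        = 2 * (sqrt (real n + 1) - sqrt (real n)) * sqrt (real n + 1)" by simp
    ultimately have "1 \<le> 2 * (sqrt (real n + 1) - sqrt (real n)) * sqrt (real n + 1)" by linarith
    then show ?thesis by (simp add: pos_divide_le_eq)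
  qed
  with Suc show ?case by (simp add: add.commute)
qed simp

text \<open>In the first half of the steps the residual variance is of order n, so each error is
  n^(-1-d), and summing the survival bounds yields a factor sqrt n. In the second half survival is
  already O((1 + x) / sqrt n), and the time factors sum to v^(-d). The alternative 1 in the minimum
  comes from bounding survival by 1.\<close>

lemma lindeberg_sum:
  "\<exists>C>0. \<forall>x\<ge>0. \<forall>n\<ge>1. \<forall>v. 1 \<le> v \<longrightarrow> v \<le> real n \<longrightarrow>
     (\<Sum>k<n. vv n v (Suc k) powr (-1 - d) * surv x k) \<le> C * min 1 ((1 + x) / sqrt (real n)) * v powr (- d)"
proof -
  obtain Cs where Cs: "Cs > 0" "\<And>x n. x \<ge> 0 \<Longrightarrow> surv x n \<le> Cs * (1 + x) / sqrt (real n + 1)"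
    using survival by blast
  obtain Cv where Cv: "Cv > 0" "\<And>v m n. v \<ge> 1 \<Longrightarrow> (\<Sum>k=m..<n. vv n v (Suc k) powr (-1 - d)) \<le> Cv * v powr (- d)"
    using sum_vv by blast
  define c where "c = (\<sigma>\<^sup>2 / 2) powr (-1 - d)"
  have c: "c > 0" using sigma_pos by (simp add: c_def)
  define C where "C = max Cv (2 * Cs * c + 2 * Cs * Cv)"
  have "(\<Sum>k<n. vv n v (Suc k) powr (-1 - d) * surv x k) \<le> C * min 1 ((1 + x) / sqrt (real n)) * v powr (- d)"
    if x: "x \<ge> 0" and n: "n \<ge> 1" and v: "1 \<le> v" "v \<le> real n" for x n v
  proof -
    let ?s = "\<lambda>k. vv n v (Suc k) powr (-1 - d)"
    have "(\<Sum>k<n. ?s k * surv x k) \<le> (\<Sum>k=0..<n. ?s k)"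
      unfolding atLeast0LessThan by (intro sum_mono mult_left_le surv_le_1) auto
    also have "\<dots> \<le> Cv * v powr (- d)" by (rule Cv(2)[OF v(1)])
    also have "\<dots> \<le> C * v powr (- d)" by (intro mult_right_mono) (auto simp: C_def)
    finally have A: "(\<Sum>k<n. ?s k * surv x k) \<le> C * v powr (- d)" .
    define j where "j = n div 2"
    have j: "j \<le> n" unfolding j_def by simp
    have "(\<Sum>k<n. ?s k * surv x k) = (\<Sum>k<j. ?s k * surv x k) + (\<Sum>k=j..<n. ?s k * surv x k)"
      using sum.atLeastLessThan_concat[of 0 j n "\<lambda>k. ?s k * surv x k"] j by (simp add: atLeast0LessThan)
    also have "(\<Sum>k<j. ?s k * surv x k) \<le> (\<Sum>k<j. c * real n powr (-1 - d) * (Cs * (1 + x) * (1 / sqrt (real k + 1))))"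
    proof (intro sum_mono mult_mono)
      fix k assume k: "k \<in> {..<j}"
      then have "2 * Suc k \<le> n" unfolding j_def lessThan_iff by presburger
      then have "real (2 * Suc k) \<le> real n" by (rule of_nat_mono)
      then have "real n / 2 \<le> real n - real (Suc k)" by simp
      then have "\<sigma>\<^sup>2 * (real n / 2) \<le> \<sigma>\<^sup>2 * (real n - real (Suc k))" by (intro mult_left_mono) auto
      then have "\<sigma>\<^sup>2 / 2 * real n \<le> vv n v (Suc k)" using v by (simp add: vv_def)
      then have "?s k \<le> (\<sigma>\<^sup>2 / 2 * real n) powr (-1 - d)"
        using sigma_pos n d_pos by (intro powr_mono2') auto
      also have "\<dots> = c * real n powr (-1 - d)" unfolding c_def by (rule powr_mult)
      finally show "?s k \<le> c * real n powr (-1 - d)" .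
      show "surv x k \<le> Cs * (1 + x) * (1 / sqrt (real k + 1))" using Cs(2)[OF x, of k] by simp
    qed (use c surv_nonneg in auto)
    also have "\<dots> = c * real n powr (-1 - d) * (Cs * (1 + x)) * (\<Sum>k<j. 1 / sqrt (real k + 1))"
      by (simp only: sum_distrib_left mult.assoc)
    also have "\<dots> \<le> c * real n powr (-1 - d) * (Cs * (1 + x)) * (2 * sqrt (real n))"
    proof (intro mult_left_mono)
      show "(\<Sum>k<j. 1 / sqrt (real k + 1)) \<le> 2 * sqrt (real n)"
        using sum_inverse_sqrt[of j] j by (smt (verit) of_nat_le_iff real_sqrt_le_mono)
    qed (use c Cs x in auto)
    also have "\<dots> = 2 * Cs * c * (1 + x) / sqrt (real n) * real n powr (- d)"
    proof -
      have "real n powr (-1 - d) * sqrt (real n) = real n powr (- d) / sqrt (real n)"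
        using n by (simp add: powr_diff powr_minus field_simps)
      moreover have "c * real n powr (-1 - d) * (Cs * (1 + x)) * (2 * sqrt (real n))
          = 2 * Cs * c * (1 + x) * (real n powr (-1 - d) * sqrt (real n))" by (simp only: mult_ac)
      ultimately show ?thesis by simp
    qed
    also have "\<dots> \<le> 2 * Cs * c * (1 + x) / sqrt (real n) * v powr (- d)"
      using v c Cs x d_pos by (intro mult_left_mono powr_mono2') auto
    also have "(\<Sum>k=j..<n. ?s k * surv x k) \<le> (\<Sum>k=j..<n. ?s k * surv x j)"
      by (intro sum_mono mult_left_mono surv_antimono) auto
    also have "\<dots> = (\<Sum>k=j..<n. ?s k) * surv x j" by (simp add: sum_distrib_right)
    also have "\<dots> \<le> Cv * v powr (- d) * (2 * Cs * (1 + x) / sqrt (real n))"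
    proof (intro mult_mono Cv(2)[OF v(1)])
      have "surv x j \<le> Cs * (1 + x) / sqrt (real j + 1)" by (rule Cs(2)[OF x])
      also have "\<dots> \<le> Cs * (1 + x) / (sqrt (real n) / 2)"
      proof (intro divide_left_mono)
        have "n \<le> 4 * (j + 1)" unfolding j_def by presburger
        then have "real n \<le> real (4 * (j + 1))" by (rule of_nat_mono)
        then have "sqrt (real n) \<le> sqrt (4 * (real j + 1))" by simp
        then show "sqrt (real n) / 2 \<le> sqrt (real j + 1)" unfolding real_sqrt_mult by simp
      qed (use Cs x n in auto)
      finally show "surv x j \<le> 2 * Cs * (1 + x) / sqrt (real n)" by (simp add: field_simps)
    qed (use Cv surv_nonneg in auto)
    finally have "(\<Sum>k<n. ?s k * surv x k) \<le> (2 * Cs * c + 2 * Cs * Cv) * ((1 + x) / sqrt (real n)) * v powr (- d)"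
      by (simp add: algebra_simps add_divide_distrib)
    also have "\<dots> \<le> C * ((1 + x) / sqrt (real n)) * v powr (- d)"
      using x by (intro mult_right_mono) (auto simp: C_def)
    finally have B: "(\<Sum>k<n. ?s k * surv x k) \<le> C * ((1 + x) / sqrt (real n)) * v powr (- d)" .
    show ?thesis using A B by (simp add: min_def)
  qed
  moreover have "C > 0" using Cv by (simp add: C_def less_max_iff_disj)
  ultimately show ?thesis by blast
qed

end

section \<open>Absorbed Brownian motion\<close>

text \<open>The law of Brownian motion of variance \<open>v\<close> killed at \<open>0\<close>, by the reflection principle:
  \<open>usol v T y\<close> is the odd extension in \<open>y\<close> of the probability of survival with endpoint in \<open>[0, T]\<close>,
  and \<open>uslope v T\<close> is its derivative at \<open>y = 0\<close>.\<close>

definition usol :: "real \<Rightarrow> real \<Rightarrow> real \<Rightarrow> real" where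
  "usol v T y = 2 * heat v y - heat v (y - T) - heat v (y + T)"

definition uslope :: "real \<Rightarrow> real \<Rightarrow> real" where
  "uslope v T = 2 * heat' v 0 - 2 * heat' v T"

lemma heat'_even: "heat' v (- y) = heat' v y"
  by (simp add: heat'_def gphi_even flip: minus_divide_left)

lemma abs_second_difference:
  fixes a b c e :: real
  assumes "\<bar>a\<bar> \<le> e" "\<bar>b\<bar> \<le> e" "\<bar>c\<bar> \<le> e"
  shows "\<bar>2 * a - b - c\<bar> \<le> 4 * e"
  using assms by linarith

text \<open>By oddness of the heat flow the base values at T and -T cancel. Bounds on increments of
  \<open>heat\<close> thus pass to \<open>usol\<close> at the cost of a factor 4, with no separate
  argument at the boundary.\<close>

lemma usol_increments:
  "usol v T y = 2 * (heat v (0 + y) - heat v 0) - (heat v (- T + y) - heat v (- T)) - (heat v (T + y) - heat v T)"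
  by (simp add: usol_def heat_odd algebra_simps)

lemma usol_abs_le_2: "\<bar>usol v T y\<bar> \<le> 2"
  using heat_abs_le[of v y] heat_abs_le[of v "y - T"] heat_abs_le[of v "y + T"]
  unfolding usol_def by linarith

lemma usol_abs_le: "v > 0 \<Longrightarrow> \<bar>usol v T y\<bar> \<le> 4 * \<bar>y\<bar> / sqrt v"
  using heat_lipschitz[of v "0 + y" 0] heat_lipschitz[of v "- T + y" "- T"] heat_lipschitz[of v "T + y" T]
  unfolding usol_increments by simp

lemma heat_taylor1:
  assumes "v > 0"
  shows "\<bar>heat v (b + y) - heat v b - y * heat' v b\<bar> \<le> y\<^sup>2 / v"
proof -
  have "\<exists>z. heat v (b + y) - heat v b = y * heat' v z \<and> \<bar>z - b\<bar> \<le> \<bar>y\<bar>"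
  proof (cases y "0 :: real" rule: linorder_cases)
    case less
    then obtain z where z: "b + y < z" "z < b" "heat v b - heat v (b + y) = (b - (b + y)) * heat' v z"
      using MVT2[of "b + y" b "heat v" "heat' v"] DERIV_heat[OF assms] by auto
    show ?thesis
      by (rule exI[of _ z]) (use z less in \<open>simp add: algebra_simps\<close>)
  next
    case greater
    then obtain z where z: "b < z" "z < b + y" "heat v (b + y) - heat v b = (b + y - b) * heat' v z"
      using MVT2[of b "b + y" "heat v" "heat' v"] DERIV_heat[OF assms] by auto
    show ?thesis
      by (rule exI[of _ z]) (use z greater in \<open>simp add: algebra_simps\<close>)
  qed auto
  then obtain z where z: "heat v (b + y) - heat v b = y * heat' v z" "\<bar>z - b\<bar> \<le> \<bar>y\<bar>" by blast
  have "\<bar>heat v (b + y) - heat v b - y * heat' v b\<bar> = \<bar>y\<bar> * \<bar>heat' v z - heat' v b\<bar>"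
    unfolding z(1) by (simp flip: abs_mult right_diff_distrib)
  also have "\<dots> \<le> \<bar>y\<bar> * (\<bar>y\<bar> / v)"
    using order_trans[OF heat'_lipschitz[OF assms, of z b] divide_right_mono[OF z(2)]] assms
    by (intro mult_left_mono) auto
  also have "\<dots> = y\<^sup>2 / v" by (simp add: power2_eq_square)
  finally show ?thesis .
qed

lemma usol_linear:
  assumes "v > 0"
  shows "\<bar>usol v T y - y * uslope v T\<bar> \<le> 4 * (y\<^sup>2 / v)"
proof -
  have "usol v T y - y * uslope v T = 2 * (heat v (0 + y) - heat v 0 - y * heat' v 0)
      - (heat v (- T + y) - heat v (- T) - y * heat' v (- T)) - (heat v (T + y) - heat v T - y * heat' v T)"
    unfolding usol_increments uslope_def heat'_even by (simp add: algebra_simps)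
  then show ?thesis
    by (simp only: abs_second_difference heat_taylor1[OF assms])
qed

lemma uslope_abs_le:
  assumes "v > 0"
  shows "\<bar>uslope v T\<bar> \<le> 2 / sqrt v"
  using heat'_bounds[OF assms, of 0] heat'_bounds[OF assms, of T] unfolding uslope_def by (simp add: abs_le_iff)

text \<open>Interpolation between the quadratic Taylor error and the linear bound, since the smaller
  of z^2 and z is below z^(1+d). The power \<open>1 + d\<close> is the one that
  \<open>ED_overshoot\<close> can integrate.\<close>

lemma usol_linear_powr:
  assumes v: "v > 0" and d: "0 \<le> d" "d \<le> 1"
  shows "\<bar>usol v T y - y * uslope v T\<bar> \<le> 6 * v powr (- (1 + d) / 2) * \<bar>y\<bar> powr (1 + d)"
proof -
  define z where "z = \<bar>y\<bar> / sqrt v"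
  have z: "z \<ge> 0" using v by (simp add: z_def)
  have zp: "z powr (1 + d) = v powr (- (1 + d) / 2) * \<bar>y\<bar> powr (1 + d)"
  proof -
    have "z powr (1 + d) = \<bar>y\<bar> powr (1 + d) / v powr ((1 + d) / 2)"
      using v unfolding z_def by (simp add: powr_divide powr_half_sqrt[symmetric] powr_powr)
    moreover have "v powr (- (1 + d) / 2) = inverse (v powr ((1 + d) / 2))"
      unfolding minus_divide_left[symmetric] by (rule powr_minus)
    ultimately show ?thesis by (simp only: divide_inverse mult.commute)
  qed
  have "\<bar>usol v T y - y * uslope v T\<bar> \<le> 4 * z\<^sup>2"
    using usol_linear[OF v, of T y] v by (simp add: z_def power_divide)
  moreover have "\<bar>usol v T y - y * uslope v T\<bar> \<le> 6 * z"
  proof -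
    have "\<bar>y * uslope v T\<bar> \<le> \<bar>y\<bar> * (2 / sqrt v)"
      unfolding abs_mult by (intro mult_left_mono uslope_abs_le v) auto
    then show ?thesis using usol_abs_le[OF v, of T y] by (simp add: z_def)
  qed
  moreover have "min (z\<^sup>2) z \<le> z powr (1 + d)"
  proof (cases "z \<le> 1")
    case True
    show ?thesis
    proof (cases "z = 0")
      case False
      then have "z powr 2 \<le> z powr (1 + d)" using z True d by (intro powr_mono') auto
      then show ?thesis using z False by (simp add: min_le_iff_disj)
    qed simp
  next
    case False
    then have "z powr 1 \<le> z powr (1 + d)" using d by (intro powr_mono) auto
    then show ?thesis using z by (simp add: min_le_iff_disj)
  qed
  ultimately show ?thesis using z by (auto simp: zp mult.assoc min_le_iff_disj)
qed

lemma uslope_time: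
  assumes "v \<ge> m" "v' \<ge> m" "m > 0"
  shows "\<bar>uslope v T - uslope v' T\<bar> \<le> 4 * (\<bar>v - v'\<bar> / (m * sqrt m))"
  using heat'_time_lipschitz[OF assms, of 0] heat'_time_lipschitz[OF assms, of T]
  unfolding uslope_def by linarith

lemma usol_time:
  assumes "v \<ge> m" "v' \<ge> m" "m > 0"
  shows "\<bar>usol v T y - usol v' T y\<bar> \<le> 4 * (\<bar>v - v'\<bar> / m)"
  using heat_time_lipschitz[OF assms, of y] heat_time_lipschitz[OF assms, of "y - T"] heat_time_lipschitz[OF assms, of "y + T"]
  unfolding usol_def by linarith

text \<open>Both solutions vanish at \<open>y = 0\<close>, so their difference is linear in
  \<open>y\<close>: the mean value theorem is applied in \<open>y\<close> to a difference in
  \<open>v\<close>. This supplies the factor x / sqrt n that the uniform bound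
  \<open>usol_time\<close> lacks.\<close>

lemma usol_time_linear:
  assumes "v \<ge> m" "v' \<ge> m" "m > 0" "y \<ge> 0"
  shows "\<bar>usol v T y - usol v' T y\<bar> \<le> 4 * (y * (\<bar>v - v'\<bar> / (m * sqrt m)))"
proof -
  have inc: "\<bar>(heat v (b + y) - heat v b) - (heat v' (b + y) - heat v' b)\<bar> \<le> y * (\<bar>v - v'\<bar> / (m * sqrt m))" for b
  proof (cases "y = 0")
    case False
    have "((\<lambda>y. heat v y - heat v' y) has_real_derivative (heat' v z - heat' v' z)) (at z)" for z
      using assms by (intro DERIV_diff DERIV_heat) auto
    then have "\<exists>z. b < z \<and> z < b + y \<and> (heat v (b + y) - heat v' (b + y)) - (heat v b - heat v' b) = (b + y - b) * (heat' v z - heat' v' z)"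
      using False assms by (intro MVT2[of b "b + y" "\<lambda>y. heat v y - heat v' y" "\<lambda>z. heat' v z - heat' v' z"]) auto
    then obtain z where "(heat v (b + y) - heat v b) - (heat v' (b + y) - heat v' b) = y * (heat' v z - heat' v' z)"
      by (auto simp: algebra_simps)
    then show ?thesis
      using mult_left_mono[OF heat'_time_lipschitz[OF assms(1-3), of z] assms(4)] assms(4) by (simp add: abs_mult)
  qed simp
  show ?thesis
    using abs_second_difference[OF inc[of 0] inc[of "- T"] inc[of T]]
    unfolding usol_increments by (simp only: algebra_simps)
qed

text \<open>At distance more than \<open>W\<close> from 0 and from \<open>T\<close>, each of the
  heat values involved is within v / (2 W^2) of 1/2 or -1/2, and these limits combine to the
  indicator.\<close>

lemma usol_indicator:
  assumes v: "v > 0" and T: "T \<ge> 0" and W: "W > 0" "y > W" "\<bar>y - T\<bar> > W"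
  shows "\<bar>usol v T y - indicator {0..T} y\<bar> \<le> 2 * (v / W\<^sup>2)"
proof -
  have tail: "1 - v / W\<^sup>2 \<le> 2 * heat v z \<and> 2 * heat v z \<le> 1" if "z \<ge> W" for z
  proof
    have "1 - 2 * heat v z \<le> v / z\<^sup>2" using that W by (intro heat_tail v) auto
    also have "\<dots> \<le> v / W\<^sup>2" using that W v by (intro divide_left_mono power_mono) auto
    finally show "1 - v / W\<^sup>2 \<le> 2 * heat v z" by simp
    show "2 * heat v z \<le> 1" using heat_abs_le[of v z] by simp
  qed
  have nn: "v / W\<^sup>2 \<ge> 0" using v by simp
  have 1: "1 - v / W\<^sup>2 \<le> 2 * heat v y \<and> 2 * heat v y \<le> 1" by (rule tail) (use W in simp)
  have 2: "1 - v / W\<^sup>2 \<le> 2 * heat v (y + T) \<and> 2 * heat v (y + T) \<le> 1" by (rule tail) (use W T in simp)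
  show ?thesis
  proof (cases "y \<le> T")
    case True
    then have "1 - v / W\<^sup>2 \<le> 2 * heat v (T - y) \<and> 2 * heat v (T - y) \<le> 1"
      using W by (intro tail) auto
    moreover have "heat v (y - T) = - heat v (T - y)" using heat_odd[of v "T - y"] by simp
    ultimately show ?thesis using True W 1 2 nn unfolding usol_def by (simp add: abs_le_iff)
  next
    case False
    then have "1 - v / W\<^sup>2 \<le> 2 * heat v (y - T) \<and> 2 * heat v (y - T) \<le> 1"
      using W by (intro tail) auto
    then show ?thesis using False W 1 2 nn unfolding usol_def by (simp add: abs_le_iff)
  qed
qed

section \<open>Comparison of the walk with absorbed Brownian motion\<close>

context centred_walk
begin

text \<open>The order of the survival probability. Keeping the minimum with 1 lets the same estimate
  serve starting points near 0 and beyond sqrt n.\<close>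

definition bnd :: "real \<Rightarrow> nat \<Rightarrow> real" where
  "bnd x n = min 1 ((1 + x) / sqrt (real n))"

lemma bnd_nonneg: "x \<ge> 0 \<Longrightarrow> 0 \<le> bnd x n" by (simp add: bnd_def)

lemma surv_half: "\<exists>C>0. \<forall>x\<ge>0. \<forall>n\<ge>1. surv x (n div 2) \<le> C * bnd x n"
proof -
  obtain Cs where Cs: "Cs > 0" "\<And>x n. x \<ge> 0 \<Longrightarrow> surv x n \<le> Cs * (1 + x) / sqrt (real n + 1)"
    using survival by blast
  have "surv x (n div 2) \<le> max 1 (2 * Cs) * bnd x n" if x: "x \<ge> 0" and n: "n \<ge> 1" for x n
  proof -
    have "surv x (n div 2) \<le> Cs * (1 + x) / sqrt (real (n div 2) + 1)" by (rule Cs(2)[OF x])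
    also have "\<dots> \<le> Cs * (1 + x) / (sqrt (real n) / 2)"
    proof (intro divide_left_mono)
      have "n \<le> 4 * (n div 2 + 1)" by presburger
      then have "real n \<le> real (4 * (n div 2 + 1))" by (rule of_nat_mono)
      then have "sqrt (real n) \<le> sqrt (4 * (real (n div 2) + 1))" by simp
      then show "sqrt (real n) / 2 \<le> sqrt (real (n div 2) + 1)" unfolding real_sqrt_mult by simp
    qed (use Cs x n in auto)
    also have "\<dots> = (2 * Cs) * ((1 + x) / sqrt (real n))" by simp
    also have "\<dots> \<le> max 1 (2 * Cs) * ((1 + x) / sqrt (real n))"
      using x by (intro mult_right_mono) auto
    finally show ?thesis
      using surv_le_1[of x "n div 2"] unfolding bnd_def by (auto simp: min_def)
  qed
  moreover have "max 1 (2 * Cs) > 0" by simp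
  ultimately show ?thesis by blast
qed

section \<open>From the indicator to the smooth solution\<close>

lemma lingrowth_usol: "lingrowth (usol v T)"
proof -
  have "lingrowth (\<lambda>y. 2 * heat v y - heat v (y + (- T)) - heat v (y + T))"
    by (intro lingrowth_diff lingrowth_cmult lingrowth_heat lingrowth_heat_shift)
  then show ?thesis by (simp add: usol_def[abs_def])
qed

lemma kern_usol:
  assumes "v \<ge> 1"
  shows "\<bar>kern (usol v T) y - usol (v + \<sigma>\<^sup>2) T y\<bar> \<le> 4 * cheat * v powr (-1 - d)"
proof -
  have "kern (usol v T) y = kern (\<lambda>y. 2 * heat v (y + 0) - heat v (y + (- T)) - heat v (y + T)) y"
    by (simp add: usol_def[abs_def])
  also have "\<dots> = 2 * kern (\<lambda>y. heat v (y + 0)) y - kern (\<lambda>y. heat v (y + (- T))) y - kern (\<lambda>y. heat v (y + T)) y"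
    by (simp only: kern_diff kern_cmult lingrowth_diff lingrowth_cmult lingrowth_heat_shift)
  finally have "kern (usol v T) y = 2 * kern (\<lambda>y. heat v (y + 0)) y - kern (\<lambda>y. heat v (y + (- T))) y - kern (\<lambda>y. heat v (y + T)) y" .
  moreover have "usol (v + \<sigma>\<^sup>2) T y = 2 * heat (v + \<sigma>\<^sup>2) (y + 0) - heat (v + \<sigma>\<^sup>2) (y + (- T)) - heat (v + \<sigma>\<^sup>2) (y + T)"
    by (simp add: usol_def)
  ultimately show ?thesis
    using kern_heat_shift[OF assms, of 0 y] kern_heat_shift[OF assms, of "- T" y] kern_heat_shift[OF assms, of T y]
    by linarith
qed

text \<open>Outside windows of half-width \<open>W\<close> around 0 and \<open>T\<close> the smooth
  solution is close to the indicator; inside them the difference is merely bounded, and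
  concentration bounds the mass of surviving paths there.\<close>

lemma smoothing_error:
  "\<exists>C>0. \<forall>x\<ge>0. \<forall>n\<ge>1. \<forall>v>0. \<forall>W\<ge>1. \<forall>T\<ge>0.
    \<bar>EA x n (indicator {0..T}) - EA x n (usol v T)\<bar> \<le> C * bnd x n * (v / W\<^sup>2 + W / sqrt (real n) + W powr (- 2 * d))"
proof -
  obtain Cc where Cc: "Cc > 0" "\<And>x n R b. x \<ge> 0 \<Longrightarrow> n \<ge> 1 \<Longrightarrow> R \<ge> 1 \<Longrightarrow>
     EA x n (indicator {b..b + R}) \<le> Cc * surv x (n div 2) * (R / sqrt (real n) + R powr (- 2 * d))"
    using concentration by blast
  obtain Ch where Ch: "Ch > 0" "\<And>x n. x \<ge> 0 \<Longrightarrow> n \<ge> 1 \<Longrightarrow> surv x (n div 2) \<le> Ch * bnd x n"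
    using surv_half by blast
  have "\<bar>EA x n (indicator {0..T}) - EA x n (usol v T)\<bar> \<le> ((2 + 9 * Cc) * Ch) * bnd x n * (v / W\<^sup>2 + W / sqrt (real n) + W powr (- 2 * d))"
    if x: "x \<ge> 0" and n: "n \<ge> 1" and v: "v > 0" and W: "W \<ge> 1" and T: "T \<ge> 0" for x n v W T
  proof -
    \<comment> \<open>The factor 3 bounds the difference of an indicator and \<open>usol\<close>,
      whose absolute value is at most 2. The windows are written as b..b + R to match
      \<open>concentration\<close>.\<close>
    define G :: "real \<Rightarrow> real" where "G y = 2 * (v / W\<^sup>2) + 3 * (indicator {0..0 + W} y + indicator {T - W..T - W + 2 * W} y)" for y
    have Glin: "lingrowth G"
      unfolding G_def by (intro lingrowth_add lingrowth_cmult lingrowth_const lingrowth_indicator) auto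
    have pt: "\<bar>indicator {0..T} y - usol v T y\<bar> \<le> G y" if y: "y \<ge> 0" for y
    proof (cases "y \<le> W \<or> \<bar>y - T\<bar> \<le> W")
      case True
      have "\<bar>indicator {0..T} y - usol v T y\<bar> \<le> 3"
        using usol_abs_le_2[of v T y] by (auto simp: indicator_def)
      moreover have "(1::real) \<le> indicator {0..0 + W} y + indicator {T - W..T - W + 2 * W} y"
        using True y by (auto simp: indicator_def)
      moreover have "0 \<le> v / W\<^sup>2" using v by simp
      moreover have "a \<le> 3 \<Longrightarrow> 1 \<le> p \<Longrightarrow> 0 \<le> q \<Longrightarrow> a \<le> 2 * q + 3 * p" for a p q :: real by linarith
      ultimately show ?thesis unfolding G_def by blast
    next
      case False
      have "(0::real) \<le> indicator {0..0 + W} y" "(0::real) \<le> indicator {T - W..T - W + 2 * W} y"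
        by (auto simp: indicator_def)
      moreover have "\<bar>usol v T y - indicator {0..T} y\<bar> \<le> 2 * (v / W\<^sup>2)"
        by (rule usol_indicator[OF v T]) (use W False in auto)
      moreover have "\<bar>a - b\<bar> \<le> 2 * q \<Longrightarrow> 0 \<le> p \<Longrightarrow> 0 \<le> r \<Longrightarrow> \<bar>b - a\<bar> \<le> 2 * q + 3 * (p + r)" for a b p q r :: real
        unfolding distrib_left by linarith
      ultimately show ?thesis unfolding G_def by blast
    qed
    have i: "lingrowth (indicator {0..T})" by (rule lingrowth_indicator) auto
    have "\<bar>EA x n (indicator {0..T}) - EA x n (usol v T)\<bar> \<le> EA x n G"
    proof -
      have "EA x n (\<lambda>y. indicator {0..T} y - usol v T y) \<le> EA x n G"
        by (intro EA_mono lingrowth_diff i lingrowth_usol Glin x abs_le_D1[OF pt])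
      moreover have "EA x n (\<lambda>y. usol v T y - indicator {0..T} y) \<le> EA x n G"
        by (intro EA_mono lingrowth_diff i lingrowth_usol Glin x) (use abs_le_D2[OF pt] in simp)
      ultimately show ?thesis by (simp add: EA_diff i lingrowth_usol abs_le_iff)
    qed
    also have "EA x n G = 2 * (v / W\<^sup>2) * surv x n + 3 * (EA x n (indicator {0..0 + W}) + EA x n (indicator {T - W..T - W + 2 * W}))"
    proof -
      have "EA x n G = EA x n (\<lambda>_. 2 * (v / W\<^sup>2)) + EA x n (\<lambda>y. 3 * (indicator {0..0 + W} y + indicator {T - W..T - W + 2 * W} y))"
        unfolding G_def by (intro EA_add lingrowth_add lingrowth_cmult lingrowth_const lingrowth_indicator) auto
      moreover have "EA x n (\<lambda>y. indicator {0..0 + W} y + indicator {T - W..T - W + 2 * W} y) = EA x n (indicator {0..0 + W}) + EA x n (indicator {T - W..T - W + 2 * W})"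
        by (intro EA_add lingrowth_indicator) auto
      ultimately show ?thesis by (simp only: EA_cmult EA_const)
    qed
    also have "\<dots> \<le> 2 * (v / W\<^sup>2) * surv x (n div 2) + 3 * (Cc * surv x (n div 2) * (W / sqrt (real n) + W powr (- 2 * d))
        + Cc * surv x (n div 2) * (2 * W / sqrt (real n) + (2 * W) powr (- 2 * d)))"
      using W v by (intro add_mono mult_left_mono Cc x n surv_antimono) auto
    also have "\<dots> \<le> 2 * (v / W\<^sup>2) * surv x (n div 2) + 3 * (Cc * surv x (n div 2) * (W / sqrt (real n) + W powr (- 2 * d))
        + Cc * surv x (n div 2) * (2 * W / sqrt (real n) + 2 * W powr (- 2 * d)))"
    proof -
      have "(2 * W) powr (- 2 * d) \<le> W powr (- 2 * d)"
        using W d_pos by (intro powr_mono2') auto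
      then have "(2 * W) powr (- 2 * d) \<le> 2 * W powr (- 2 * d)"
        using powr_ge_zero[of W "- 2 * d"] by linarith
      then show ?thesis
        using Cc(1) surv_nonneg by (intro add_left_mono mult_left_mono) (auto intro!: mult_nonneg_nonneg)
    qed
    also have "\<dots> = surv x (n div 2) * (2 * (v / W\<^sup>2) + 9 * Cc * (W / sqrt (real n) + W powr (- 2 * d)))"
      by (simp add: algebra_simps)
    also have "\<dots> \<le> surv x (n div 2) * ((2 + 9 * Cc) * (v / W\<^sup>2 + W / sqrt (real n) + W powr (- 2 * d)))"
    proof (intro mult_left_mono surv_nonneg)
      have "0 \<le> 9 * Cc * (v / W\<^sup>2)" "0 \<le> 2 * (W / sqrt (real n) + W powr (- 2 * d))"
        using Cc(1) v W by (auto intro!: mult_nonneg_nonneg add_nonneg_nonneg)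
      then show "2 * (v / W\<^sup>2) + 9 * Cc * (W / sqrt (real n) + W powr (- 2 * d)) \<le> (2 + 9 * Cc) * (v / W\<^sup>2 + W / sqrt (real n) + W powr (- 2 * d))"
        by (simp add: algebra_simps)
    qed
    also have "\<dots> \<le> (Ch * bnd x n) * ((2 + 9 * Cc) * (v / W\<^sup>2 + W / sqrt (real n) + W powr (- 2 * d)))"
      using Cc(1) v W by (intro mult_right_mono Ch x n) (auto intro!: mult_nonneg_nonneg add_nonneg_nonneg)
    finally show ?thesis by (simp add: mult_ac)
  qed
  moreover have "(2 + 9 * Cc) * Ch > 0" using Cc Ch by (simp add: add_pos_pos)
  ultimately show ?thesis by blast
qed

text \<open>The smoothing time: long enough to make the Lindeberg errors of the last steps summable, short
  compared to \<open>n\<close> so that the smoothing itself is a small error.\<close>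

definition smooth :: "nat \<Rightarrow> real" where
  "smooth n = real n powr (1 - d / 4)"

lemma smooth_bounds:
  assumes "n \<ge> 1"
  shows "1 \<le> smooth n" "smooth n \<le> real n"
proof -
  show "1 \<le> smooth n" unfolding smooth_def using assms d_le by (intro ge_one_powr_ge_zero) auto
  have "real n powr (1 - d / 4) \<le> real n powr 1" using assms d_pos by (intro powr_mono) auto
  then show "smooth n \<le> real n" using assms by (simp add: smooth_def)
qed

lemma npowr_mono: "n \<ge> 1 \<Longrightarrow> a \<le> b \<Longrightarrow> real n powr a \<le> real n powr b"
  by (intro powr_mono) auto

text \<open>Three errors are added: the indicator against the smooth solution at time n, the
  Lindeberg errors, and the extra variance \<open>smooth n\<close> in the initial solution. The exit
  terms stay explicit, since they can be of the same order as the leading term.\<close>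

lemma comparison_exit:
  "\<exists>C>0. \<forall>x\<ge>0. \<forall>n\<ge>1. \<forall>T\<ge>0.
    \<bar>EA x n (indicator {0..T}) + (\<Sum>k<n. ED x k (usol (vv n (smooth n) (Suc k)) T)) - usol (\<sigma>\<^sup>2 * real n) T x\<bar>
      \<le> C * bnd x n * real n powr (- d / 16)"
proof -
  obtain C1 where C10: "C1 > 0" "\<forall>x\<ge>0. \<forall>n\<ge>1. \<forall>v>0. \<forall>W\<ge>1. \<forall>T\<ge>0.
    \<bar>EA x n (indicator {0..T}) - EA x n (usol v T)\<bar> \<le> C1 * bnd x n * (v / W\<^sup>2 + W / sqrt (real n) + W powr (- 2 * d))"
    using smoothing_error by (elim exE conjE)
  note C1 = C10(1) C10(2)[rule_format]
  obtain C2 where C2: "C2 > 0" "\<And>x n v. x \<ge> 0 \<Longrightarrow> n \<ge> 1 \<Longrightarrow> 1 \<le> v \<Longrightarrow> v \<le> real n \<Longrightarrow>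
     (\<Sum>k<n. vv n v (Suc k) powr (-1 - d) * surv x k) \<le> C2 * bnd x n * v powr (- d)"
    using lindeberg_sum unfolding bnd_def by blast
  define C3 where "C3 = 4 * (1 / \<sigma>\<^sup>2 + 1 / (\<sigma>\<^sup>2 * \<sigma>))"
  have C3: "C3 > 0" using sigma_pos by (simp add: C3_def add_pos_pos)
  have "\<bar>EA x n (indicator {0..T}) + (\<Sum>k<n. ED x k (usol (vv n (smooth n) (Suc k)) T)) - usol (\<sigma>\<^sup>2 * real n) T x\<bar>
      \<le> (3 * C1 + 4 * cheat * C2 + C3) * bnd x n * real n powr (- d / 16)"
    if x: "x \<ge> 0" and n: "n \<ge> 1" and T: "T \<ge> 0" for x n T
  proof -
    define v where "v = smooth n"
    have v: "1 \<le> v" "v \<le> real n" using smooth_bounds[OF n] by (auto simp: v_def)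
    define q where "q = real n powr (- d / 16)"
    have B: "0 \<le> bnd x n" by (rule bnd_nonneg[OF x])
    have e1: "\<bar>EA x n (indicator {0..T}) - EA x n (usol v T)\<bar> \<le> 3 * C1 * bnd x n * q"
    proof -
      \<comment> \<open>The exponent is midway between those of sqrt v, which is 1/2 - d/8, and of
        sqrt n. So v / W^2 and W / sqrt n are both small, and the latter fixes the rate
        n^(-d/16).\<close>
      define W where "W = real n powr (1/2 - d / 16)"
      have W: "W \<ge> 1" unfolding W_def using n d_le by (intro ge_one_powr_ge_zero) auto
      have W2: "W\<^sup>2 = real n powr (1 - d / 8)"
        by (simp add: W_def power2_eq_square flip: powr_add)
      have "v / W\<^sup>2 = real n powr (1 - d / 4 - (1 - d / 8))"
        unfolding W2 v_def smooth_def by (rule powr_diff[symmetric])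
      also have "\<dots> \<le> q" unfolding q_def using n d_pos by (intro npowr_mono) auto
      finally have 1: "v / W\<^sup>2 \<le> q" .
      have "sqrt (real n) = real n powr (1/2)" by (simp add: powr_half_sqrt)
      then have "W / sqrt (real n) = real n powr (1/2 - d / 16 - 1/2)"
        unfolding W_def by (simp only: powr_diff)
      then have "W / sqrt (real n) = q" by (simp add: q_def)
      moreover have "W powr (- 2 * d) \<le> q"
      proof -
        have "W powr (- 2 * d) = real n powr ((1/2 - d / 16) * (- 2 * d))" by (simp add: W_def powr_powr)
        also have "\<dots> \<le> q"
        proof -
          have "d * d \<le> d * (1/2)" using d_pos d_le by (intro mult_left_mono) auto
          then show ?thesis unfolding q_def using n d_pos by (intro npowr_mono) (auto simp: field_simps)
        qed
        finally show ?thesis .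
      qed
      ultimately have "C1 * bnd x n * (v / W\<^sup>2 + W / sqrt (real n) + W powr (- 2 * d)) \<le> C1 * bnd x n * (3 * q)"
        using 1 C1(1) B by (intro mult_left_mono) auto
      with C1(2)[OF x n _ W T, of v] v show ?thesis by (simp add: mult_ac)
    qed
    have e2: "\<bar>EA x n (usol v T) + (\<Sum>k<n. ED x k (usol (vv n v (Suc k)) T)) - usol (vv n v 0) T x\<bar> \<le> 4 * cheat * C2 * bnd x n * q"
    proof -
      have "\<bar>EA x n (usol (vv n v n) T) + (\<Sum>k=0..<n. ED x k (usol (vv n v (Suc k)) T)) - EA x 0 (usol (vv n v 0) T)\<bar>
          \<le> (\<Sum>k=0..<n. 4 * cheat * vv n v (Suc k) powr (-1 - d) * surv x k)"
      proof (rule telescoping[OF lingrowth_usol x])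
        fix k y assume "k < n"
        then have "1 \<le> vv n v (Suc k)" using vv_ge[of "Suc k" n v] v by simp
        from kern_usol[OF this, of T y] show "\<bar>kern (usol (vv n v (Suc k)) T) y - usol (vv n v k) T y\<bar> \<le> 4 * cheat * vv n v (Suc k) powr (-1 - d)"
          unfolding vv_Suc[of n v k] .
      qed simp
      also have "\<dots> = 4 * cheat * (\<Sum>k<n. vv n v (Suc k) powr (-1 - d) * surv x k)"
        by (simp add: sum_distrib_left mult_ac atLeast0LessThan)
      also have "\<dots> \<le> 4 * cheat * (C2 * bnd x n * v powr (- d))"
        using cheat_pos by (intro mult_left_mono C2 x n v) auto
      also have "\<dots> \<le> 4 * cheat * (C2 * bnd x n * q)"
      proof (intro mult_left_mono)
        have "d * d \<le> d * (1/2)" using d_pos d_le by (intro mult_left_mono) auto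
        then show "v powr (- d) \<le> q"
          unfolding v_def smooth_def q_def powr_powr using n d_pos by (intro npowr_mono) (auto simp: field_simps)
      qed (use cheat_pos C2(1) B in auto)
      finally show ?thesis by (simp add: EA_0 atLeast0LessThan mult_ac)
    qed
    have e3: "\<bar>usol (vv n v 0) T x - usol (\<sigma>\<^sup>2 * real n) T x\<bar> \<le> C3 * bnd x n * q"
    proof -
      define m where "m = \<sigma>\<^sup>2 * real n"
      have m: "m > 0" using sigma_pos n by (simp add: m_def)
      have v0: "vv n v 0 = m + v" by (simp add: vv_def m_def)
      have vn: "v / real n \<le> q"
      proof -
        have "v / real n = real n powr (1 - d / 4 - 1)"
          unfolding v_def smooth_def powr_diff using n by simp
        also have "\<dots> \<le> q" unfolding q_def using n d_pos by (intro npowr_mono) auto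
        finally show ?thesis .
      qed
      have q0: "q \<ge> 0" by (simp add: q_def)
      have "0 \<le> 1 / \<sigma>\<^sup>2" "0 \<le> 1 / (\<sigma>\<^sup>2 * \<sigma>)" using sigma_pos by auto
      then have c3: "4 * (1 / \<sigma>\<^sup>2) \<le> C3" "4 * (1 / (\<sigma>\<^sup>2 * \<sigma>)) \<le> C3"
        unfolding C3_def distrib_left by linarith+
      have "\<bar>usol (vv n v 0) T x - usol m T x\<bar> \<le> 4 * (v / m)"
        using usol_time[of m "vv n v 0" m T x] v m by (simp add: v0)
      also have "\<dots> = 4 * (1 / \<sigma>\<^sup>2) * (v / real n)" by (simp add: m_def)
      also have "\<dots> \<le> 4 * (1 / \<sigma>\<^sup>2) * q" using vn by (intro mult_left_mono) auto
      also have "\<dots> \<le> C3 * q" by (intro mult_right_mono c3 q0)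
      finally have a: "\<bar>usol (vv n v 0) T x - usol m T x\<bar> \<le> C3 * q" .
      have "\<bar>usol (vv n v 0) T x - usol m T x\<bar> \<le> 4 * (x * (v / (m * sqrt m)))"
        using usol_time_linear[of m "vv n v 0" m x T] v m x by (simp add: v0)
      also have "\<dots> = 4 * (1 / (\<sigma>\<^sup>2 * \<sigma>)) * (x / sqrt (real n)) * (v / real n)"
        using sigma_pos by (simp add: m_def real_sqrt_mult mult_ac)
      also have "\<dots> \<le> 4 * (1 / (\<sigma>\<^sup>2 * \<sigma>)) * (x / sqrt (real n)) * q"
        using vn x sigma_pos by (intro mult_left_mono) auto
      also have "\<dots> \<le> C3 * ((1 + x) / sqrt (real n)) * q"
        by (intro mult_right_mono mult_mono divide_right_mono c3 q0) (use x C3 in auto)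
      finally have b: "\<bar>usol (vv n v 0) T x - usol m T x\<bar> \<le> C3 * ((1 + x) / sqrt (real n)) * q" .
      \<comment> \<open>The uniform time bound serves the first alternative, the bound linear in
        \<open>x\<close> the second.\<close>
      have "bnd x n = 1 \<or> bnd x n = (1 + x) / sqrt (real n)" by (auto simp: bnd_def min_def)
      then show ?thesis
        unfolding m_def[symmetric]
      proof
        assume eq: "bnd x n = 1"
        show "\<bar>usol (vv n v 0) T x - usol m T x\<bar> \<le> C3 * bnd x n * q" using a unfolding eq by simp
      next
        assume eq: "bnd x n = (1 + x) / sqrt (real n)"
        show "\<bar>usol (vv n v 0) T x - usol m T x\<bar> \<le> C3 * bnd x n * q" using b unfolding eq .
      qed
    qed
    have "\<bar>EA x n (indicator {0..T}) + (\<Sum>k<n. ED x k (usol (vv n v (Suc k)) T)) - usol (\<sigma>\<^sup>2 * real n) T x\<bar>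
        \<le> 3 * C1 * bnd x n * q + 4 * cheat * C2 * bnd x n * q + C3 * bnd x n * q"
      using e1 e2 e3 by linarith
    also have "\<dots> = (3 * C1 + 4 * cheat * C2 + C3) * bnd x n * q" by (simp only: distrib_right)
    finally show ?thesis unfolding v_def q_def .
  qed
  note main = this
  have "3 * C1 + 4 * cheat * C2 + C3 > 0" using C1(1) C2(1) C3 cheat_pos by (simp add: add_pos_pos)
  then show ?thesis
    by (intro exI[of _ "3 * C1 + 4 * cheat * C2 + C3"] conjI allI impI main)
qed

text \<open>The total mean overshoot below 0 at exit; \<open>V_eq\<close> shows that it is the
  excess of V(x) over x.\<close>

definition ov :: "real \<Rightarrow> real" where
  "ov x = (\<Sum>k. over x k)"

lemma over_summable: "x \<ge> 0 \<Longrightarrow> summable (over x)"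
proof -
  assume x: "x \<ge> 0"
  obtain C where C: "\<And>x n. x \<ge> 0 \<Longrightarrow> (\<Sum>k<n. over x k) \<le> C * (1 + x) powr (1 - d)"
    using sum_over_bound by blast
  show ?thesis
    by (rule summableI_nonneg_bounded[OF over_nonneg C[OF x]])
qed

lemma ov_bound: "\<exists>C>0. \<forall>x\<ge>0. ov x \<le> C * (1 + x) powr (1 - d)"
proof -
  obtain C where C: "C > 0" "\<And>x n. x \<ge> 0 \<Longrightarrow> (\<Sum>k<n. over x k) \<le> C * (1 + x) powr (1 - d)"
    using sum_over_bound by blast
  have "ov x \<le> C * (1 + x) powr (1 - d)" if x: "x \<ge> 0" for x
    unfolding ov_def by (rule suminf_le_const[OF over_summable[OF x] C(2)[OF x]])
  then show ?thesis using C(1) by blast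
qed

lemma ov_nonneg: "x \<ge> 0 \<Longrightarrow> 0 \<le> ov x"
  unfolding ov_def by (rule suminf_nonneg[OF over_summable over_nonneg])

lemma ov_tail:
  "\<exists>C>0. \<forall>x\<ge>0. \<forall>m\<ge>1. ov x - (\<Sum>k<m. over x k) \<le> C * (1 + x) * real m powr (- d / 2)"
proof -
  obtain C where C: "C > 0" "\<And>x m n. x \<ge> 0 \<Longrightarrow> m \<ge> 1 \<Longrightarrow> n \<ge> m \<Longrightarrow> (\<Sum>k=m..<n. over x k) \<le> C * (1 + x) * real m powr (- d / 2)"
    using sum_over_tail by blast
  have "ov x - (\<Sum>k<m. over x k) \<le> C * (1 + x) * real m powr (- d / 2)" if x: "x \<ge> 0" and m: "m \<ge> 1" for x m
  proof -
    have "ov x \<le> (\<Sum>k<m. over x k) + C * (1 + x) * real m powr (- d / 2)"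
      unfolding ov_def
    proof (rule suminf_le_const[OF over_summable[OF x]])
      fix n
      show "(\<Sum>k<n. over x k) \<le> (\<Sum>k<m. over x k) + C * (1 + x) * real m powr (- d / 2)"
      proof (cases "n \<ge> m")
        case True
        then show ?thesis
          using C(2)[OF x m True] sum.atLeastLessThan_concat[of 0 m n "over x"] by (simp add: atLeast0LessThan)
      next
        case False
        then have "(\<Sum>k<n. over x k) \<le> (\<Sum>k<m. over x k)" by (intro sum_mono2 over_nonneg) auto
        moreover have "0 \<le> C * (1 + x) * real m powr (- d / 2)" using C(1) x by simp
        ultimately show ?thesis by linarith
      qed
    qed
    then show ?thesis by simp
  qed
  then show ?thesis using C(1) by blast
qed

section \<open>The contribution of the exit terms\<close>

lemma powr_smooth: "smooth n powr a = real n powr ((1 - d / 4) * a)"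
  by (simp add: smooth_def powr_powr)

lemma d_sq: "d * d \<le> d / 2"
  using mult_left_mono[of d "1/2" d] d_pos d_le by simp

lemma EA_wght_sum_bound: "\<exists>C>0. \<forall>x\<ge>0. \<forall>n. (\<Sum>k<n. EA x k (wght 1)) \<le> C * (1 + x)"
proof -
  obtain C where C: "C > 0" "\<And>x m n. x \<ge> 0 \<Longrightarrow> m \<le> n \<Longrightarrow> (\<Sum>k=m..<n. EA x k (wght 1)) \<le> C * EA x m (lyap 1)"
    using green by blast
  have "(\<Sum>k<n. EA x k (wght 1)) \<le> C * (1 + x)" if x: "x \<ge> 0" for x n
  proof -
    have "(\<Sum>k<n. EA x k (wght 1)) \<le> C * (1 + x) powr (1 - d)"
      using C(2)[OF x, of 0 n] x by (simp add: EA_0 lyap_def atLeast0LessThan)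
    also have "(1 + x) powr (1 - d) \<le> (1 + x) powr 1" using x d_pos by (intro powr_mono) auto
    finally show ?thesis using C(1) x by simp
  qed
  then show ?thesis using C(1) by blast
qed

lemma sum_over_linear: "\<exists>C>0. \<forall>x\<ge>0. \<forall>n. (\<Sum>k<n. over x k) \<le> C * (1 + x)"
proof -
  obtain C where C: "C > 0" "\<And>x n. x \<ge> 0 \<Longrightarrow> (\<Sum>k<n. over x k) \<le> C * (1 + x) powr (1 - d)"
    using sum_over_bound by blast
  have "(\<Sum>k<n. over x k) \<le> C * (1 + x)" if x: "x \<ge> 0" for x n
  proof -
    have "(1 + x) powr (1 - d) \<le> (1 + x) powr 1" using x d_pos by (intro powr_mono) auto
    then have "C * (1 + x) powr (1 - d) \<le> C * (1 + x)" using C(1) x by (intro mult_left_mono) auto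
    then show ?thesis using C(2)[OF x, of n] by linarith
  qed
  then show ?thesis using C(1) by blast
qed

lemma ED_linear: "ED x k (\<lambda>y. y * s) = - s * over x k"
proof -
  have "ED x k (\<lambda>y. y * s) = ED x k (\<lambda>y. - s * - y)" by (simp add: mult.commute)
  also have "\<dots> = - s * over x k" unfolding ED_cmult over_def ..
  finally show ?thesis .
qed

text \<open>When much variance \<open>v\<close> is left at exit, the solution at the overshoot is
  slope times overshoot. The first error is the linearisation, the second the change from the slope
  at variance \<open>v\<close> to that at a reference variance \<open>v'\<close>, the same for all
  exit times.\<close>

lemma exit_term_early:
  assumes x: "x \<ge> 0" and v: "v \<ge> m" "v' \<ge> m" and m: "m > 0"
  shows "\<bar>ED x k (usol v T) + uslope v' T * over x k\<bar>
    \<le> 6 * m powr (- (1 + d) / 2) * mom' * EA x k (wght 1) + 4 * (\<bar>v' - v\<bar> / (m * sqrt m)) * over x k"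
proof -
  have v0: "v > 0" using v m by simp
  have lin: "lingrowth (\<lambda>y. y * uslope v T)"
    using lingrowth_cmult[OF lingrowth_id, of "uslope v T"] by (simp add: mult.commute)
  have "ED x k (usol v T) + uslope v' T * over x k
      = ED x k (\<lambda>y. usol v T y - y * uslope v T) + (uslope v' T - uslope v T) * over x k"
    unfolding ED_diff[OF lingrowth_usol lin] ED_linear by (simp add: algebra_simps)
  moreover have "\<bar>ED x k (\<lambda>y. usol v T y - y * uslope v T)\<bar> \<le> 6 * m powr (- (1 + d) / 2) * mom' * EA x k (wght 1)"
  proof (rule ED_overshoot[OF lingrowth_diff[OF lingrowth_usol lin] _ _ x])
    fix y :: real assume "y < 0"
    have "\<bar>usol v T y - y * uslope v T\<bar> \<le> 6 * v powr (- (1 + d) / 2) * \<bar>y\<bar> powr (1 + d)"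
      by (rule usol_linear_powr[OF v0]) (use d_pos d_le in auto)
    also have "\<dots> \<le> 6 * m powr (- (1 + d) / 2) * (1 + \<bar>y\<bar>) powr (1 + d)"
      using v m d_pos by (intro mult_mono mult_left_mono powr_mono2 powr_mono2') auto
    finally show "\<bar>usol v T y - y * uslope v T\<bar> \<le> 6 * m powr (- (1 + d) / 2) * (1 + \<bar>y\<bar>) powr (1 + d)" .
  qed simp
  moreover have "\<bar>(uslope v' T - uslope v T) * over x k\<bar> \<le> 4 * (\<bar>v' - v\<bar> / (m * sqrt m)) * over x k"
    using mult_right_mono[OF uslope_time[OF v(2,1) m, of T] over_nonneg[of x k]] over_nonneg[of x k]
    by (simp add: abs_mult)
  ultimately show ?thesis by linarith
qed

text \<open>Close to time n the solution is too steep to be linearised usefully. A Lipschitz bound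
  suffices, because late exits contribute little total overshoot.\<close>

lemma exit_term_late:
  assumes v: "v \<ge> m" and m: "m > 0"
  shows "\<bar>ED x k (usol v T)\<bar> \<le> 4 / sqrt m * over x k"
proof -
  have b: "\<bar>usol v T y\<bar> \<le> 4 / sqrt m * (- y)" if "y < 0" for y
  proof -
    have "\<bar>usol v T y\<bar> \<le> 4 * \<bar>y\<bar> / sqrt v" using v m by (intro usol_abs_le) auto
    also have "\<dots> \<le> 4 * \<bar>y\<bar> / sqrt m" using v m by (intro divide_left_mono) auto
    finally show ?thesis using that by simp
  qed
  have "ED x k (usol v T) \<le> ED x k (\<lambda>y. 4 / sqrt m * (- y))"
    by (intro ED_mono lingrowth_usol lingrowth_cmult lingrowth_uminus abs_le_D1[OF b])
  moreover have "ED x k (\<lambda>y. - (4 / sqrt m) * (- y)) \<le> ED x k (usol v T)"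
  proof (intro ED_mono lingrowth_usol lingrowth_cmult lingrowth_uminus)
    fix y :: real assume "y < 0"
    show "- (4 / sqrt m) * (- y) \<le> usol v T y" using abs_le_D2[OF b[OF \<open>y < 0\<close>]] by simp
  qed
  ultimately show ?thesis unfolding ED_cmult over_def[symmetric] by (simp add: abs_le_iff)
qed

text \<open>Exits are split at time m, the integer part of \<open>smooth n\<close>. Before m, the
  residual variance is of order n and differs from \<open>\<sigma>\<^sup>2 * real n\<close> by
  O(\<open>smooth n\<close>), so linearisation at a common slope works. After m, the slope may grow
  to 1 / sqrt v with v = \<open>smooth n\<close>, a loss of n^(d/8), but the remaining overshoot is
  O((1 + x) m^(-d/2)), which outweighs it.\<close>

lemma comparison_overshoot:
  "\<exists>C>0. \<forall>x\<ge>0. \<forall>n\<ge>1. \<forall>T.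
    \<bar>(\<Sum>k<n. ED x k (usol (vv n (smooth n) (Suc k)) T)) + uslope (\<sigma>\<^sup>2 * real n) T * ov x\<bar>
      \<le> C * ((1 + x) * real n powr (- 1 / 2 - d / 16))"
proof -
  obtain Cg where Cg: "Cg > 0" "\<And>x n. x \<ge> 0 \<Longrightarrow> (\<Sum>k<n. EA x k (wght 1)) \<le> Cg * (1 + x)"
    using EA_wght_sum_bound by blast
  obtain Co where Co: "Co > 0" "\<And>x n. x \<ge> 0 \<Longrightarrow> (\<Sum>k<n. over x k) \<le> Co * (1 + x)"
    using sum_over_linear by blast
  obtain Ct where Ct: "Ct > 0" "\<And>x m n. x \<ge> 0 \<Longrightarrow> m \<ge> 1 \<Longrightarrow> n \<ge> m \<Longrightarrow> (\<Sum>k=m..<n. over x k) \<le> Ct * (1 + x) * real m powr (- d / 2)"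
    using sum_over_tail by blast
  obtain Cu where Cu: "Cu > 0" "\<And>x m. x \<ge> 0 \<Longrightarrow> m \<ge> 1 \<Longrightarrow> ov x - (\<Sum>k<m. over x k) \<le> Cu * (1 + x) * real m powr (- d / 2)"
    using ov_tail by blast
  \<comment> \<open>At an early exit at least \<open>c * real n\<close> of variance is left: if at
    most half the steps are done, the walk still has \<open>\<sigma>\<^sup>2 * real n / 2\<close> to
    run; otherwise \<open>smooth n\<close> itself is at least n/2.\<close>
  define c where "c = min 1 (\<sigma>\<^sup>2) / 2"
  have c: "c > 0" "c \<le> 1/2" "c \<le> \<sigma>\<^sup>2 / 2" using sigma_pos by (auto simp: c_def)
  define K1 where "K1 = 6 * c powr (- (1 + d) / 2) * mom' * Cg"
  define K2 where "K2 = 4 * ((1 + \<sigma>\<^sup>2) / (c * sqrt c)) * Co"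
  define K3 where "K3 = 8 * Ct"
  define K4 where "K4 = 4 / \<sigma> * Cu"
  have K: "K1 \<ge> 0" "K2 \<ge> 0" "K3 > 0" "K4 \<ge> 0"
    using c mom'_ge Cg(1) Co(1) Ct(1) Cu(1) sigma_pos by (auto simp: K1_def K2_def K3_def K4_def)
  have main: "\<bar>(\<Sum>k<n. ED x k (usol (vv n (smooth n) (Suc k)) T)) + uslope (\<sigma>\<^sup>2 * real n) T * ov x\<bar>
      \<le> (K1 + K2 + K3 + K4) * ((1 + x) * real n powr (- 1 / 2 - d / 16))"
    if x: "x \<ge> 0" and n: "n \<ge> 1" for x n T
  proof -
    define v where "v = smooth n"
    define r where "r = (1 + x) * real n powr (- 1 / 2 - d / 16)"
    define m where "m = nat \<lfloor>v\<rfloor>"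
    define D where "D = uslope (\<sigma>\<^sup>2 * real n) T"
    have v: "1 \<le> v" "v \<le> real n" using smooth_bounds[OF n] by (auto simp: v_def)
    have m: "m \<ge> 1" "real m \<le> v" "v \<le> 2 * real m" "m \<le> n"
    proof -
      have "1 \<le> \<lfloor>v\<rfloor>" using v by simp
      then have rm: "real m = of_int \<lfloor>v\<rfloor>" unfolding m_def by (intro of_nat_nat) simp
      have "(1::real) \<le> of_int \<lfloor>v\<rfloor>" using \<open>1 \<le> \<lfloor>v\<rfloor>\<close> by linarith
      then show "m \<ge> 1" "real m \<le> v" "v \<le> 2 * real m"
        using rm of_int_floor_le[of v] real_of_int_floor_add_one_gt[of v] by linarith+
      then have "real m \<le> real n" using v by linarith
      then show "m \<le> n" by simp
    qed
    have n0: "real n > 0" using n by simp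
    have cn: "c * real n > 0" using c n0 by simp
    have mpow: "real m powr (- d / 2) \<le> 2 * v powr (- d / 2)"
    proof -
      have "real m powr (- d / 2) \<le> (v / 2) powr (- d / 2)"
        using m v d_pos by (intro powr_mono2') auto
      also have "\<dots> = (1/2 * v) powr (- d / 2)" by simp
      also have "\<dots> = (1/2) powr (- d / 2) * v powr (- d / 2)" by (rule powr_mult)
      also have "\<dots> \<le> (1/2) powr (- 1) * v powr (- d / 2)"
        using d_le by (intro mult_right_mono powr_mono') auto
      also have "(1/2::real) powr (- 1) = 2" by (simp add: powr_minus)
      finally show ?thesis .
    qed
    have p1: "(c * real n) powr (- (1 + d) / 2) \<le> c powr (- (1 + d) / 2) * real n powr (- 1 / 2 - d / 16)"
      unfolding powr_mult using n d_pos by (intro mult_left_mono npowr_mono) auto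
    have p2: "v / (c * real n * sqrt (c * real n)) \<le> 1 / (c * sqrt c) * real n powr (- 1 / 2 - d / 16)"
    proof -
      have "v / (c * real n * sqrt (c * real n)) = 1 / (c * sqrt c) * (v / real n / sqrt (real n))"
        by (simp add: real_sqrt_mult mult_ac)
      also have "v / real n / sqrt (real n) = real n powr (1 - d / 4 - 1 - 1/2)"
        unfolding powr_diff v_def smooth_def using n0 by (simp add: powr_half_sqrt)
      also have "\<dots> \<le> real n powr (- 1 / 2 - d / 16)" using n d_pos by (intro npowr_mono) auto
      finally show ?thesis using c by (simp add: divide_right_mono)
    qed
    have p3: "1 / sqrt v * v powr (- d / 2) \<le> real n powr (- 1 / 2 - d / 16)"
    proof -
      have "1 / sqrt v = v powr (- 1 / 2)" using v by (simp add: powr_minus_divide powr_half_sqrt)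
      then have "1 / sqrt v * v powr (- d / 2) = v powr (- 1 / 2 + - d / 2)" by (simp only: powr_add)
      also have "\<dots> = real n powr ((1 - d / 4) * (- 1 / 2 + - d / 2))" unfolding v_def powr_smooth ..
      also have "\<dots> \<le> real n powr (- 1 / 2 - d / 16)"
        using n d_pos d_sq by (intro npowr_mono) (auto simp: algebra_simps)
      finally show ?thesis .
    qed
    have p4: "1 / sqrt (real n) * v powr (- d / 2) \<le> real n powr (- 1 / 2 - d / 16)"
    proof -
      have "1 / sqrt (real n) = real n powr (- 1 / 2)" using n0 by (simp add: powr_minus_divide powr_half_sqrt)
      then have "1 / sqrt (real n) * v powr (- d / 2) = real n powr (- 1 / 2 + (1 - d / 4) * (- d / 2))"
        unfolding v_def powr_smooth by (simp only: powr_add)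
      also have "\<dots> \<le> real n powr (- 1 / 2 - d / 16)"
        using n d_pos d_sq by (intro npowr_mono) (auto simp: algebra_simps)
      finally show ?thesis .
    qed
    let ?u = "\<lambda>k. ED x k (usol (vv n v (Suc k)) T)"
    have early: "\<bar>?u k + D * over x k\<bar> \<le> 6 * (c * real n) powr (- (1 + d) / 2) * mom' * EA x k (wght 1)
        + 4 * ((1 + \<sigma>\<^sup>2) * v / (c * real n * sqrt (c * real n))) * over x k" if k: "k < m" for k
    proof -
      have kn: "Suc k \<le> m" "Suc k \<le> n" "real (Suc k) \<le> v" using k m by auto
      have "c * real n \<le> vv n v (Suc k)"
      proof (cases "2 * Suc k \<le> n")
        case True
        then have "real (2 * Suc k) \<le> real n" by (rule of_nat_mono)
        then have "\<sigma>\<^sup>2 * (real n / 2) \<le> \<sigma>\<^sup>2 * (real n - real (Suc k))" by (intro mult_left_mono) auto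
        moreover have "c * real n \<le> \<sigma>\<^sup>2 * (real n / 2)"
          using mult_right_mono[OF c(3), of "real n"] by simp
        ultimately show ?thesis using v unfolding vv_def by linarith
      next
        case False
        then have "real n \<le> real (2 * Suc k)" by (intro of_nat_mono) simp
        then have "real n / 2 \<le> v" using kn by simp
        moreover have "c * real n \<le> 1/2 * real n" using c by (intro mult_right_mono) auto
        moreover have "0 \<le> \<sigma>\<^sup>2 * (real n - real (Suc k))" using kn by simp
        ultimately show ?thesis unfolding vv_def by linarith
      qed
      moreover have "c * real n \<le> \<sigma>\<^sup>2 * real n" using c sigma_pos by (intro mult_right_mono) auto
      ultimately have "\<bar>?u k + D * over x k\<bar> \<le> 6 * (c * real n) powr (- (1 + d) / 2) * mom' * EA x k (wght 1)
          + 4 * (\<bar>\<sigma>\<^sup>2 * real n - vv n v (Suc k)\<bar> / (c * real n * sqrt (c * real n))) * over x k"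
        unfolding D_def by (intro exit_term_early x cn)
      also have "\<dots> \<le> 6 * (c * real n) powr (- (1 + d) / 2) * mom' * EA x k (wght 1)
          + 4 * ((1 + \<sigma>\<^sup>2) * v / (c * real n * sqrt (c * real n))) * over x k"
      proof (intro add_left_mono mult_right_mono mult_left_mono divide_right_mono over_nonneg)
        have "0 \<le> \<sigma>\<^sup>2 * real (Suc k)" by simp
        moreover have "\<sigma>\<^sup>2 * real (Suc k) \<le> \<sigma>\<^sup>2 * v" using kn by (intro mult_left_mono) auto
        moreover have "\<sigma>\<^sup>2 * real n - vv n v (Suc k) = \<sigma>\<^sup>2 * real (Suc k) - v"
          by (simp add: vv_def algebra_simps)
        ultimately show "\<bar>\<sigma>\<^sup>2 * real n - vv n v (Suc k)\<bar> \<le> (1 + \<sigma>\<^sup>2) * v"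
          using v unfolding distrib_right by linarith
      qed (use cn c in auto)
      finally show ?thesis .
    qed
    have A: "\<bar>(\<Sum>k<m. ?u k) + D * (\<Sum>k<m. over x k)\<bar> \<le> K1 * r + K2 * r"
    proof -
      have "\<bar>(\<Sum>k<m. ?u k) + D * (\<Sum>k<m. over x k)\<bar> = \<bar>\<Sum>k<m. ?u k + D * over x k\<bar>"
        by (simp add: sum.distrib sum_distrib_left)
      also have "\<dots> \<le> (\<Sum>k<m. 6 * (c * real n) powr (- (1 + d) / 2) * mom' * EA x k (wght 1)
        + 4 * ((1 + \<sigma>\<^sup>2) * v / (c * real n * sqrt (c * real n))) * over x k)"
        by (rule order_trans[OF sum_abs sum_mono]) (rule early, simp)
      also have "\<dots> = 6 * mom' * ((c * real n) powr (- (1 + d) / 2) * (\<Sum>k<m. EA x k (wght 1)))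
        + 4 * (1 + \<sigma>\<^sup>2) * (v / (c * real n * sqrt (c * real n)) * (\<Sum>k<m. over x k))"
        unfolding sum.distrib sum_distrib_left[symmetric] by (simp add: mult_ac)
      also have "\<dots> \<le> 6 * mom' * (c powr (- (1 + d) / 2) * real n powr (- 1 / 2 - d / 16) * (Cg * (1 + x)))
        + 4 * (1 + \<sigma>\<^sup>2) * (1 / (c * sqrt c) * real n powr (- 1 / 2 - d / 16) * (Co * (1 + x)))"
      proof (intro add_mono mult_left_mono mult_mono p1 p2 Cg(2) Co(2) x)
        show "0 \<le> (\<Sum>k<m. EA x k (wght 1))"
          by (intro sum_nonneg EA_nonneg x) (simp add: wght_def)
        show "0 \<le> (\<Sum>k<m. over x k)" by (intro sum_nonneg over_nonneg)
      qed (use c mom'_ge in auto)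
      also have "\<dots> = K1 * r + K2 * r" by (simp add: K1_def K2_def r_def mult_ac)
      finally show ?thesis .
    qed
    have B: "\<bar>\<Sum>k=m..<n. ?u k\<bar> \<le> K3 * r"
    proof -
      have "\<bar>\<Sum>k=m..<n. ?u k\<bar> \<le> (\<Sum>k=m..<n. 4 / sqrt v * over x k)"
      proof (rule order_trans[OF sum_abs sum_mono])
        fix k assume "k \<in> {m..<n}"
        then show "\<bar>?u k\<bar> \<le> 4 / sqrt v * over x k"
          using v by (intro exit_term_late vv_ge) auto
      qed
      also have "\<dots> = 4 / sqrt v * (\<Sum>k=m..<n. over x k)" by (simp add: sum_distrib_left)
      also have "\<dots> \<le> 4 / sqrt v * (Ct * (1 + x) * (2 * v powr (- d / 2)))"
      proof (intro mult_left_mono)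
        have "(\<Sum>k=m..<n. over x k) \<le> Ct * (1 + x) * real m powr (- d / 2)" by (rule Ct(2)[OF x m(1,4)])
        also have "\<dots> \<le> Ct * (1 + x) * (2 * v powr (- d / 2))"
          using Ct(1) x by (intro mult_left_mono mpow) auto
        finally show "(\<Sum>k=m..<n. over x k) \<le> Ct * (1 + x) * (2 * v powr (- d / 2))" .
      qed (use v in auto)
      also have "\<dots> = K3 * (1 + x) * (1 / sqrt v * v powr (- d / 2))" by (simp add: K3_def)
      also have "\<dots> \<le> K3 * (1 + x) * real n powr (- 1 / 2 - d / 16)"
        using K x by (intro mult_left_mono p3) auto
      finally show ?thesis by (simp add: r_def mult.assoc)
    qed
    have E: "\<bar>D * (ov x - (\<Sum>k<m. over x k))\<bar> \<le> K4 * r"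
    proof -
      have nn: "0 \<le> ov x - (\<Sum>k<m. over x k)"
        unfolding ov_def using sum_le_suminf[OF over_summable[OF x], of "{..<m}"] over_nonneg by simp
      have "\<bar>D * (ov x - (\<Sum>k<m. over x k))\<bar> = \<bar>D\<bar> * (ov x - (\<Sum>k<m. over x k))"
        using nn by (simp add: abs_mult)
      also have "\<dots> \<le> (2 / sqrt (\<sigma>\<^sup>2 * real n)) * (Cu * (1 + x) * (2 * v powr (- d / 2)))"
      proof (intro mult_mono nn)
        show "\<bar>D\<bar> \<le> 2 / sqrt (\<sigma>\<^sup>2 * real n)"
          unfolding D_def using sigma_pos n0 by (intro uslope_abs_le) auto
        have "ov x - (\<Sum>k<m. over x k) \<le> Cu * (1 + x) * real m powr (- d / 2)" by (rule Cu(2)[OF x m(1)])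
        also have "\<dots> \<le> Cu * (1 + x) * (2 * v powr (- d / 2))"
          using Cu(1) x by (intro mult_left_mono mpow) auto
        finally show "ov x - (\<Sum>k<m. over x k) \<le> Cu * (1 + x) * (2 * v powr (- d / 2))" .
      qed auto
      also have "\<dots> = K4 * (1 + x) * (1 / sqrt (real n) * v powr (- d / 2))"
        using sigma_pos by (simp add: K4_def real_sqrt_mult)
      also have "\<dots> \<le> K4 * (1 + x) * real n powr (- 1 / 2 - d / 16)"
        using K x by (intro mult_left_mono p4) auto
      finally show ?thesis by (simp add: r_def mult.assoc)
    qed
    have split: "(\<Sum>k<n. ?u k) = (\<Sum>k<m. ?u k) + (\<Sum>k=m..<n. ?u k)"
      using sum.atLeastLessThan_concat[of 0 m n ?u] m(4) by (simp add: atLeast0LessThan)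
    have "(\<Sum>k<n. ?u k) + D * ov x = ((\<Sum>k<m. ?u k) + D * (\<Sum>k<m. over x k)) + (\<Sum>k=m..<n. ?u k) + D * (ov x - (\<Sum>k<m. over x k))"
      unfolding split by (simp add: right_diff_distrib)
    then have "\<bar>(\<Sum>k<n. ?u k) + D * ov x\<bar> \<le> K1 * r + K2 * r + K3 * r + K4 * r"
      using A B E by linarith
    also have "\<dots> = (K1 + K2 + K3 + K4) * r" by (simp only: distrib_right)
    finally show ?thesis unfolding v_def r_def D_def .
  qed
  have "K1 + K2 + K3 + K4 > 0" using K by linarith
  then show ?thesis
    by (intro exI[of _ "K1 + K2 + K3 + K4"] conjI allI impI main)
qed

lemma comparison_small:
  "\<exists>C>0. \<forall>x\<ge>0. \<forall>n\<ge>1. \<forall>T\<ge>0.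
    \<bar>EA x n (indicator {0..T}) - usol (\<sigma>\<^sup>2 * real n) T x - uslope (\<sigma>\<^sup>2 * real n) T * ov x\<bar>
      \<le> C * ((1 + x) * real n powr (- 1 / 2 - d / 16))"
proof -
  obtain C1 where C1: "C1 > 0" "\<forall>x\<ge>0. \<forall>n\<ge>1. \<forall>T\<ge>0.
    \<bar>EA x n (indicator {0..T}) + (\<Sum>k<n. ED x k (usol (vv n (smooth n) (Suc k)) T)) - usol (\<sigma>\<^sup>2 * real n) T x\<bar>
      \<le> C1 * bnd x n * real n powr (- d / 16)"
    using comparison_exit by (elim exE conjE)
  obtain C2 where C2: "C2 > 0" "\<forall>x\<ge>0. \<forall>n\<ge>1. \<forall>T.
    \<bar>(\<Sum>k<n. ED x k (usol (vv n (smooth n) (Suc k)) T)) + uslope (\<sigma>\<^sup>2 * real n) T * ov x\<bar>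
      \<le> C2 * ((1 + x) * real n powr (- 1 / 2 - d / 16))"
    using comparison_overshoot by (elim exE conjE)
  have main: "\<bar>EA x n (indicator {0..T}) - usol (\<sigma>\<^sup>2 * real n) T x - uslope (\<sigma>\<^sup>2 * real n) T * ov x\<bar>
      \<le> (C1 + C2) * ((1 + x) * real n powr (- 1 / 2 - d / 16))"
    if x: "x \<ge> 0" and n: "n \<ge> 1" and T: "T \<ge> 0" for x n T
  proof -
    have "bnd x n * real n powr (- d / 16) \<le> (1 + x) / sqrt (real n) * real n powr (- d / 16)"
      unfolding bnd_def by (intro mult_right_mono) auto
    also have "\<dots> = (1 + x) * real n powr (- 1 / 2 - d / 16)"
    proof -
      have "1 / sqrt (real n) = real n powr (- 1 / 2)" using n by (simp add: powr_minus_divide powr_half_sqrt)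
      then have "1 / sqrt (real n) * real n powr (- d / 16) = real n powr (- 1 / 2 + - d / 16)"
        by (simp only: powr_add)
      moreover have "(1 + x) / sqrt (real n) * real n powr (- d / 16) = (1 + x) * (1 / sqrt (real n) * real n powr (- d / 16))"
        by simp
      moreover have "- 1 / 2 + - d / 16 = - 1 / 2 - d / 16" by simp
      ultimately show ?thesis by (simp only:)
    qed
    finally have "C1 * bnd x n * real n powr (- d / 16) \<le> C1 * ((1 + x) * real n powr (- 1 / 2 - d / 16))"
      unfolding mult.assoc using C1(1) by (intro mult_left_mono) auto
    then show ?thesis
      using C1(2)[rule_format, OF x n T] C2(2)[rule_format, OF x n, of T]
      unfolding distrib_right[of C1 C2] by linarith
  qed
  have "C1 + C2 > 0" using C1(1) C2(1) by simp
  then show ?thesis by (intro exI[of _ "C1 + C2"] conjI allI impI main)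
qed

section \<open>Starting points beyond the diffusive scale\<close>

lemma ED_const_sum: "(\<Sum>k<n. ED x k (\<lambda>_. c)) = c * (1 - surv x n)"
proof (induction n)
  case (Suc n)
  have "EA x (Suc n) (\<lambda>_. c) + ED x n (\<lambda>_. c) = EA x n (kern (\<lambda>_. c))"
    by (rule EA_ED_step[OF lingrowth_const])
  then have "ED x n (\<lambda>_. c) = c * surv x n - c * surv x (Suc n)"
    by (simp add: EA_const kern_const[abs_def])
  with Suc show ?case by (simp add: algebra_simps)
qed simp

text \<open>Telescoping is applied to \<open>2 * heat\<close>, the survival probability of Brownian
  motion extended oddly. It is at most 1 on surviving paths and negative at exit, so
  \<open>surv x n\<close> is at least its initial value minus the Lindeberg errors; the Gaussian
  tail bounds that initial value from below.\<close>

lemma exit_probability: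
  "\<exists>C>0. \<forall>x>0. \<forall>n\<ge>1. 1 - surv x n \<le> C * (real n / x\<^sup>2 + real n powr (- d / 16))"
proof -
  obtain C2 where C2: "C2 > 0" "\<forall>x\<ge>0. \<forall>n\<ge>1. \<forall>v. 1 \<le> v \<longrightarrow> v \<le> real n \<longrightarrow>
     (\<Sum>k<n. vv n v (Suc k) powr (-1 - d) * surv x k) \<le> C2 * min 1 ((1 + x) / sqrt (real n)) * v powr (- d)"
    using lindeberg_sum by (elim exE conjE)
  define C where "C = max (1 + \<sigma>\<^sup>2) (2 * cheat * C2)"
  have main: "1 - surv x n \<le> C * (real n / x\<^sup>2 + real n powr (- d / 16))" if x: "x > 0" and n: "n \<ge> 1" for x n
  proof -
    have x0: "x \<ge> 0" using x by simp
    define v where "v = smooth n"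
    have v: "1 \<le> v" "v \<le> real n" using smooth_bounds[OF n] by (auto simp: v_def)
    let ?F = "\<lambda>k y. 2 * heat (vv n v k) y"
    have "\<bar>EA x n (?F n) + (\<Sum>k=0..<n. ED x k (?F (Suc k))) - EA x 0 (?F 0)\<bar>
        \<le> (\<Sum>k=0..<n. 2 * cheat * vv n v (Suc k) powr (-1 - d) * surv x k)"
    proof (rule telescoping[OF lingrowth_cmult[OF lingrowth_heat] x0])
      fix k y assume "k < n"
      then have v1: "1 \<le> vv n v (Suc k)" using vv_ge[of "Suc k" n v] v by simp
      show "\<bar>kern (?F (Suc k)) y - ?F k y\<bar> \<le> 2 * cheat * vv n v (Suc k) powr (-1 - d)"
        using kern_heat_shift[OF v1, of 0 y] unfolding vv_Suc[of n v k] kern_cmult by simp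
    qed simp
    also have "\<dots> = 2 * cheat * (\<Sum>k<n. vv n v (Suc k) powr (-1 - d) * surv x k)"
      by (simp add: sum_distrib_left mult_ac atLeast0LessThan)
    also have "\<dots> \<le> 2 * cheat * (C2 * min 1 ((1 + x) / sqrt (real n)) * v powr (- d))"
      using cheat_pos C2(2)[rule_format, OF x0 n v] by (intro mult_left_mono) auto
    also have "\<dots> \<le> 2 * cheat * (C2 * 1 * real n powr (- d / 16))"
    proof (intro mult_left_mono mult_mono)
      show "v powr (- d) \<le> real n powr (- d / 16)"
        unfolding v_def powr_smooth using n d_pos d_sq by (intro npowr_mono) (auto simp: algebra_simps)
    qed (use cheat_pos C2(1) in auto)
    also have "\<dots> \<le> C * real n powr (- d / 16)"
    proof -
      have "2 * cheat * C2 * real n powr (- d / 16) \<le> C * real n powr (- d / 16)"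
        by (intro mult_right_mono) (auto simp: C_def)
      then show ?thesis by (simp add: mult.assoc)
    qed
    finally have tele: "\<bar>EA x n (?F n) + (\<Sum>k=0..<n. ED x k (?F (Suc k))) - EA x 0 (?F 0)\<bar> \<le> C * real n powr (- d / 16)" .
    have "EA x n (?F n) \<le> EA x n (\<lambda>_. 1)"
    proof (intro EA_mono lingrowth_cmult lingrowth_heat lingrowth_const x0)
      show "?F n y \<le> 1" for y using heat_abs_le[of "vv n v n" y] by (simp add: abs_le_iff)
    qed
    then have a: "EA x n (?F n) \<le> surv x n" by (simp add: EA_const)
    have b: "(\<Sum>k=0..<n. ED x k (?F (Suc k))) \<le> 0"
    proof (intro sum_nonpos)
      fix k assume "k \<in> {0..<n}"
      then have v1: "0 < vv n v (Suc k)" using vv_ge[of "Suc k" n v] v by simp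
      have "ED x k (?F (Suc k)) \<le> ED x k (\<lambda>_. 0)"
      proof (intro ED_mono lingrowth_cmult lingrowth_heat lingrowth_const)
        show "?F (Suc k) y \<le> 0" if "y < 0" for y using heat_mono[OF v1, of y 0] that by simp
      qed
      then show "ED x k (?F (Suc k)) \<le> 0" by (simp add: ED_def)
    qed
    have c: "EA x 0 (?F 0) \<ge> 1 - C * (real n / x\<^sup>2)"
    proof -
      have v0: "vv n v 0 = v + \<sigma>\<^sup>2 * real n" by (simp add: vv_def)
      have "1 - 2 * heat (vv n v 0) x \<le> vv n v 0 / x\<^sup>2"
        using x v unfolding v0 by (intro heat_tail) (auto intro: add_pos_nonneg)
      also have "\<dots> \<le> (1 + \<sigma>\<^sup>2) * real n / x\<^sup>2"
        using v unfolding v0 by (intro divide_right_mono) (auto simp: distrib_right)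
      also have "\<dots> \<le> C * (real n / x\<^sup>2)"
        unfolding times_divide_eq_right[symmetric] by (intro mult_right_mono) (auto simp: C_def)
      finally show ?thesis by (simp add: EA_0)
    qed
    show ?thesis using tele a b c unfolding distrib_left by linarith
  qed
  have "C > 0" by (simp add: C_def less_max_iff_disj add_pos_nonneg)
  then show ?thesis by (intro exI[of _ C] conjI allI impI main)
qed

text \<open>Here the exit terms are not expanded but bounded by twice the exit probability. The
  error does not grow with \<open>x\<close>, which is what \<open>comparison_small\<close> cannot
  offer for \<open>x\<close> far above sqrt n.\<close>

lemma comparison_large:
  "\<exists>C>0. \<forall>x>0. \<forall>n\<ge>1. \<forall>T\<ge>0.
    \<bar>EA x n (indicator {0..T}) - usol (\<sigma>\<^sup>2 * real n) T x\<bar> \<le> C * (real n / x\<^sup>2 + real n powr (- d / 16))"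
proof -
  obtain C1 where C1: "C1 > 0" "\<forall>x\<ge>0. \<forall>n\<ge>1. \<forall>T\<ge>0.
    \<bar>EA x n (indicator {0..T}) + (\<Sum>k<n. ED x k (usol (vv n (smooth n) (Suc k)) T)) - usol (\<sigma>\<^sup>2 * real n) T x\<bar>
      \<le> C1 * bnd x n * real n powr (- d / 16)"
    using comparison_exit by (elim exE conjE)
  obtain C2 where C2: "C2 > 0" "\<And>x n. x > 0 \<Longrightarrow> n \<ge> 1 \<Longrightarrow> 1 - surv x n \<le> C2 * (real n / x\<^sup>2 + real n powr (- d / 16))"
    using exit_probability by blast
  have main: "\<bar>EA x n (indicator {0..T}) - usol (\<sigma>\<^sup>2 * real n) T x\<bar> \<le> (C1 + 2 * C2) * (real n / x\<^sup>2 + real n powr (- d / 16))"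
    if x: "x > 0" and n: "n \<ge> 1" and T: "T \<ge> 0" for x n T
  proof -
    let ?u = "\<lambda>k. ED x k (usol (vv n (smooth n) (Suc k)) T)"
    have "\<bar>\<Sum>k<n. ?u k\<bar> \<le> (\<Sum>k<n. ED x k (\<lambda>_. 2))"
    proof (rule order_trans[OF sum_abs sum_mono])
      fix k
      have "?u k \<le> ED x k (\<lambda>_. 2)"
        by (intro ED_mono lingrowth_usol lingrowth_const abs_le_D1[OF usol_abs_le_2])
      moreover have "ED x k (\<lambda>_. - 1 * 2) \<le> ?u k"
      proof (intro ED_mono lingrowth_usol lingrowth_const)
        show "- 1 * 2 \<le> usol (vv n (smooth n) (Suc k)) T y" for y
          using abs_le_D2[OF usol_abs_le_2[of "vv n (smooth n) (Suc k)" T y]] by simp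
      qed
      ultimately show "\<bar>?u k\<bar> \<le> ED x k (\<lambda>_. 2)" unfolding ED_cmult by simp
    qed
    also have "\<dots> = 2 * (1 - surv x n)" by (rule ED_const_sum)
    also have "\<dots> \<le> 2 * (C2 * (real n / x\<^sup>2 + real n powr (- d / 16)))"
      by (intro mult_left_mono C2(2) x n) auto
    finally have a: "\<bar>\<Sum>k<n. ?u k\<bar> \<le> 2 * C2 * (real n / x\<^sup>2 + real n powr (- d / 16))" by simp
    have "C1 * bnd x n * real n powr (- d / 16) \<le> C1 * 1 * real n powr (- d / 16)"
      using C1(1) by (intro mult_right_mono mult_left_mono) (auto simp: bnd_def)
    also have "\<dots> \<le> C1 * (real n / x\<^sup>2 + real n powr (- d / 16))"
      using C1(1) by simp
    finally have b: "C1 * bnd x n * real n powr (- d / 16) \<le> C1 * (real n / x\<^sup>2 + real n powr (- d / 16))" .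
    show ?thesis
      using a b C1(2)[rule_format, OF less_imp_le[OF x] n T]
      unfolding distrib_right[of C1 "2 * C2"] by linarith
  qed
  have "C1 + 2 * C2 > 0" using C1(1) C2(1) by simp
  then show ?thesis by (intro exI[of _ "C1 + 2 * C2"] conjI allI impI main)
qed

end

section \<open>Identification of the quantities in the theorem\<close>

lemma less_Inf_enat_iff: "enat n < Inf A \<longleftrightarrow> (\<forall>a\<in>A. enat n < a)"
proof
  show "enat n < Inf A \<Longrightarrow> \<forall>a\<in>A. enat n < a" using Inf_lower less_le_trans by blast
  assume *: "\<forall>a\<in>A. enat n < a"
  show "enat n < Inf A"
  proof (cases "A = {}")
    case False
    then have "Inf A \<in> A" unfolding Inf_enat_def by (auto intro: LeastI)
    then show ?thesis using * by blast
  qed (simp add: Inf_enat_def)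
qed

text \<open>\<open>psi\<close> is the transition density of absorbed Brownian motion at unit
  variance; Brownian scaling by \<open>s\<close> turns its integral into
  \<open>usol\<close>.\<close>

lemma integral_psi:
  assumes s: "s > 0" and t: "t \<ge> 0"
  shows "integral {0..t} (\<lambda>z. psi z (x / s)) = usol (s\<^sup>2) (t * s) x"
proof -
  define a where "a = x / s"
  have "((\<lambda>z. gint (z - a) - gint (z + a)) has_vector_derivative psi z a) (at z within {0..t})" for z
    unfolding has_real_derivative_iff_has_vector_derivative[symmetric]
    by (auto intro!: derivative_eq_intros simp: psi_def gphi_def diff_divide_distrib)
  then have "((\<lambda>z. psi z a) has_integral (gint (t - a) - gint (t + a)) - (gint (0 - a) - gint (0 + a))) {0..t}"
    by (intro fundamental_theorem_of_calculus t) auto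
  then have "integral {0..t} (\<lambda>z. psi z a) = gint (t - a) - gint (t + a) + 2 * gint a"
    by (simp add: integral_unique gint_odd)
  moreover have "gint (t - a) = - gint (a - t)" using gint_odd[of "a - t"] by simp
  moreover have "usol (s\<^sup>2) (t * s) x = 2 * gint a - gint (a - t) - gint (a + t)"
    using s by (simp add: usol_def heat_def a_def diff_divide_distrib add_divide_distrib)
  ultimately show ?thesis by (simp add: a_def add.commute)
qed

text \<open>The Rayleigh distribution function of part (i) arises here, as the derivative at the
  boundary of the absorbed Brownian probability.\<close>

lemma uslope_Phi_plus:
  assumes s: "s > 0" and t: "t \<ge> 0"
  shows "uslope (s\<^sup>2) (t * s) = 2 / (s * sqrt (2 * pi)) * Phi_plus t"
proof -
  have "heat' (s\<^sup>2) 0 = 1 / (s * sqrt (2 * pi))" "heat' (s\<^sup>2) (t * s) = exp (- (t\<^sup>2 / 2)) / (s * sqrt (2 * pi))"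
    using s by (simp_all add: heat'_def gphi_def mult.commute)
  moreover have "Phi_plus t = 1 - exp (- (t\<^sup>2 / 2))" using t by (simp add: Phi_plus_def)
  ultimately show ?thesis unfolding uslope_def by (simp add: right_diff_distrib)
qed

context centred_walk
begin

section \<open>The exit time and \<open>V\<close> in terms of the killed walk\<close>

lemma exit_time_gt_iff: "enat n < exit_time X x w \<longleftrightarrow> (\<forall>j\<in>{1..n}. 0 \<le> Y x j w)"
proof -
  have "enat n < exit_time X x w \<longleftrightarrow> (\<forall>k. k \<ge> 1 \<and> Y x k w < 0 \<longrightarrow> n < k)"
    unfolding exit_time_def less_Inf_enat_iff Y_def by auto
  also have "\<dots> \<longleftrightarrow> (\<forall>j\<in>{1..n}. 0 \<le> Y x j w)"
    by (auto simp: not_less[symmetric])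
  finally show ?thesis .
qed

lemma measure_eq_EA:
  assumes x: "x \<ge> 0" and n: "n \<ge> 1"
  shows "measure M {w \<in> space M. (x + walk X n w) / (\<sigma> * sqrt (real n)) \<le> t \<and> exit_time X x w > enat n}
    = EA x n (indicator {0..t * (\<sigma> * sqrt (real n))})"
proof -
  have s: "\<sigma> * sqrt (real n) > 0" using sigma_pos n by simp
  let ?A = "{w \<in> space M. (x + walk X n w) / (\<sigma> * sqrt (real n)) \<le> t \<and> exit_time X x w > enat n}"
  have A: "?A = alive x n \<inter> {w \<in> space M. Y x n w \<le> t * (\<sigma> * sqrt (real n))}"
    using s by (auto simp: exit_time_gt_iff alive_def Y_def pos_divide_le_eq)
  then have "measure M ?A = (\<integral>w. indicator ?A w \<partial>M)" by simp
  also have "\<dots> = EA x n (indicator {0..t * (\<sigma> * sqrt (real n))})"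
    unfolding EA_def
    by (intro Bochner_Integration.integral_cong) (auto simp: A indicator_def dest: alive_nonneg[OF x])
  finally show ?thesis .
qed

lemma dies_exit_time:
  assumes "w \<in> dies x k"
  shows "exit_time X x w = enat (Suc k)"
proof (rule antisym)
  have "Y x (Suc k) w < 0" "\<forall>j\<in>{1..k}. 0 \<le> Y x j w" using assms by (auto simp: dies_def alive_def)
  then show "exit_time X x w \<le> enat (Suc k)"
    unfolding exit_time_def by (intro Inf_lower) (auto simp: Y_def)
  have "enat k < exit_time X x w" unfolding exit_time_gt_iff by fact
  then show "enat (Suc k) \<le> exit_time X x w" by (simp add: Suc_ile_eq)
qed

lemma exit_time_dies:
  assumes w: "w \<in> space M" and e: "exit_time X x w = enat j" and x: "x \<ge> 0"
  shows "\<exists>k. w \<in> dies x k"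
proof (rule ccontr)
  assume no: "\<nexists>k. w \<in> dies x k"
  have "w \<in> alive x n" for n
    by (induction n) (use w no in \<open>auto simp: alive_Suc dies_def not_less\<close>)
  then have "enat j < exit_time X x w" unfolding exit_time_gt_iff by (auto simp: alive_def)
  then show False using e by simp
qed

lemma surv_tendsto_0: "x \<ge> 0 \<Longrightarrow> surv x \<longlonglongrightarrow> 0"
proof -
  assume x: "x \<ge> 0"
  obtain Cs where Cs: "\<And>x n. x \<ge> 0 \<Longrightarrow> surv x n \<le> Cs * (1 + x) / sqrt (real n + 1)"
    using survival by blast
  have "filterlim (\<lambda>n. sqrt (real n + 1)) at_top sequentially"
    by (rule filterlim_compose[OF sqrt_at_top], rule filterlim_at_top_mono[OF filterlim_real_sequentially]) auto
  then have l: "(\<lambda>n. Cs * (1 + x) / sqrt (real n + 1)) \<longlonglongrightarrow> 0"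
    by (rule real_tendsto_divide_at_top[OF tendsto_const])
  show ?thesis
    by (rule tendsto_sandwich[OF _ _ tendsto_const l]) (use Cs[OF x] surv_nonneg in auto)
qed

text \<open>The partial sum \<open>f n\<close> equals -S at the exit time if exit occurs by time n,
  and 0 otherwise. Its terms are nonnegative because x is and the position at exit is negative, so
  monotone convergence applies and also delivers integrability.\<close>

lemma V_eq:
  assumes x: "x \<ge> 0"
  shows "V M X x = x + ov x"
proof -
  define g where "g k w = indicator (dies x k) w * (x - Y x (Suc k) w)" for k w
  define f where "f n w = (\<Sum>k<n. g k w)" for n w
  have g0: "g k w \<ge> 0" for k w using x by (auto simp: g_def dies_def indicator_def)
  have gi: "integrable M (g k)" for k
    unfolding g_def by (intro integrable_ind Bochner_Integration.integrable_diff integrable_Y) auto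
  have lim: "(\<lambda>n. f n w) \<longlonglongrightarrow> - walk_at_exit X x w" if w: "w \<in> space M" for w
  proof (cases "exit_time X x w")
    case (enat j)
    then obtain k where k: "w \<in> dies x k" using exit_time_dies[OF w _ x] by blast
    have "w \<notin> dies x i" if "i \<noteq> k" for i
      using dies_exit_time[of w x i] dies_exit_time[OF k] that by auto
    then have gk: "g i w = (if i = k then x - Y x (Suc k) w else 0)" for i
      using k by (auto simp: g_def)
    have "f n w = x - Y x (Suc k) w" if "n \<ge> Suc k" for n
      unfolding f_def gk using that by simp
    then have "\<forall>\<^sub>F n in sequentially. f n w = x - Y x (Suc k) w"
      unfolding eventually_sequentially by blast
    moreover have "x - Y x (Suc k) w = - walk_at_exit X x w"
      unfolding walk_at_exit_def dies_exit_time[OF k] by (simp add: Y_def)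
    ultimately show ?thesis by (simp add: tendsto_eventually)
  next
    \<comment> \<open>All terms vanish, in agreement with the dummy value 0 of
      \<open>walk_at_exit\<close>; the limit therefore holds at every point and not only almost
      surely.\<close>
    case infinity
    have "w \<notin> dies x i" for i
      using dies_exit_time[of w x i] infinity by auto
    then have "g i w = 0" for i
      by (simp add: g_def)
    then show ?thesis by (simp add: f_def walk_at_exit_def infinity)
  qed
  have fi: "integrable M (f n)" for n unfolding f_def by (intro Bochner_Integration.integrable_sum gi)
  have fint: "(\<integral>w. f n w \<partial>M) = x * (1 - surv x n) + (\<Sum>k<n. over x k)" for n
  proof -
    have "(\<integral>w. f n w \<partial>M) = (\<Sum>k<n. (\<integral>w. g k w \<partial>M))"
      unfolding f_def by (intro Bochner_Integration.integral_sum gi)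
    also have "\<dots> = (\<Sum>k<n. ED x k (\<lambda>_. x) + over x k)"
    proof (intro sum.cong refl)
      fix k
      have "ED x k (\<lambda>y. x - y) = ED x k (\<lambda>_. x) - ED x k (\<lambda>y. y)"
        by (intro ED_diff lingrowth_const lingrowth_id)
      moreover have "ED x k (\<lambda>y. y) = - over x k" using ED_linear[of x k 1] by simp
      moreover have "(\<integral>w. g k w \<partial>M) = ED x k (\<lambda>y. x - y)" by (simp add: g_def ED_def)
      ultimately show "(\<integral>w. g k w \<partial>M) = ED x k (\<lambda>_. x) + over x k" by simp
    qed
    finally show ?thesis by (simp add: sum.distrib ED_const_sum)
  qed
  \<comment> \<open>Vanishing survival probability is the statement that exit is almost sure; it
    turns the first summand into x.\<close>
  have "(\<lambda>n. x * (1 - surv x n) + (\<Sum>k<n. over x k)) \<longlonglongrightarrow> x * (1 - 0) + ov x"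
    unfolding ov_def by (intro tendsto_intros surv_tendsto_0 x summable_LIMSEQ over_summable)
  then have L: "(\<lambda>n. \<integral>w. f n w \<partial>M) \<longlonglongrightarrow> x + ov x" by (simp add: fint)
  have "(\<integral>w. - walk_at_exit X x w \<partial>M) = x + ov x"
  proof (rule integral_monotone_convergence[OF fi _ _ L])
    show "AE w in M. mono (\<lambda>n. f n w)"
      unfolding f_def by (intro AE_I2 monoI sum_mono2 g0) auto
    show "AE w in M. (\<lambda>n. f n w) \<longlonglongrightarrow> - walk_at_exit X x w" using lim by (intro AE_I2)
    show "(\<lambda>w. - walk_at_exit X x w) \<in> borel_measurable M"
      by (rule borel_measurable_LIMSEQ_real[of M f]) (use lim fi in \<open>auto intro: borel_measurable_integrable\<close>)
  qed
  then show ?thesis by (simp add: V_def)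
qed

section \<open>The two regimes\<close>

lemma sqrt_powr: "1 / sqrt (real n) = real n powr (- 1 / 2)"
  by (simp add: powr_minus_divide powr_half_sqrt)

text \<open>Linearising \<open>usol\<close> at 0 adds x times the slope to the overshoot term, and
  together they form slope times V(x). The price is of order x^2 / n, at most a constant times
  \<alpha> (1 + x) / sqrt n, which is the origin of the \<alpha> in the bound.\<close>

lemma small_start:
  "\<exists>c>0. \<forall>n\<ge>1. \<forall>t\<ge>0. \<forall>x\<ge>0. \<forall>\<alpha>. x \<le> \<alpha> * sqrt (real n) \<longrightarrow>
    \<bar>EA x n (indicator {0..t * (\<sigma> * sqrt (real n))}) - 2 * V M X x / (\<sigma> * sqrt (2 * pi * real n)) * Phi_plus t\<bar>
      \<le> c * (\<alpha> + real n powr (- (d / 16))) * ((1 + x) / real n powr (1/2))"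
proof -
  obtain C where C: "C > 0" "\<forall>x\<ge>0. \<forall>n\<ge>1. \<forall>T\<ge>0.
    \<bar>EA x n (indicator {0..T}) - usol (\<sigma>\<^sup>2 * real n) T x - uslope (\<sigma>\<^sup>2 * real n) T * ov x\<bar>
      \<le> C * ((1 + x) * real n powr (- 1 / 2 - d / 16))"
    using comparison_small by (elim exE conjE)
  have main: "\<bar>EA x n (indicator {0..t * (\<sigma> * sqrt (real n))}) - 2 * V M X x / (\<sigma> * sqrt (2 * pi * real n)) * Phi_plus t\<bar>
      \<le> (C + 4 / \<sigma>\<^sup>2) * (\<alpha> + real n powr (- (d / 16))) * ((1 + x) / real n powr (1/2))"
    if n: "n \<ge> 1" and t: "t \<ge> 0" and x: "x \<ge> 0" and \<alpha>: "x \<le> \<alpha> * sqrt (real n)" for n t x \<alpha>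
  proof -
    define s where "s = \<sigma> * sqrt (real n)"
    have s: "s > 0" using sigma_pos n by (simp add: s_def)
    have s2: "\<sigma>\<^sup>2 * real n = s\<^sup>2" by (simp add: s_def power_mult_distrib)
    define U where "U = uslope (s\<^sup>2) (t * s)"
    define r where "r = (1 + x) / sqrt (real n)"
    define q where "q = real n powr (- (d / 16))"
    have r: "r \<ge> 0" and q: "q \<ge> 0" using x by (auto simp: r_def q_def)
    have "(1 + x) * real n powr (- 1 / 2 - d / 16) = (1 + x) * (real n powr (- 1 / 2) * real n powr (- (d / 16)))"
      by (simp flip: powr_add)
    also have "\<dots> = r * q" unfolding sqrt_powr[symmetric] by (simp add: r_def q_def)
    finally have e: "\<bar>EA x n (indicator {0..t * s}) - usol (s\<^sup>2) (t * s) x - U * ov x\<bar> \<le> C * (r * q)"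
      using C(2)[rule_format, OF x n, of "t * s"] s t by (simp add: s2 U_def)
    have an: "x / sqrt (real n) \<le> \<alpha>" using \<alpha> n by (simp add: pos_divide_le_eq)
    have a0: "\<alpha> \<ge> 0" by (rule order_trans[OF _ an]) (use x in simp)
    have "\<bar>usol (s\<^sup>2) (t * s) x - x * U\<bar> \<le> 4 * (x\<^sup>2 / s\<^sup>2)"
      unfolding U_def using s by (intro usol_linear) simp
    also have "\<dots> = 4 / \<sigma>\<^sup>2 * ((x / sqrt (real n)) * (x / sqrt (real n)))"
      by (simp add: s_def power_mult_distrib power2_eq_square)
    also have "\<dots> \<le> 4 / \<sigma>\<^sup>2 * (\<alpha> * r)"
      using an x a0 by (intro mult_left_mono mult_mono) (auto simp: r_def intro: divide_right_mono)
    finally have u: "\<bar>usol (s\<^sup>2) (t * s) x - x * U\<bar> \<le> 4 / \<sigma>\<^sup>2 * (\<alpha> * r)" .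
    have U: "U = 2 / (s * sqrt (2 * pi)) * Phi_plus t"
      unfolding U_def by (rule uslope_Phi_plus[OF s t])
    have "2 * V M X x / (\<sigma> * sqrt (2 * pi * real n)) * Phi_plus t = U * V M X x"
      unfolding U s_def by (simp add: real_sqrt_mult mult_ac)
    also have "\<dots> = x * U + U * ov x" unfolding V_eq[OF x] by (simp add: algebra_simps)
    finally have "\<bar>EA x n (indicator {0..t * s}) - 2 * V M X x / (\<sigma> * sqrt (2 * pi * real n)) * Phi_plus t\<bar>
        \<le> C * (r * q) + 4 / \<sigma>\<^sup>2 * (\<alpha> * r)"
      using e u by linarith
    also have "\<dots> \<le> (C + 4 / \<sigma>\<^sup>2) * (\<alpha> + q) * r"
    proof -
      have "0 \<le> C * (\<alpha> * r)" "0 \<le> 4 / \<sigma>\<^sup>2 * (q * r)" using C(1) a0 r q by auto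
      moreover have "(C + e) * (\<alpha> + q) * r = C * (r * q) + e * (\<alpha> * r) + C * (\<alpha> * r) + e * (q * r)" for e
        by (simp add: algebra_simps)
      ultimately show ?thesis by simp
    qed
    also have "r = (1 + x) / real n powr (1/2)" by (simp add: r_def powr_half_sqrt)
    finally show ?thesis unfolding s_def q_def .
  qed
  have "C + 4 / \<sigma>\<^sup>2 > 0" using C(1) by (simp add: add_pos_nonneg)
  then show ?thesis by (intro exI[of _ "C + 4 / \<sigma>\<^sup>2"] conjI allI impI main)
qed

text \<open>Three ranges of \<open>x\<close>. Up to n^(1/2 - d/64), the overshoot term (1 + x)^(1-d)
  / sqrt n gains (1 + x)^(-d), at most n^(-d \<beta>). Above it the right-hand side no longer grows
  with \<open>x\<close>, and the aim becomes n^(-d/32). This follows from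
  \<open>comparison_small\<close> up to n^(1/2 + d/32) and from \<open>comparison_large\<close>
  beyond.\<close>

lemma large_start:
  "\<exists>c>0. \<forall>\<beta>\<in>{0<..<1/2 - d / 64}. \<forall>n\<ge>1. \<forall>T\<ge>0. \<forall>x\<ge>real n powr \<beta>.
    \<bar>EA x n (indicator {0..T}) - usol (\<sigma>\<^sup>2 * real n) T x\<bar>
      \<le> c * ((1 + min x (real n powr (1/2 - d / 64))) / real n powr (1/2 + d / 64 * \<beta>))"
proof -
  obtain C where C: "C > 0" "\<forall>x\<ge>0. \<forall>n\<ge>1. \<forall>T\<ge>0.
    \<bar>EA x n (indicator {0..T}) - usol (\<sigma>\<^sup>2 * real n) T x - uslope (\<sigma>\<^sup>2 * real n) T * ov x\<bar>
      \<le> C * ((1 + x) * real n powr (- 1 / 2 - d / 16))"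
    using comparison_small by (elim exE conjE)
  obtain C' where C': "C' > 0" "\<forall>x>0. \<forall>n\<ge>1. \<forall>T\<ge>0.
    \<bar>EA x n (indicator {0..T}) - usol (\<sigma>\<^sup>2 * real n) T x\<bar> \<le> C' * (real n / x\<^sup>2 + real n powr (- d / 16))"
    using comparison_large by (elim exE conjE)
  obtain Co where Co: "Co > 0" "\<And>x. x \<ge> 0 \<Longrightarrow> ov x \<le> Co * (1 + x) powr (1 - d)"
    using ov_bound by blast
  define K where "K = max (4 * Co / \<sigma> + 2 * C) (2 * C')"
  have Kpos: "K > 0" using C'(1) by (simp add: K_def less_max_iff_disj)
  have main: "\<bar>EA x n (indicator {0..T}) - usol (\<sigma>\<^sup>2 * real n) T x\<bar>
      \<le> K * ((1 + min x (real n powr (1/2 - d / 64))) / real n powr (1/2 + d / 64 * \<beta>))"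
    if \<beta>: "\<beta> \<in> {0<..<1/2 - d / 64}" and n: "n \<ge> 1" and T: "T \<ge> 0" and x: "x \<ge> real n powr \<beta>" for \<beta> n T x
  proof -
    have n0: "real n > 0" using n by simp
    have \<beta>': "0 < \<beta>" "\<beta> < 1/2" using \<beta> d_pos by auto
    have nb: "real n powr \<beta> \<ge> 1" using n \<beta>' by (intro ge_one_powr_ge_zero) auto
    have x1: "x \<ge> 1" using x nb by linarith
    define p where "p = real n powr (1/2 + d / 64 * \<beta>)"
    have p: "p > 0" using n0 by (simp add: p_def)
    have db: "d * \<beta> \<le> d * (1/2)" "0 \<le> d * \<beta>" using d_pos \<beta>' by (auto intro: mult_left_mono)
    define L where "L = \<bar>EA x n (indicator {0..T}) - usol (\<sigma>\<^sup>2 * real n) T x\<bar>"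
    have small: "L \<le> 2 / \<sigma> * Co * ((1 + x) powr (1 - d) * real n powr (- 1 / 2)) + C * ((1 + x) * real n powr (- 1 / 2 - d / 16))"
    proof -
      have "\<bar>uslope (\<sigma>\<^sup>2 * real n) T * ov x\<bar> = \<bar>uslope (\<sigma>\<^sup>2 * real n) T\<bar> * ov x"
        using ov_nonneg[of x] x1 by (simp add: abs_mult)
      also have "\<dots> \<le> (2 / sqrt (\<sigma>\<^sup>2 * real n)) * (Co * (1 + x) powr (1 - d))"
        using sigma_pos n0 x1 ov_nonneg[of x] by (intro mult_mono uslope_abs_le Co) auto
      also have "\<dots> = 2 / \<sigma> * Co * ((1 + x) powr (1 - d) * (1 / sqrt (real n)))"
        using sigma_pos by (simp add: real_sqrt_mult)
      also have "\<dots> = 2 / \<sigma> * Co * ((1 + x) powr (1 - d) * real n powr (- 1 / 2))" unfolding sqrt_powr ..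
      finally show ?thesis
        using C(2)[rule_format, of x n T] x1 n T unfolding L_def by linarith
    qed
    have x_pow: "(1 + x) powr (1 - d) = (1 + x) * (1 + x) powr (- d)"
      using x1 powr_add[of "1 + x" 1 "- d"] by simp
    have "L \<le> K * ((1 + min x (real n powr (1/2 - d / 64))) / p)"
    proof (cases "x \<le> real n powr (1/2 - d / 64)")
      case True
      have ip: "real n powr (- 1 / 2 - d / 64 * \<beta>) = 1 / p"
      proof -
        have "- 1 / 2 - d / 64 * \<beta> = - (1/2 + d / 64 * \<beta>)" by simp
        then show ?thesis unfolding p_def by (simp only: powr_minus_divide)
      qed
      have "(1 + x) powr (- d) \<le> (real n powr \<beta>) powr (- d)"
        using x nb d_pos n by (intro powr_mono2') auto
      also have "\<dots> = real n powr (\<beta> * (- d))" by (rule powr_powr)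
      also have "\<dots> \<le> real n powr (- (d / 64 * \<beta>))"
        using n db by (intro npowr_mono) (auto simp: algebra_simps)
      finally have "(1 + x) powr (1 - d) * real n powr (- 1 / 2) \<le> (1 + x) * real n powr (- (d / 64 * \<beta>)) * real n powr (- 1 / 2)"
        unfolding x_pow using x1 by (intro mult_right_mono mult_left_mono) auto
      also have "\<dots> = (1 + x) * (1 / p)"
        unfolding ip[symmetric] mult.assoc by (simp flip: powr_add add: algebra_simps)
      finally have 1: "(1 + x) powr (1 - d) * real n powr (- 1 / 2) \<le> (1 + x) / p" by simp
      have "real n powr (- 1 / 2 - d / 16) \<le> real n powr (- 1 / 2 - d / 64 * \<beta>)"
        using n db d_pos by (intro npowr_mono) auto
      then have 2: "(1 + x) * real n powr (- 1 / 2 - d / 16) \<le> (1 + x) / p"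
        unfolding ip using x1 mult_left_mono[of _ "1 / p" "1 + x"] by simp
      have "L \<le> 2 / \<sigma> * Co * ((1 + x) / p) + C * ((1 + x) / p)"
        using Co(1) C(1) sigma_pos by (intro order_trans[OF small] add_mono mult_left_mono 1 2) auto
      also have "\<dots> = (2 * Co / \<sigma> + C) * ((1 + x) / p)" unfolding distrib_right by simp
      also have "\<dots> \<le> K * ((1 + x) / p)"
      proof (intro mult_right_mono)
        have "0 \<le> Co / \<sigma>" using Co(1) sigma_pos by simp
        then have "2 * Co / \<sigma> + C \<le> 4 * Co / \<sigma> + 2 * C" using C(1) by simp
        then show "2 * Co / \<sigma> + C \<le> K" by (simp add: K_def)
      qed (use x1 p in auto)
      finally show ?thesis using True by (simp add: min_def)
    next
      case False
      \<comment> \<open>Once the minimum has reached n^(1/2 - d/64), the right-hand side is at least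
        n to the power -d(1 + \<beta>)/64, and \<beta> < 1.\<close>
      have goal: "real n powr (- (d / 32)) \<le> (1 + min x (real n powr (1/2 - d / 64))) / p"
      proof -
        have "real n powr (- (d / 32)) \<le> real n powr (1/2 - d / 64 - (1/2 + d / 64 * \<beta>))"
          using n db d_pos by (intro npowr_mono) (auto simp: algebra_simps)
        also have "\<dots> = real n powr (1/2 - d / 64) / p" unfolding p_def by (rule powr_diff)
        also have "\<dots> \<le> (1 + min x (real n powr (1/2 - d / 64))) / p"
          using False p by (intro divide_right_mono) auto
        finally show ?thesis .
      qed
      have "L \<le> K * real n powr (- (d / 32))"
      \<comment> \<open>The threshold spends half of the gain d/16 of
        \<open>comparison_small\<close>. Below it the error (1 + x) n^(-1/2 - d/16) is still
        O(n^(-d/32)); above it n / x^2 is at most n^(-d/16).\<close>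
      proof (cases "x \<le> real n powr (1/2 + d / 32)")
        case True
        define z where "z = real n powr (1/2 + d / 32)"
        have xz: "1 + x \<le> 2 * z" using True x1 by (simp add: z_def)
        have z0: "z > 0" using n0 by (simp add: z_def)
        have "(1 + x) powr (1 - d) \<le> (2 * z) powr (1 - d)"
          using xz x1 d_le by (intro powr_mono2) auto
        also have "\<dots> = 2 powr (1 - d) * z powr (1 - d)" by (rule powr_mult)
        also have "\<dots> \<le> 2 powr 1 * z powr (1 - d)" using d_pos by (intro mult_right_mono powr_mono) auto
        finally have "(1 + x) powr (1 - d) * real n powr (- 1 / 2) \<le> 2 * z powr (1 - d) * real n powr (- 1 / 2)"
          by (intro mult_right_mono) auto
        also have "\<dots> = 2 * real n powr ((1/2 + d / 32) * (1 - d) + - 1 / 2)"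
          unfolding z_def powr_powr mult.assoc powr_add[symmetric] ..
        also have "\<dots> \<le> 2 * real n powr (- (d / 32))"
        proof (intro mult_left_mono npowr_mono n)
          have "(1/2 + d / 32) * (1 - d) + - 1 / 2 = d / 32 - d / 2 - d * d / 32" by (simp add: field_simps)
          moreover have "0 \<le> d * d" by simp
          ultimately show "(1/2 + d / 32) * (1 - d) + - 1 / 2 \<le> - (d / 32)" using d_pos by linarith
        qed simp
        finally have 1: "(1 + x) powr (1 - d) * real n powr (- 1 / 2) \<le> 2 * real n powr (- (d / 32))" .
        have "(1 + x) * real n powr (- 1 / 2 - d / 16) \<le> 2 * z * real n powr (- 1 / 2 - d / 16)"
          using xz by (intro mult_right_mono) auto
        also have "\<dots> = 2 * real n powr ((1/2 + d / 32) + (- 1 / 2 - d / 16))"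
          unfolding z_def mult.assoc powr_add[symmetric] ..
        also have "(1/2 + d / 32) + (- 1 / 2 - d / 16) = - (d / 32)" by simp
        finally have 2: "(1 + x) * real n powr (- 1 / 2 - d / 16) \<le> 2 * real n powr (- (d / 32))" .
        have "L \<le> 2 / \<sigma> * Co * (2 * real n powr (- (d / 32))) + C * (2 * real n powr (- (d / 32)))"
          using Co(1) C(1) sigma_pos by (intro order_trans[OF small] add_mono mult_left_mono 1 2) auto
        also have "\<dots> = (4 * Co / \<sigma> + 2 * C) * real n powr (- (d / 32))" by (simp add: distrib_right)
        also have "\<dots> \<le> K * real n powr (- (d / 32))" by (intro mult_right_mono) (auto simp: K_def)
        finally show ?thesis .
      next
        case False
        define z where "z = real n powr (1/2 + d / 32)"
        have xz: "z \<le> x" and z0: "z > 0" using False n0 by (auto simp: z_def)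
        have "real n / x\<^sup>2 \<le> real n / z\<^sup>2"
          using xz z0 x1 by (intro divide_left_mono power_mono mult_pos_pos) auto
        also have "\<dots> = real n powr (1 - (1 + d / 16))"
        proof -
          have "z\<^sup>2 = real n powr (1 + d / 16)"
            by (simp add: z_def power2_eq_square flip: powr_add)
          then show ?thesis unfolding powr_diff using n0 by simp
        qed
        also have "\<dots> \<le> real n powr (- (d / 32))" using n d_pos by (intro npowr_mono) auto
        finally have 1: "real n / x\<^sup>2 \<le> real n powr (- (d / 32))" .
        have 2: "real n powr (- d / 16) \<le> real n powr (- (d / 32))" using n d_pos by (intro npowr_mono) auto
        have "L \<le> C' * (real n / x\<^sup>2 + real n powr (- d / 16))"
          unfolding L_def using C'(2) x1 n T by simp
        also have "\<dots> \<le> C' * (real n powr (- (d / 32)) + real n powr (- (d / 32)))"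
          using C'(1) by (intro mult_left_mono add_mono 1 2) auto
        also have "\<dots> = (2 * C') * real n powr (- (d / 32))" by simp
        also have "\<dots> \<le> K * real n powr (- (d / 32))" by (intro mult_right_mono) (auto simp: K_def)
        finally show ?thesis .
      qed
      also have "\<dots> \<le> K * ((1 + min x (real n powr (1/2 - d / 64))) / p)"
        using Kpos by (intro mult_left_mono goal) auto
      finally show ?thesis .
    qed
    then show ?thesis unfolding L_def p_def .
  qed
  show ?thesis
    by (intro exI[of _ K] conjI Kpos ballI allI impI main)
qed

end

theorem corollary2p9:
  fixes M :: "'a measure" and X :: "nat \<Rightarrow> 'a \<Rightarrow> real" and \<sigma> \<delta> :: real
  assumes "prob_space M"
    and indep: "prob_space.indep_vars M (\<lambda>_. borel) X {1..}"
    and ident: "\<And>i. i \<ge> 1 \<Longrightarrow> distr M borel (X i) = distr M borel (X 1)"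
    and mean: "integrable M (X 1)" "(\<integral>w. X 1 w \<partial>M) = 0"
    and var: "\<sigma> > 0" "integrable M (\<lambda>w. (X 1 w)\<^sup>2)" "(\<integral>w. (X 1 w)\<^sup>2 \<partial>M) = \<sigma>\<^sup>2"
    and moment: "\<delta> > 0" "integrable M (\<lambda>w. \<bar>X 1 w\<bar> powr (2 + \<delta>))"
  shows
    "(\<exists>\<epsilon>>0. \<exists>c>0. \<forall>\<alpha> :: nat \<Rightarrow> real. (\<forall>n\<ge>1. \<alpha> n > 0) \<longrightarrow> \<alpha> \<longlonglongrightarrow> 0 \<longrightarrow>
       (\<forall>n::nat. n \<ge> 1 \<longrightarrow> (\<forall>t\<ge>0. \<forall>x\<in>{0..\<alpha> n * sqrt (real n)}.
         \<bar>measure M {w \<in> space M. (x + walk X n w) / (\<sigma> * sqrt (real n)) \<le> t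
                                  \<and> exit_time X x w > enat n}
            - 2 * V M X x / (\<sigma> * sqrt (2 * pi * real n)) * Phi_plus t\<bar>
         \<le> c * (\<alpha> n + real n powr (- \<epsilon>)) * ((1 + x) / real n powr (1/2)))))
     \<and>
     (\<exists>\<epsilon>\<in>{0<..<1/2}. \<exists>c>0. \<forall>\<beta>\<in>{0<..<1/2 - \<epsilon>}.
       (\<forall>n::nat. n \<ge> 1 \<longrightarrow> (\<forall>t\<ge>0. \<forall>x\<ge>real n powr \<beta>.
         \<bar>measure M {w \<in> space M. (x + walk X n w) / (\<sigma> * sqrt (real n)) \<le> t
                                  \<and> exit_time X x w > enat n}
            - integral {0..t} (\<lambda>s. psi s (x / (\<sigma> * sqrt (real n))))\<bar>
         \<le> c * ((1 + min x (real n powr (1/2 - \<epsilon>))) / real n powr (1/2 + \<epsilon> * \<beta>)))))"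
proof -
  interpret prob_space M by fact
  \<comment> \<open>Then 2 + 2d is at most 2 + \<delta>, so the moment is finite, and at most 3, as
    the Taylor estimates require.\<close>
  define d where "d = min (\<delta> / 2) (1/2)"
  have d: "0 < d" "d \<le> 1/2" "2 * d \<le> \<delta>" using moment(1) by (auto simp: d_def)
  have X1: "X 1 \<in> borel_measurable M" using mean(1) by auto
  have pw: "integrable M (\<lambda>w. \<bar>X 1 w\<bar> powr (2 + 2 * d))"
  proof (rule Bochner_Integration.integrable_bound)
    show "integrable M (\<lambda>w. 1 + \<bar>X 1 w\<bar> powr (2 + \<delta>))" using moment(2) by auto
    show "(\<lambda>w. \<bar>X 1 w\<bar> powr (2 + 2 * d)) \<in> borel_measurable M" using X1 by measurable
    have "\<bar>z\<bar> powr (2 + 2 * d) \<le> 1 + \<bar>z\<bar> powr (2 + \<delta>)" for z :: real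
    proof (cases "\<bar>z\<bar> \<le> 1")
      case True
      then have "\<bar>z\<bar> powr (2 + 2 * d) \<le> 1" using d by (intro powr_le1) auto
      then show ?thesis using powr_ge_zero[of "\<bar>z\<bar>" "2 + \<delta>"] by linarith
    next
      case False
      then have "\<bar>z\<bar> powr (2 + 2 * d) \<le> \<bar>z\<bar> powr (2 + \<delta>)" using d by (intro powr_mono) auto
      then show ?thesis by linarith
    qed
    then show "AE w in M. norm (\<bar>X 1 w\<bar> powr (2 + 2 * d)) \<le> norm (1 + \<bar>X 1 w\<bar> powr (2 + \<delta>))"
      by (auto simp: abs_of_nonneg add_nonneg_nonneg)
  qed
  interpret centred_walk M X \<sigma> d
    by unfold_locales (fact indep ident mean var d pw)+
  obtain c1 where c1: "c1 > 0" "\<forall>n\<ge>1. \<forall>t\<ge>0. \<forall>x\<ge>0. \<forall>\<alpha>. x \<le> \<alpha> * sqrt (real n) \<longrightarrow>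
    \<bar>EA x n (indicator {0..t * (\<sigma> * sqrt (real n))}) - 2 * V M X x / (\<sigma> * sqrt (2 * pi * real n)) * Phi_plus t\<bar>
      \<le> c1 * (\<alpha> + real n powr (- (d / 16))) * ((1 + x) / real n powr (1/2))"
    using small_start by (elim exE conjE)
  obtain c2 where c2: "c2 > 0" "\<forall>\<beta>\<in>{0<..<1/2 - d / 64}. \<forall>n\<ge>1. \<forall>T\<ge>0. \<forall>x\<ge>real n powr \<beta>.
    \<bar>EA x n (indicator {0..T}) - usol (\<sigma>\<^sup>2 * real n) T x\<bar>
      \<le> c2 * ((1 + min x (real n powr (1/2 - d / 64))) / real n powr (1/2 + d / 64 * \<beta>))"
    using large_start by (elim exE conjE)
  have i: "\<bar>measure M {w \<in> space M. (x + walk X n w) / (\<sigma> * sqrt (real n)) \<le> t \<and> exit_time X x w > enat n}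
        - 2 * V M X x / (\<sigma> * sqrt (2 * pi * real n)) * Phi_plus t\<bar>
      \<le> c1 * (\<alpha> n + real n powr (- (d / 16))) * ((1 + x) / real n powr (1/2))"
    if n: "n \<ge> 1" and t: "t \<ge> 0" and x: "x \<in> {0..\<alpha> n * sqrt (real n)}" for \<alpha> :: "nat \<Rightarrow> real" and n t x
  proof -
    have x': "0 \<le> x" "x \<le> \<alpha> n * sqrt (real n)" using x by auto
    show ?thesis
      unfolding measure_eq_EA[OF x'(1) n] by (rule c1(2)[rule_format, OF n t x'])
  qed
  have ii: "\<bar>measure M {w \<in> space M. (x + walk X n w) / (\<sigma> * sqrt (real n)) \<le> t \<and> exit_time X x w > enat n}
        - integral {0..t} (\<lambda>s. psi s (x / (\<sigma> * sqrt (real n))))\<bar>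
      \<le> c2 * ((1 + min x (real n powr (1/2 - d / 64))) / real n powr (1/2 + d / 64 * \<beta>))"
    if \<beta>: "\<beta> \<in> {0<..<1/2 - d / 64}" and n: "n \<ge> 1" and t: "t \<ge> 0" and x: "real n powr \<beta> \<le> x" for \<beta> n t x
  proof -
    have x0: "x \<ge> 0" by (rule order_trans[OF _ x]) simp
    have s: "\<sigma> * sqrt (real n) > 0" using var(1) n by simp
    have s2: "(\<sigma> * sqrt (real n))\<^sup>2 = \<sigma>\<^sup>2 * real n" by (simp add: power_mult_distrib)
    have T: "t * (\<sigma> * sqrt (real n)) \<ge> 0" using t s by simp
    show ?thesis
      unfolding measure_eq_EA[OF x0 n] integral_psi[OF s t] s2
      by (rule c2(2)[rule_format, OF \<beta> n T x])
  qed
  show ?thesis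
  proof (rule conjI)
    show "\<exists>\<epsilon>>0. \<exists>c>0. \<forall>\<alpha> :: nat \<Rightarrow> real. (\<forall>n\<ge>1. \<alpha> n > 0) \<longrightarrow> \<alpha> \<longlonglongrightarrow> 0 \<longrightarrow>
       (\<forall>n::nat. n \<ge> 1 \<longrightarrow> (\<forall>t\<ge>0. \<forall>x\<in>{0..\<alpha> n * sqrt (real n)}.
         \<bar>measure M {w \<in> space M. (x + walk X n w) / (\<sigma> * sqrt (real n)) \<le> t
                                  \<and> exit_time X x w > enat n}
            - 2 * V M X x / (\<sigma> * sqrt (2 * pi * real n)) * Phi_plus t\<bar>
         \<le> c * (\<alpha> n + real n powr (- \<epsilon>)) * ((1 + x) / real n powr (1/2))))"
      by (rule exI[of _ "d / 16"], rule conjI, use d in simp, rule exI[of _ c1], rule conjI, rule c1(1),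
          intro allI impI ballI i)
    show "\<exists>\<epsilon>\<in>{0<..<1/2}. \<exists>c>0. \<forall>\<beta>\<in>{0<..<1/2 - \<epsilon>}.
       (\<forall>n::nat. n \<ge> 1 \<longrightarrow> (\<forall>t\<ge>0. \<forall>x\<ge>real n powr \<beta>.
         \<bar>measure M {w \<in> space M. (x + walk X n w) / (\<sigma> * sqrt (real n)) \<le> t
                                  \<and> exit_time X x w > enat n}
            - integral {0..t} (\<lambda>s. psi s (x / (\<sigma> * sqrt (real n))))\<bar>
         \<le> c * ((1 + min x (real n powr (1/2 - \<epsilon>))) / real n powr (1/2 + \<epsilon> * \<beta>))))"
      by (rule bexI[of _ "d / 64"], rule exI[of _ c2], rule conjI, rule c2(1),
          intro allI impI ballI ii, use d in auto)
  qed
qed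

end
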